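(* Let $(M,g)$ be a K\"ahler-Einstein manifold of complex dimension $n$ with $\operatorname{Ric}(g)=\lambda g$ for some $\lambda\in\mathbb{R}$, and let $\{S_A\}$ be a unitary eigenbasis of $S^{2,0}$ for the Calabi curvature operator $C$, with $C(S_A)=\sigma_A S_A$. Then $$\operatorname{Ric}_L(R,\overline R)=4\sum_A\sigma_A|S_AR|^2+16\operatorname{tr}(C^3)-16\lambda\operatorname{tr}(C^2).$$
   Context: Conventions. $\{Z_\alpha\}_{\alpha=1}^n$ is a local unitary frame of $T^{1,0}M$, with $g$ extended complex bilinearly and $g(Z_\alpha,\bar Z_\beta)=\delta_{\alpha\beta}$. Pairs of repeated indices, one barred and one unbarred, are summed from $1$ to $n$. $R_{\alpha\bar\beta\gamma\bar\delta}$ is the K\"ahler curvature tensor, with sign such that $R_{\alpha\bar\alpha\alpha\bar\alpha}$ (no sum) is the holomorphic sectional curvature (positive on $\mathbb{CP}^n$). $R_{\alpha\bar\beta}=R_{\alpha\bar\beta\gamma\bar\gamma}$, and $\operatorname{Ric}(g)=\lambda g$ reads $R_{\alpha\bar\beta}=\lambda g_{\alpha\bar\beta}$. Norms. $|T|^2$ is the full tensor norm $\sum|T_{i_1\dots i_k}|^2$, each index running over barred and unbarred indices. $|T_{\alpha\bar\beta\gamma\bar\delta}|^2$ is only the sum over components with bars in the indicated positions (so $|R|^2=4|R_{\alpha\bar\beta\gamma\bar\delta}|^2$), and similarly $|\nabla_\mu R_{\alpha\bar\beta\gamma\bar\delta}|^2$, $|\nabla_{\bar\mu}R_{\alpha\bar\beta\gamma\bar\delta}|^2$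 are summed over all of $\mu,\alpha,\beta,\gamma,\delta$. The term $\operatorname{Ric}_L$. With $\Delta^{\mathbb{C}}=\frac12(\nabla_\mu\nabla_{\bar\mu}+\nabla_{\bar\mu}\nabla_\mu)$ (half the real Laplacian), the zeroth order curvature term $\operatorname{Ric}_L(R,\overline R)$ of a K\"ahler-Einstein manifold is the one in the Bochner formula $$\Delta^{\mathbb{C}}|R_{\alpha\bar\beta\gamma\bar\delta}|^2=|\nabla_\mu R_{\alpha\bar\beta\gamma\bar\delta}|^2+|\nabla_{\bar\mu}R_{\alpha\bar\beta\gamma\bar\delta}|^2+\tfrac18\operatorname{Ric}_L(R,\overline R).$$ Calabi operator. $S^{2,0}\subset T^{1,0}M\otimes T^{1,0}M$ is the bundle of symmetric $(2,0)$-tensors with the Hermitian inner product induced from $T^{1,0}M\otimes T^{1,0}M$. For $h=h_{\bar\alpha\bar\gamma}Z_\alpha\otimes Z_\gamma$, $C\colon S^{2,0}\to S^{2,0}$ is the self-adjoint operator $C(h)_{\bar\beta\bar\delta}=R_{\alpha\bar\beta\gamma\bar\delta}h_{\bar\alpha\bar\gamma}$. Action. $S\in T^{1,0}M\otimes T^{1,0}M$ is viewed as a linear map $T_{\mathbb{C}}M\to T_{\mathbb{C}}M$ by linear extension of $(Z_i\otimes Z_k)(v)=g(Z_i,v)Z_k$; it vanishes on $T^{1,0}M$ and maps $T^{0,1}M$ to $T^{1,0}M$. For a $(0,4)$-tensor $T$, $ST$ is the $(0,4)$-tensor $(ST)(x,y,z,w)=-T(Sx,y,z,w)-T(x,Sy,z,w)-T(x,y,Sz,w)-T(x,y,z,Sw)$.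 *)

theory Defs
  imports "HOL-Analysis.Analysis"
begin

section \<open>Smooth functions and complex manifolds\<close>

fun Ck_on :: "nat \<Rightarrow> ('a::real_normed_vector \<Rightarrow> 'b::real_normed_vector) \<Rightarrow> 'a set \<Rightarrow> bool" where
  "Ck_on 0 f W \<longleftrightarrow> continuous_on W f"
| "Ck_on (Suc k) f W \<longleftrightarrow> (\<forall>x\<in>W. f differentiable (at x)) \<and>
     (\<forall>v. Ck_on k (\<lambda>x. frechet_derivative f (at x) v) W)"

definition smooth_on :: "('a::real_normed_vector \<Rightarrow> 'b::real_normed_vector) \<Rightarrow> 'a set \<Rightarrow> bool" where
  "smooth_on f W \<longleftrightarrow> (\<forall>k. Ck_on k f W)"

definition holomorphic_map_on :: "(complex^'n \<Rightarrow> complex^'n) \<Rightarrow> (complex^'n) set \<Rightarrow> bool" where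
  "holomorphic_map_on F W \<longleftrightarrow>
     (\<forall>z\<in>W. \<exists>D. (F has_derivative D) (at z) \<and> (\<forall>v. D (\<i> *s v) = \<i> *s D v))"

type_synonym ('m, 'n) chart = "'m set \<times> ('m \<Rightarrow> complex^'n)"

definition is_chart :: "('m::topological_space, 'n::finite) chart \<Rightarrow> bool" where
  "is_chart c \<longleftrightarrow> open (fst c) \<and> open (snd c ` fst c) \<and>
     (\<exists>\<psi>. homeomorphism (fst c) (snd c ` fst c) (snd c) \<psi>)"

text \<open>The change of coordinates from \<open>c\<close> to \<open>d\<close>; it is meaningful on
  \<open>snd c ` (fst c \<inter> fst d)\<close> only.\<close>

definition transition ::
    "('m, 'n::finite) chart \<Rightarrow> ('m, 'n) chart \<Rightarrow> complex^'n \<Rightarrow> complex^'n" where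
  "transition c d = snd d \<circ> inv_into (fst c) (snd c)"

text \<open>The underlying space is an open subset \<open>M\<close> of a Hausdorff, second countable type.\<close>

definition complex_manifold ::
    "('m::{t2_space,second_countable_topology}) set \<Rightarrow> ('m, 'n::finite) chart set \<Rightarrow> bool" where
  "complex_manifold M atlas \<longleftrightarrow>
     M = (\<Union>c\<in>atlas. fst c) \<and> (\<forall>c\<in>atlas. is_chart c) \<and>
     (\<forall>c\<in>atlas. \<forall>d\<in>atlas. holomorphic_map_on (transition c d) (snd c ` (fst c \<inter> fst d)))"


section \<open>Kaehler metrics\<close>

text \<open>In a chart the real tangent spaces are \<open>complex^'n\<close> (as a real vector space), with
  complex structure \<open>J v = \<i> *s v\<close>.  A metric in a chart assigns to each point a real
  bilinear form on this space.\<close>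

type_synonym 'n metric = "complex^'n \<Rightarrow> complex^'n \<Rightarrow> complex^'n \<Rightarrow> real"

definition hermitian_metric_on :: "'n::finite metric \<Rightarrow> (complex^'n) set \<Rightarrow> bool" where
  "hermitian_metric_on g W \<longleftrightarrow>
     (\<forall>u v. smooth_on (\<lambda>z. g z u v) W) \<and>
     (\<forall>z\<in>W. bilinear (g z) \<and> (\<forall>u v. g z u v = g z v u) \<and> (\<forall>u. u \<noteq> 0 \<longrightarrow> g z u u > 0) \<and>
        (\<forall>u v. g z (\<i> *s u) (\<i> *s v) = g z u v))"

definition kaehler_form :: "'n::finite metric \<Rightarrow> complex^'n \<Rightarrow> complex^'n \<Rightarrow> complex^'n \<Rightarrow> real" where
  "kaehler_form g z u v = g z (\<i> *s u) v"

text \<open>The exterior derivative of a 2-form, evaluated on constant vector fields.\<close>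

definition ext_deriv2 ::
    "(complex^'n \<Rightarrow> complex^'n \<Rightarrow> complex^'n \<Rightarrow> real) \<Rightarrow>
       complex^'n \<Rightarrow> complex^'n \<Rightarrow> complex^'n \<Rightarrow> complex^'n \<Rightarrow> real" where
  "ext_deriv2 \<omega> z u v w =
     frechet_derivative (\<lambda>y. \<omega> y v w) (at z) u
   - frechet_derivative (\<lambda>y. \<omega> y u w) (at z) v
   + frechet_derivative (\<lambda>y. \<omega> y u v) (at z) w"

definition kaehler_metric_on :: "'n::finite metric \<Rightarrow> (complex^'n) set \<Rightarrow> bool" where
  "kaehler_metric_on g W \<longleftrightarrow> hermitian_metric_on g W \<and>
     (\<forall>z\<in>W. \<forall>u v w. ext_deriv2 (kaehler_form g) z u v w = 0)"

text \<open>A metric on the manifold is the family of its coordinate expressions, related by pullback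
  along the changes of coordinates.\<close>

definition kaehler_manifold ::
    "('m::{t2_space,second_countable_topology}) set \<Rightarrow> ('m, 'n::finite) chart set \<Rightarrow>
       (('m, 'n) chart \<Rightarrow> 'n metric) \<Rightarrow> bool" where
  "kaehler_manifold M atlas g \<longleftrightarrow> complex_manifold M atlas \<and>
     (\<forall>c\<in>atlas. kaehler_metric_on (g c) (snd c ` fst c)) \<and>
     (\<forall>c\<in>atlas. \<forall>d\<in>atlas. \<forall>p\<in>fst c \<inter> fst d. \<forall>u v.
        g c (snd c p) u v =
          g d (snd d p) (frechet_derivative (transition c d) (at (snd c p)) u)
                        (frechet_derivative (transition c d) (at (snd c p)) v))"


section \<open>Levi-Civita connection and curvature in complex coordinates\<close>

text \<open>Indices of type \<open>'n + 'n\<close> refer to the frame of the complexified tangent bundle given by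
  \<open>\<partial>/\<partial>z\<^sub>i = (e\<^sub>i - \<i> J e\<^sub>i)/2\<close> for \<open>Inl i\<close> and
  \<open>\<partial>/\<partial>\<bar>z\<^sub>i = (e\<^sub>i + \<i> J e\<^sub>i)/2\<close> for \<open>Inr i\<close>,
  where \<open>e\<^sub>i = axis i 1\<close>.  Vectors of type \<open>complex^('n + 'n)\<close> are complexified tangent
  vectors in this frame.  These coordinate fields commute.\<close>

fun base_vec :: "'n::finite + 'n \<Rightarrow> complex^'n" where
  "base_vec (Inl i) = axis i 1"
| "base_vec (Inr i) = axis i 1"

fun frame_sgn :: "'n + 'n \<Rightarrow> complex" where
  "frame_sgn (Inl i) = - 1"
| "frame_sgn (Inr i) = 1"

definition pd :: "'n::finite + 'n \<Rightarrow> (complex^'n \<Rightarrow> complex) \<Rightarrow> complex^'n \<Rightarrow> complex" where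
  "pd a f z = (frechet_derivative f (at z) (base_vec a)
     + frame_sgn a * \<i> * frechet_derivative f (at z) (\<i> *s base_vec a)) / 2"

text \<open>The complex bilinear extension of the metric on the coordinate frame.\<close>

definition metric_mat :: "'n::finite metric \<Rightarrow> complex^'n \<Rightarrow> complex^('n + 'n)^('n + 'n)" where
  "metric_mat g z = (\<chi> a b.
     (of_real (g z (base_vec a) (base_vec b))
      + frame_sgn b * \<i> * of_real (g z (base_vec a) (\<i> *s base_vec b))
      + frame_sgn a * \<i> * of_real (g z (\<i> *s base_vec a) (base_vec b))
      + (frame_sgn a * \<i>) * (frame_sgn b * \<i>) * of_real (g z (\<i> *s base_vec a) (\<i> *s base_vec b))) / 4)"

definition metric_ext ::
    "'n::finite metric \<Rightarrow> complex^'n \<Rightarrow> complex^('n + 'n) \<Rightarrow> complex^('n + 'n) \<Rightarrow> complex" where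
  "metric_ext g z x y = (\<Sum>a\<in>UNIV. \<Sum>b\<in>UNIV. metric_mat g z $ a $ b * x $ a * y $ b)"

text \<open>\<open>christoffel g c a b\<close> is the \<open>c\<close>-component of the Levi-Civita derivative of the field
  \<open>b\<close> along the field \<open>a\<close>.\<close>

definition christoffel ::
    "'n::finite metric \<Rightarrow> 'n + 'n \<Rightarrow> 'n + 'n \<Rightarrow> 'n + 'n \<Rightarrow> complex^'n \<Rightarrow> complex" where
  "christoffel g c a b z = (\<Sum>d\<in>UNIV. matrix_inv (metric_mat g z) $ c $ d *
     (pd a (\<lambda>y. metric_mat g y $ b $ d) z
      + pd b (\<lambda>y. metric_mat g y $ a $ d) z
      - pd d (\<lambda>y. metric_mat g y $ a $ b) z)) / 2"

text \<open>\<open>curv_op g e a b c\<close> is the \<open>e\<close>-component of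
  \<open>R(\<partial>\<^sub>a, \<partial>\<^sub>b) \<partial>\<^sub>c = \<nabla>\<^sub>a \<nabla>\<^sub>b \<partial>\<^sub>c - \<nabla>\<^sub>b \<nabla>\<^sub>a \<partial>\<^sub>c\<close>, and
  \<open>curv g a b c d = g(R(\<partial>\<^sub>a, \<partial>\<^sub>b) \<partial>\<^sub>c, \<partial>\<^sub>d)\<close>.  With this sign
  \<open>R(Z, \<bar>Z, Z, \<bar>Z)\<close> is the holomorphic sectional curvature of a unit \<open>Z\<close> of type (1,0).\<close>

definition curv_op ::
    "'n::finite metric \<Rightarrow> 'n + 'n \<Rightarrow> 'n + 'n \<Rightarrow> 'n + 'n \<Rightarrow> 'n + 'n \<Rightarrow> complex^'n \<Rightarrow> complex" where
  "curv_op g e a b c z =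
     pd a (christoffel g e b c) z - pd b (christoffel g e a c) z
     + (\<Sum>f\<in>UNIV. christoffel g e a f z * christoffel g f b c z
                 - christoffel g e b f z * christoffel g f a c z)"

definition curv ::
    "'n::finite metric \<Rightarrow> 'n + 'n \<Rightarrow> 'n + 'n \<Rightarrow> 'n + 'n \<Rightarrow> 'n + 'n \<Rightarrow> complex^'n \<Rightarrow> complex" where
  "curv g a b c d z = (\<Sum>e\<in>UNIV. curv_op g e a b c z * metric_mat g z $ e $ d)"

text \<open>\<open>curv_deriv g m a b c d\<close> is
  \<open>(\<nabla>\<^sub>m R)(\<partial>\<^sub>a, \<partial>\<^sub>b, \<partial>\<^sub>c, \<partial>\<^sub>d)\<close>.\<close>

definition curv_deriv ::
    "'n::finite metric \<Rightarrow> 'n + 'n \<Rightarrow> 'n + 'n \<Rightarrow> 'n + 'n \<Rightarrow> 'n + 'n \<Rightarrow> 'n + 'n \<Rightarrow>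
       complex^'n \<Rightarrow> complex" where
  "curv_deriv g m a b c d z = pd m (curv g a b c d) z
     - (\<Sum>f\<in>UNIV. christoffel g f m a z * curv g f b c d z
                 + christoffel g f m b z * curv g a f c d z
                 + christoffel g f m c z * curv g a b f d z
                 + christoffel g f m d z * curv g a b c f z)"

type_synonym 'n tvec = "complex^('n + 'n)"
type_synonym 'n tensor4 = "'n tvec \<Rightarrow> 'n tvec \<Rightarrow> 'n tvec \<Rightarrow> 'n tvec \<Rightarrow> complex"

definition Riem :: "'n::finite metric \<Rightarrow> complex^'n \<Rightarrow> 'n tensor4" where
  "Riem g z x y v w = (\<Sum>a\<in>UNIV. \<Sum>b\<in>UNIV. \<Sum>c\<in>UNIV. \<Sum>d\<in>UNIV.
     curv g a b c d z * x $ a * y $ b * v $ c * w $ d)"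

definition nabla_Riem :: "'n::finite metric \<Rightarrow> complex^'n \<Rightarrow> 'n tvec \<Rightarrow> 'n tensor4" where
  "nabla_Riem g z t x y v w = (\<Sum>m\<in>UNIV. \<Sum>a\<in>UNIV. \<Sum>b\<in>UNIV. \<Sum>c\<in>UNIV. \<Sum>d\<in>UNIV.
     curv_deriv g m a b c d z * t $ m * x $ a * y $ b * v $ c * w $ d)"

text \<open>The Hessian (second covariant derivative) of a function.\<close>

definition Hess ::
    "'n::finite metric \<Rightarrow> (complex^'n \<Rightarrow> complex) \<Rightarrow> complex^'n \<Rightarrow> 'n tvec \<Rightarrow> 'n tvec \<Rightarrow> complex" where
  "Hess g u z x y = (\<Sum>a\<in>UNIV. \<Sum>b\<in>UNIV.
     (pd a (pd b u) z - (\<Sum>c\<in>UNIV. christoffel g c a b z * pd c u z)) * x $ a * y $ b)"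


section \<open>Unitary frames\<close>

text \<open>A vector \<open>v :: complex^'n\<close> of coordinates gives the (1,0)-vector
  \<open>\<Sum>\<^sub>i v\<^sub>i \<partial>/\<partial>z\<^sub>i\<close> and its conjugate.\<close>

definition hol_vec :: "complex^'n::finite \<Rightarrow> 'n tvec" where
  "hol_vec v = (\<chi> a. case a of Inl i \<Rightarrow> v $ i | Inr i \<Rightarrow> 0)"

definition antihol_vec :: "complex^'n::finite \<Rightarrow> 'n tvec" where
  "antihol_vec v = (\<chi> a. case a of Inl i \<Rightarrow> 0 | Inr i \<Rightarrow> cnj (v $ i))"

definition unitary_basis_at :: "'n::finite metric \<Rightarrow> complex^'n \<Rightarrow> ('n \<Rightarrow> complex^'n) \<Rightarrow> bool" where
  "unitary_basis_at g z E \<longleftrightarrow>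
     (\<forall>\<alpha> \<beta>. metric_ext g z (hol_vec (E \<alpha>)) (antihol_vec (E \<beta>)) = (if \<alpha> = \<beta> then 1 else 0))"

definition unitary_frame_on ::
    "'n::finite metric \<Rightarrow> (complex^'n) set \<Rightarrow> (complex^'n \<Rightarrow> 'n \<Rightarrow> complex^'n) \<Rightarrow> bool" where
  "unitary_frame_on g W Z \<longleftrightarrow> open W \<and> (\<forall>\<alpha>. smooth_on (\<lambda>z. Z z \<alpha>) W) \<and>
     (\<forall>z\<in>W. unitary_basis_at g z (Z z))"

definition Ricci ::
    "'n::finite metric \<Rightarrow> complex^'n \<Rightarrow> ('n \<Rightarrow> complex^'n) \<Rightarrow> 'n \<Rightarrow> 'n \<Rightarrow> complex" where
  "Ricci g z E \<alpha> \<beta> = (\<Sum>\<gamma>\<in>UNIV.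
     Riem g z (hol_vec (E \<alpha>)) (antihol_vec (E \<beta>)) (hol_vec (E \<gamma>)) (antihol_vec (E \<gamma>)))"

definition kaehler_einstein_manifold ::
    "('m::{t2_space,second_countable_topology}) set \<Rightarrow> ('m, 'n::finite) chart set \<Rightarrow>
       (('m, 'n) chart \<Rightarrow> 'n metric) \<Rightarrow> real \<Rightarrow> bool" where
  "kaehler_einstein_manifold M atlas g lam \<longleftrightarrow> kaehler_manifold M atlas g \<and>
     (\<forall>c\<in>atlas. \<forall>z\<in>snd c ` fst c. \<forall>E. unitary_basis_at (g c) z E \<longrightarrow>
        (\<forall>\<alpha> \<beta>. Ricci (g c) z E \<alpha> \<beta> =
           of_real lam * metric_ext (g c) z (hol_vec (E \<alpha>)) (antihol_vec (E \<beta>))))"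

fun full_frame :: "('n::finite \<Rightarrow> complex^'n) \<Rightarrow> 'n + 'n \<Rightarrow> 'n tvec" where
  "full_frame E (Inl \<alpha>) = hol_vec (E \<alpha>)"
| "full_frame E (Inr \<alpha>) = antihol_vec (E \<alpha>)"

definition tensor_norm_sq :: "('n::finite \<Rightarrow> complex^'n) \<Rightarrow> 'n tensor4 \<Rightarrow> real" where
  "tensor_norm_sq E T = (\<Sum>a\<in>UNIV. \<Sum>b\<in>UNIV. \<Sum>c\<in>UNIV. \<Sum>d\<in>UNIV.
     (cmod (T (full_frame E a) (full_frame E b) (full_frame E c) (full_frame E d)))\<^sup>2)"

text \<open>The sum over the components with bars as in \<open>T\<^bsub>\<alpha>\<bar>\<beta>\<gamma>\<bar>\<delta>\<^esub>\<close> only.\<close>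

definition mixed_norm_sq :: "('n::finite \<Rightarrow> complex^'n) \<Rightarrow> 'n tensor4 \<Rightarrow> real" where
  "mixed_norm_sq E T = (\<Sum>\<alpha>\<in>UNIV. \<Sum>\<beta>\<in>UNIV. \<Sum>\<gamma>\<in>UNIV. \<Sum>\<delta>\<in>UNIV.
     (cmod (T (hol_vec (E \<alpha>)) (antihol_vec (E \<beta>)) (hol_vec (E \<gamma>)) (antihol_vec (E \<delta>))))\<^sup>2)"

definition laplacian_C ::
    "'n::finite metric \<Rightarrow> (complex^'n \<Rightarrow> 'n \<Rightarrow> complex^'n) \<Rightarrow> (complex^'n \<Rightarrow> complex) \<Rightarrow>
       complex^'n \<Rightarrow> complex" where
  "laplacian_C g Z u z = (\<Sum>\<mu>\<in>UNIV.
     Hess g u z (hol_vec (Z z \<mu>)) (antihol_vec (Z z \<mu>))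
   + Hess g u z (antihol_vec (Z z \<mu>)) (hol_vec (Z z \<mu>))) / 2"

text \<open>\<open>Ric_L(R, \<bar>R)\<close>, the term determined by the Bochner formula
  \<open>\<Delta> |R\<^bsub>\<alpha>\<bar>\<beta>\<gamma>\<bar>\<delta>\<^esub>|\<^sup>2 = |\<nabla>\<^bsub>\<mu>\<^esub> R\<^bsub>\<alpha>\<bar>\<beta>\<gamma>\<bar>\<delta>\<^esub>|\<^sup>2 + |\<nabla>\<^bsub>\<bar>\<mu>\<^esub> R\<^bsub>\<alpha>\<bar>\<beta>\<gamma>\<bar>\<delta>\<^esub>|\<^sup>2 + Ric_L(R, \<bar>R) / 8\<close>.\<close>

definition Ric_L ::
    "'n::finite metric \<Rightarrow> (complex^'n \<Rightarrow> 'n \<Rightarrow> complex^'n) \<Rightarrow> complex^'n \<Rightarrow> complex" where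
  "Ric_L g Z z = 8 *
     (laplacian_C g Z (\<lambda>y. of_real (mixed_norm_sq (Z y) (Riem g y))) z
      - of_real (\<Sum>\<mu>\<in>UNIV. mixed_norm_sq (Z z) (nabla_Riem g z (hol_vec (Z z \<mu>))))
      - of_real (\<Sum>\<mu>\<in>UNIV. mixed_norm_sq (Z z) (nabla_Riem g z (antihol_vec (Z z \<mu>)))))"


section \<open>The Calabi operator and the action of symmetric (2,0)-tensors\<close>

text \<open>\<open>h :: complex^('n \<times> 'n)\<close> stands for the tensor
  \<open>\<Sum>\<^bsub>\<alpha>,\<gamma>\<^esub> h\<^bsub>\<alpha>\<gamma>\<^esub> Z\<^sub>\<alpha> \<otimes> Z\<^sub>\<gamma>\<close> with respect to a unitary basis.\<close>

definition S20 :: "(complex^('n::finite \<times> 'n)) set" where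
  "S20 = {h. \<forall>\<alpha> \<gamma>. h $ (\<alpha>, \<gamma>) = h $ (\<gamma>, \<alpha>)}"

definition herm_inner :: "complex^'k::finite \<Rightarrow> complex^'k \<Rightarrow> complex" where
  "herm_inner h k = (\<Sum>p\<in>UNIV. h $ p * cnj (k $ p))"

definition Calabi ::
    "'n::finite metric \<Rightarrow> complex^'n \<Rightarrow> ('n \<Rightarrow> complex^'n) \<Rightarrow>
       complex^('n \<times> 'n) \<Rightarrow> complex^('n \<times> 'n)" where
  "Calabi g z E h = (\<chi> p. \<Sum>\<alpha>\<in>UNIV. \<Sum>\<gamma>\<in>UNIV.
     Riem g z (hol_vec (E \<alpha>)) (antihol_vec (E (fst p))) (hol_vec (E \<gamma>)) (antihol_vec (E (snd p)))
       * h $ (\<alpha>, \<gamma>))"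

definition unitary_basis_of ::
    "(complex^'k::finite) set \<Rightarrow> 'i set \<Rightarrow> ('i \<Rightarrow> complex^'k) \<Rightarrow> bool" where
  "unitary_basis_of V I S \<longleftrightarrow> finite I \<and>
     (\<forall>A\<in>I. \<forall>B\<in>I. herm_inner (S A) (S B) = (if A = B then 1 else 0)) \<and>
     vec.span (S ` I) = V"

text \<open>The trace of a linear endomorphism of a subspace \<open>V\<close>.\<close>

definition trace_on :: "(complex^'k::finite) set \<Rightarrow> (complex^'k \<Rightarrow> complex^'k) \<Rightarrow> complex" where
  "trace_on V L = (let B = (SOME B. vec.independent B \<and> vec.span B = V)
                   in \<Sum>b\<in>B. vec.representation B (L b) b)"

definition tensor_map ::
    "'n::finite metric \<Rightarrow> complex^'n \<Rightarrow> ('n \<Rightarrow> complex^'n) \<Rightarrow> complex^('n \<times> 'n) \<Rightarrow>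
       'n tvec \<Rightarrow> 'n tvec" where
  "tensor_map g z E h v = (\<Sum>\<alpha>\<in>UNIV. \<Sum>\<gamma>\<in>UNIV.
     (h $ (\<alpha>, \<gamma>) * metric_ext g z (hol_vec (E \<alpha>)) v) *s hol_vec (E \<gamma>))"

definition tensor_action :: "('n::finite tvec \<Rightarrow> 'n tvec) \<Rightarrow> 'n tensor4 \<Rightarrow> 'n tensor4" where
  "tensor_action S T x y v w =
     - T (S x) y v w - T x (S y) v w - T x y (S v) w - T x y v (S w)"

end

theory Submission
  imports Defs
begin

text \<open>
  Raise the barred indices of the curvature tensor: \<open>A\<^bsup>bd\<^esup>\<^bsub>ac\<^esub>\<close> is then an endomorphism of
  \<open>T\<^sup>1\<^sup>,\<^sup>0 \<otimes> T\<^sup>1\<^sup>,\<^sup>0\<close> with \<open>tr (A A) = |R\<^bsub>\<alpha>\<bar>\<beta>\<gamma>\<bar>\<delta>\<^esub>|\<^sup>2\<close>, an expression without metric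
  factors, and covariant differentiation in the (0,1) directions is plain differentiation.
  Differentiating twice gives \<open>Ric_L = 16 tr (X A)\<close> with \<open>X = g\<^bsup>p\<bar>q\<^esup> \<nabla>\<^sub>p \<partial>\<^sub>\<bar>q A\<close>.  The second Bianchi identity
  moves the free index to \<open>\<partial>\<^sub>\<bar>q\<close>; after commuting the two derivatives, what is left besides the
  curvature terms is a derivative of the divergence of \<open>A\<close>, which vanishes by the Einstein condition.  Hence
  \<open>X\<^bsup>bd\<^esup>\<^bsub>ac\<^esub> = \<lambda> A\<^bsup>bd\<^esup>\<^bsub>ac\<^esub> + A\<^bsup>bd\<^esup>\<^bsub>pf\<^esub> A\<^bsup>pf\<^esup>\<^bsub>ac\<^esub> - A\<^bsup>bf\<^esup>\<^bsub>pa\<^esub> A\<^bsup>pd\<^esup>\<^bsub>fc\<^esub> - A\<^bsup>bf\<^esup>\<^bsub>pc\<^esub> A\<^bsup>pd\<^esup>\<^bsub>af\<^esub>\<close>.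
  In a unitary frame \<open>A\<close> restricts to the Calabi operator, so the first two terms give
  traces of its powers, and the spectral decomposition \<open>\<Sum>\<^sub>A \<sigma>\<^sub>A S\<^sub>A \<otimes> \<bar>S\<^sub>A = C\<close> identifies the
  remaining cubic term with \<open>\<Sum>\<^sub>A \<sigma>\<^sub>A |S\<^sub>A R|\<^sup>2\<close> up to a multiple of \<open>\<lambda> tr (C\<^sup>2)\<close>.
\<close>

section \<open>Smooth functions and Wirtinger derivatives\<close>

text \<open>The 16 is the 8 in \<open>Ric_L\<close> times 2: |R|^2 is quadratic in A, and the two
  gradient terms left by the product rule are exactly the two norms subtracted in
  \<open>Ric_L\<close>. Write T for the contraction of A with itself in the last two terms of X
  (\<open>twist4\<close>). Then Ric_L = 16 lambda tr (A A) + 16 tr (A A A) - 32 tr (T A). On the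
  other side, four patterns of bars contribute equally to |S_A R|^2, and expanding the square gives
  sum_A sigma_A |S_A R|^2 = 8 lambda tr (C^2) - 8 tr (T A). Eliminating tr (T A) costs 32 lambda tr
  (C^2), which turns the + 16 lambda into the - 16 lambda of the theorem. The obstacle is that two
  frames are in play. The unitary frame is only smooth, and derivatives of its coefficients would
  enter every formula; all differentiation is therefore done in holomorphic coordinates, on
  components of \<open>A\<close>. Orthonormality, on which the eigenbasis depends, holds only in the
  frame. The bridge is that full contractions and the products \<open>comp4\<close> and
  \<open>twist4\<close> commute with a change of frame, so only undifferentiated identities are
  transported.\<close>

lemma frechet_derivative_cong_open:
  assumes "open W" "x \<in> W" "\<And>y. y \<in> W \<Longrightarrow> f y = g y"
  shows "frechet_derivative f (at x) = frechet_derivative g (at x)"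
proof -
  have "(f has_derivative D) (at x) \<longleftrightarrow> (g has_derivative D) (at x)" for D
    using assms by (metis has_derivative_transform_within_open)
  then show ?thesis by (simp add: frechet_derivative_def)
qed

section \<open>Closure properties of iterated differentiability\<close>

lemma Ck_on_cong:
  assumes "open W" "\<And>y. y \<in> W \<Longrightarrow> f y = g y" "Ck_on k f W"
  shows "Ck_on k g W"
  using assms(2,3)
proof (induction k arbitrary: f g)
  case 0
  then show ?case by (simp cong: continuous_on_cong)
next
  case (Suc k)
  have eq: "frechet_derivative f (at x) = frechet_derivative g (at x)" if "x \<in> W" for x
    using frechet_derivative_cong_open[OF assms(1) that Suc.prems(1)] .
  have d: "g differentiable (at x)" if "x \<in> W" for x
  proof -
    have "f differentiable (at x)" using Suc.prems(2) that by simp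
    then show ?thesis unfolding differentiable_def
      using has_derivative_transform_within_open[OF _ assms(1) that] Suc.prems(1) by blast
  qed
  have "Ck_on k (\<lambda>x. frechet_derivative g (at x) v) W" for v
    using Suc.IH[of "\<lambda>x. frechet_derivative f (at x) v"] eq Suc.prems(2) by simp
  then show ?case using d by simp
qed

lemma Ck_on_subset: "Ck_on k f V \<Longrightarrow> W \<subseteq> V \<Longrightarrow> Ck_on k f W"
  by (induction k arbitrary: f) (auto intro: continuous_on_subset)

text \<open>The recursion for \<open>Ck_on\<close> only speaks of derivatives, so that a higher
  order implies the lower ones is itself an induction; its base is that differentiability gives
  continuity. The product rule relies on it.\<close>

lemma Ck_on_SucD: "Ck_on (Suc k) f W \<Longrightarrow> Ck_on k f W"
proof (induction k arbitrary: f)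
  case 0
  then show ?case
    by (auto intro!: continuous_at_imp_continuous_on differentiable_imp_continuous_within)
next
  case (Suc k)
  note * = Suc.prems[unfolded Ck_on.simps(2)[of "Suc k"]]
  have "\<forall>v. Ck_on k (\<lambda>x. frechet_derivative f (at x) v) W"
  proof
    fix v
    show "Ck_on k (\<lambda>x. frechet_derivative f (at x) v) W"
      by (rule Suc.IH[OF spec[OF conjunct2[OF *]]])
  qed
  with conjunct1[OF *] show ?case by (rule Ck_on.simps(2)[THEN iffD2, OF conjI])
qed

lemma Ck_on_const: "Ck_on k (\<lambda>x. c) W"
  by (induction k arbitrary: c) simp_all

lemma has_derivative_frechet:
  "f differentiable (at x) \<Longrightarrow> (f has_derivative frechet_derivative f (at x)) (at x)"
  using frechet_derivative_works by blast

lemma frechet_derivative_add: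
  assumes "f differentiable (at x)" "g differentiable (at x)"
  shows "frechet_derivative (\<lambda>y. f y + g y) (at x) =
     (\<lambda>v. frechet_derivative f (at x) v + frechet_derivative g (at x) v)"
  by (rule frechet_derivative_at[OF has_derivative_add[OF assms[THEN has_derivative_frechet]], symmetric])

lemma frechet_derivative_mult:
  fixes f g :: "'a::real_normed_vector \<Rightarrow> 'b::real_normed_algebra"
  assumes "f differentiable (at x)" "g differentiable (at x)"
  shows "frechet_derivative (\<lambda>y. f y * g y) (at x) =
     (\<lambda>v. f x * frechet_derivative g (at x) v + frechet_derivative f (at x) v * g x)"
  by (rule frechet_derivative_at[OF has_derivative_mult[OF assms[THEN has_derivative_frechet]], symmetric])

lemma frechet_derivative_bounded_linear:
  assumes "bounded_linear L" "f differentiable (at x)"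
  shows "frechet_derivative (\<lambda>y. L (f y)) (at x) = (\<lambda>v. L (frechet_derivative f (at x) v))"
  by (rule frechet_derivative_at[OF bounded_linear.has_derivative[OF assms(1) has_derivative_frechet[OF assms(2)]], symmetric])

lemma differentiable_bounded_linear:
  assumes "bounded_linear L" "f differentiable (at x)"
  shows "(\<lambda>y. L (f y)) differentiable (at x)"
  using assms bounded_linear.has_derivative unfolding differentiable_def by blast

lemma Ck_on_add:
  assumes "open W" "Ck_on k f W" "Ck_on k g W"
  shows "Ck_on k (\<lambda>x. f x + g x) W"
  using assms(2,3)
proof (induction k arbitrary: f g)
  case 0
  then show ?case by (simp add: continuous_on_add)
next
  case (Suc k)
  have "Ck_on k (\<lambda>x. frechet_derivative (\<lambda>x. f x + g x) (at x) v) W" for v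
    by (rule Ck_on_cong[OF assms(1) _ Suc.IH[of "\<lambda>x. frechet_derivative f (at x) v"
          "\<lambda>x. frechet_derivative g (at x) v"]])
       (use Suc.prems in \<open>auto simp: frechet_derivative_add\<close>)
  then show ?case using Suc.prems by simp
qed

lemma Ck_on_mult:
  fixes f g :: "'a::real_normed_vector \<Rightarrow> 'b::real_normed_algebra"
  assumes "open W" "Ck_on k f W" "Ck_on k g W"
  shows "Ck_on k (\<lambda>x. f x * g x) W"
  using assms(2,3)
proof (induction k arbitrary: f g)
  case 0
  then show ?case by (simp add: continuous_on_mult)
next
  case (Suc k)
  have "Ck_on k (\<lambda>x. frechet_derivative (\<lambda>x. f x * g x) (at x) v) W" for v
  proof (rule Ck_on_cong[OF assms(1)])
    show "Ck_on k (\<lambda>x. f x * frechet_derivative g (at x) v + frechet_derivative f (at x) v * g x) W"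
      \<comment> \<open>The undifferentiated factors of the product rule are given at order
        \<open>Suc k\<close> but have to be used at order \<open>k\<close>.\<close>
      using Suc.prems Suc.prems[THEN Ck_on_SucD] by (intro Ck_on_add assms(1) Suc.IH) simp_all
  qed (use Suc.prems in \<open>simp add: frechet_derivative_mult\<close>)
  then show ?case using Suc.prems by simp
qed

lemma Ck_on_bounded_linear:
  assumes "open W" "bounded_linear L" "Ck_on k f W"
  shows "Ck_on k (\<lambda>x. L (f x)) W"
  using assms(3)
proof (induction k arbitrary: f)
  case 0
  then show ?case
    by (simp add: bounded_linear.continuous_on[OF assms(2)])
next
  case (Suc k)
  have "Ck_on k (\<lambda>x. frechet_derivative (\<lambda>x. L (f x)) (at x) v) W" for v
    by (rule Ck_on_cong[OF assms(1) _ Suc.IH[of "\<lambda>x. frechet_derivative f (at x) v"]])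
       (use Suc.prems in \<open>auto simp: frechet_derivative_bounded_linear[OF assms(2)]\<close>)
  then show ?case using Suc.prems by (simp add: differentiable_bounded_linear[OF assms(2)])
qed

lemma smooth_on_subset: "smooth_on f V \<Longrightarrow> W \<subseteq> V \<Longrightarrow> smooth_on f W"
  unfolding smooth_on_def using Ck_on_subset by blast

lemma smooth_on_const: "smooth_on (\<lambda>x. c) W"
  by (simp add: smooth_on_def Ck_on_const)

lemma smooth_on_add:
  "\<lbrakk>open W; smooth_on f W; smooth_on g W\<rbrakk> \<Longrightarrow> smooth_on (\<lambda>x. f x + g x) W"
  by (simp add: smooth_on_def Ck_on_add)

lemma smooth_on_mult:
  fixes f g :: "'a::real_normed_vector \<Rightarrow> 'b::real_normed_algebra"
  shows "\<lbrakk>open W; smooth_on f W; smooth_on g W\<rbrakk> \<Longrightarrow> smooth_on (\<lambda>x. f x * g x) W"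
  by (simp add: smooth_on_def Ck_on_mult)

lemma smooth_on_bounded_linear:
  "\<lbrakk>open W; bounded_linear L; smooth_on f W\<rbrakk> \<Longrightarrow> smooth_on (\<lambda>x. L (f x)) W"
  by (simp add: smooth_on_def Ck_on_bounded_linear)

lemma smooth_on_sum:
  "\<lbrakk>open W; \<And>i. i \<in> I \<Longrightarrow> smooth_on (f i) W\<rbrakk> \<Longrightarrow> smooth_on (\<lambda>x. \<Sum>i\<in>I. f i x) W"
  by (induction I rule: infinite_finite_induct) (simp_all add: smooth_on_const smooth_on_add)

lemma smooth_on_differentiable: "smooth_on f W \<Longrightarrow> x \<in> W \<Longrightarrow> f differentiable (at x)"
  unfolding smooth_on_def using Ck_on.simps(2) by blast

lemma smooth_on_continuous_on: "smooth_on f W \<Longrightarrow> continuous_on W f"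
  unfolding smooth_on_def using Ck_on.simps(1) by blast

lemma smooth_on_frechet_derivative:
  "smooth_on f W \<Longrightarrow> smooth_on (\<lambda>x. frechet_derivative f (at x) v) W"
  unfolding smooth_on_def using Ck_on.simps(2) by blast

section \<open>Symmetry of second derivatives\<close>

lemma real_derivative_along_line:
  fixes f :: "'a::real_normed_vector \<Rightarrow> real"
  assumes "f differentiable (at (x + s *\<^sub>R u))"
  shows "((\<lambda>s. f (x + s *\<^sub>R u)) has_real_derivative
            frechet_derivative f (at (x + s *\<^sub>R u)) u) (at s)"
proof -
  have "((\<lambda>s. x + s *\<^sub>R u) has_derivative (\<lambda>h. h *\<^sub>R u)) (at s)"
    by (auto intro!: derivative_eq_intros)
  from has_derivative_compose[OF this, of f] has_derivative_frechet[OF assms]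
  have "((\<lambda>s. f (x + s *\<^sub>R u)) has_derivative
          (\<lambda>h. frechet_derivative f (at (x + s *\<^sub>R u)) (h *\<^sub>R u))) (at s)" by blast
  moreover have "frechet_derivative f (at (x + s *\<^sub>R u)) (h *\<^sub>R u)
      = frechet_derivative f (at (x + s *\<^sub>R u)) u * h" for h
    using linear_frechet_derivative[OF assms] by (simp add: linear_cmul mult.commute)
  ultimately show ?thesis by (simp add: has_field_derivative_def)
qed

text \<open>Two applications of the mean value theorem: along \<open>u\<close> to the difference of
  \<open>f\<close> across \<open>t *\<^sub>R v\<close>, then along \<open>v\<close> to the
  directional derivative of \<open>f\<close> in direction \<open>u\<close>.\<close>

lemma frechet_derivative_second_difference:
  fixes f :: "'a::real_normed_vector \<Rightarrow> real"
  assumes f: "smooth_on f W" and t: "t > 0"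
    and sub: "\<And>a b. \<bar>a\<bar> \<le> t \<Longrightarrow> \<bar>b\<bar> \<le> t \<Longrightarrow> x + a *\<^sub>R u + b *\<^sub>R v \<in> W"
  obtains a b where "\<bar>a\<bar> \<le> t" "\<bar>b\<bar> \<le> t"
    "f (x + t *\<^sub>R u + t *\<^sub>R v) - f (x + t *\<^sub>R u) - f (x + t *\<^sub>R v) + f x =
       t * t * frechet_derivative (\<lambda>y. frechet_derivative f (at y) u) (at (x + a *\<^sub>R u + b *\<^sub>R v)) v"
proof -
  define \<phi> where "\<phi> s = f ((x + t *\<^sub>R v) + s *\<^sub>R u) - f (x + s *\<^sub>R u)" for s
  define \<psi> where "\<psi> s = frechet_derivative f (at ((x + t *\<^sub>R v) + s *\<^sub>R u)) u
      - frechet_derivative f (at (x + s *\<^sub>R u)) u" for s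
  have d: "f differentiable (at ((x + b *\<^sub>R v) + s *\<^sub>R u))" if "\<bar>b\<bar> \<le> t" "\<bar>s\<bar> \<le> t" for b s
    using smooth_on_differentiable[OF f sub[of s b]] that by (simp add: add_ac)
  have "(\<phi> has_real_derivative \<psi> s) (at s)" if "0 \<le> s" "s \<le> t" for s
    unfolding \<phi>_def \<psi>_def
    using d[of t s] d[of 0 s] that t
    by (intro DERIV_diff real_derivative_along_line) auto
  from MVT2[OF t this] obtain a where a: "0 < a" "a < t" "\<phi> t - \<phi> 0 = t * \<psi> a" by auto
  let ?F = "\<lambda>y. frechet_derivative f (at y) u"
  define \<theta> where "\<theta> s = frechet_derivative ?F (at (x + a *\<^sub>R u + s *\<^sub>R v)) v" for s
  have "((\<lambda>s. ?F (x + a *\<^sub>R u + s *\<^sub>R v)) has_real_derivative \<theta> s) (at s)" if "0 \<le> s" "s \<le> t" for s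
    unfolding \<theta>_def
    by (intro real_derivative_along_line smooth_on_differentiable[OF smooth_on_frechet_derivative[OF f]] sub)
       (use that a in auto)
  from MVT2[OF t this] obtain b where b: "0 < b" "b < t"
    "?F (x + a *\<^sub>R u + t *\<^sub>R v) - ?F (x + a *\<^sub>R u + 0 *\<^sub>R v) = t * \<theta> b" by auto
  have "f (x + t *\<^sub>R u + t *\<^sub>R v) - f (x + t *\<^sub>R u) - f (x + t *\<^sub>R v) + f x = \<phi> t - \<phi> 0"
    by (simp add: \<phi>_def add_ac)
  also have "\<dots> = t * t * \<theta> b"
    using a(3) b(3) by (simp add: \<psi>_def add_ac)
  finally show thesis using that[of a b] a b by (simp add: \<theta>_def)
qed

text \<open>The second difference over a small parallelogram does not depend on the order of
  \<open>u\<close> and \<open>v\<close>, so the two mixed derivatives take a common value at two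
  points near \<open>x\<close>; their continuity at \<open>x\<close> does the rest.\<close>

lemma frechet_derivative_commute_real:
  fixes f :: "'a::real_normed_vector \<Rightarrow> real"
  assumes W: "open W" "x \<in> W" and f: "smooth_on f W"
  shows "frechet_derivative (\<lambda>y. frechet_derivative f (at y) u) (at x) v =
         frechet_derivative (\<lambda>y. frechet_derivative f (at y) v) (at x) u"
proof -
  let ?P = "\<lambda>y. frechet_derivative (\<lambda>y. frechet_derivative f (at y) u) (at y) v"
  let ?Q = "\<lambda>y. frechet_derivative (\<lambda>y. frechet_derivative f (at y) v) (at y) u"
  have close: "\<bar>?P x - ?Q x\<bar> \<le> e" if e: "e > 0" for e
  proof -
    have cont: "isCont ?P x" "isCont ?Q x"
      using W f by (metis continuous_on_eq_continuous_at smooth_on_continuous_on smooth_on_frechet_derivative)+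
    obtain d1 where d1: "d1 > 0" "\<And>y. dist y x < d1 \<Longrightarrow> dist (?P y) (?P x) < e/2"
      using cont(1) e unfolding continuous_at_eps_delta by (metis half_gt_zero)
    obtain d2 where d2: "d2 > 0" "\<And>y. dist y x < d2 \<Longrightarrow> dist (?Q y) (?Q x) < e/2"
      using cont(2) e unfolding continuous_at_eps_delta by (metis half_gt_zero)
    obtain d3 where d3: "d3 > 0" "\<And>y. dist y x < d3 \<Longrightarrow> y \<in> W"
      using W open_dist by metis
    define d where "d = Min {d1, d2, d3}"
    have d: "d > 0" "d \<le> d1" "d \<le> d2" "d \<le> d3" using d1 d2 d3 by (auto simp: d_def)
    \<comment> \<open>With t = d / (2 N) the whole parallelogram stays within d / 2 of
      \<open>x\<close>; the summand 1 keeps \<open>N\<close> positive when \<open>u\<close> and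
      \<open>v\<close> both vanish.\<close>
    define N where "N = norm u + norm v + 1"
    define t where "t = d / (2 * N)"
    have pos: "N > 0" by (simp add: N_def add_nonneg_pos)
    have t: "t > 0" using d(1) pos by (simp add: t_def)
    have near: "dist (x + a *\<^sub>R u + b *\<^sub>R v) x < d" if "\<bar>a\<bar> \<le> t" "\<bar>b\<bar> \<le> t" for a b
    proof -
      have "dist (x + a *\<^sub>R u + b *\<^sub>R v) x = norm (a *\<^sub>R u + b *\<^sub>R v)" by (simp add: dist_norm)
      also have "\<dots> \<le> \<bar>a\<bar> * norm u + \<bar>b\<bar> * norm v" by (metis norm_scaleR norm_triangle_ineq)
      also have "\<dots> \<le> t * norm u + t * norm v" by (intro add_mono mult_right_mono that) auto
      also have "\<dots> \<le> t * N" using t by (simp add: N_def algebra_simps)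
      also have "\<dots> = d / 2" using pos by (simp add: t_def)
      finally show ?thesis using d(1) by simp
    qed
    obtain a b where ab: "\<bar>a\<bar> \<le> t" "\<bar>b\<bar> \<le> t"
      "f (x + t *\<^sub>R u + t *\<^sub>R v) - f (x + t *\<^sub>R u) - f (x + t *\<^sub>R v) + f x = t * t * ?P (x + a *\<^sub>R u + b *\<^sub>R v)"
      by (rule frechet_derivative_second_difference[OF f t, of x u v]) (use near d3(2) d in force)+
    obtain a' b' where ab': "\<bar>a'\<bar> \<le> t" "\<bar>b'\<bar> \<le> t"
      "f (x + t *\<^sub>R v + t *\<^sub>R u) - f (x + t *\<^sub>R v) - f (x + t *\<^sub>R u) + f x = t * t * ?Q (x + a' *\<^sub>R v + b' *\<^sub>R u)"
      by (rule frechet_derivative_second_difference[OF f t, of x v u])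
         (use near d3(2) d in \<open>force simp: add_ac\<close>)+
    have "t * t * ?P (x + a *\<^sub>R u + b *\<^sub>R v) = t * t * ?Q (x + a' *\<^sub>R v + b' *\<^sub>R u)"
      unfolding ab(3)[symmetric] ab'(3)[symmetric] by (simp add: add_ac)
    then have "?P (x + a *\<^sub>R u + b *\<^sub>R v) = ?Q (x + a' *\<^sub>R v + b' *\<^sub>R u)" using t by simp
    moreover have "dist (?P (x + a *\<^sub>R u + b *\<^sub>R v)) (?P x) < e/2"
      using d1(2) near[OF ab(1,2)] d by force
    moreover have "dist (?Q (x + a' *\<^sub>R v + b' *\<^sub>R u)) (?Q x) < e/2"
      using d2(2) near[OF ab'(2,1)] d by (force simp: add_ac)
    ultimately show ?thesis unfolding dist_real_def by linarith
  qed
  have "\<bar>?P x - ?Q x\<bar> = 0"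
    using field_le_epsilon[of "\<bar>?P x - ?Q x\<bar>" 0] close by fastforce
  then show ?thesis by simp
qed

text \<open>The mean value theorem is a statement on real functions, so real and imaginary parts are
  treated separately.\<close>

lemma frechet_derivative_commute:
  fixes f :: "'a::real_normed_vector \<Rightarrow> complex"
  assumes W: "open W" "x \<in> W" and f: "smooth_on f W"
  shows "frechet_derivative (\<lambda>y. frechet_derivative f (at y) u) (at x) v =
         frechet_derivative (\<lambda>y. frechet_derivative f (at y) v) (at x) u"
proof -
  have *: "L (frechet_derivative (\<lambda>y. frechet_derivative f (at y) u) (at x) v) =
         frechet_derivative (\<lambda>y. frechet_derivative (\<lambda>y. L (f y)) (at y) u) (at x) v"
    if L: "bounded_linear L" for L :: "complex \<Rightarrow> real" and u v
  proof -
    have "frechet_derivative (\<lambda>y. frechet_derivative (\<lambda>y. L (f y)) (at y) u) (at x) =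
          frechet_derivative (\<lambda>y. L (frechet_derivative f (at y) u)) (at x)"
      using f W by (intro frechet_derivative_cong_open[of W])
        (auto simp: frechet_derivative_bounded_linear[OF L] smooth_on_differentiable)
    also have "\<dots> = (\<lambda>v. L (frechet_derivative (\<lambda>y. frechet_derivative f (at y) u) (at x) v))"
      by (rule frechet_derivative_bounded_linear[OF L
            smooth_on_differentiable[OF smooth_on_frechet_derivative[OF f] W(2)]])
    finally show ?thesis by simp
  qed
  have "L (frechet_derivative (\<lambda>y. frechet_derivative f (at y) u) (at x) v) =
        L (frechet_derivative (\<lambda>y. frechet_derivative f (at y) v) (at x) u)"
    if L: "bounded_linear L" for L :: "complex \<Rightarrow> real"
    unfolding *[OF L]
    by (rule frechet_derivative_commute_real[OF W smooth_on_bounded_linear[OF W(1) L f]])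
  from this[OF bounded_linear_Re] this[OF bounded_linear_Im] show ?thesis
    by (rule complex_eqI)
qed

section \<open>Calculus of Wirtinger derivatives on an open set\<close>

primrec conj_index :: "'n + 'n \<Rightarrow> 'n + 'n" where
  "conj_index (Inl i) = Inr i"
| "conj_index (Inr i) = Inl i"

lemma base_vec_conj_index [simp]: "base_vec (conj_index a) = base_vec a"
  by (cases a) simp_all

lemma frame_sgn_conj_index [simp]: "frame_sgn (conj_index a) = - frame_sgn a"
  by (cases a) simp_all

lemma cnj_frame_sgn [simp]: "cnj (frame_sgn a) = frame_sgn a"
  by (cases a) simp_all

locale open_domain =
  fixes W :: "(complex^'n::finite) set"
  assumes open_W: "open W"
begin

text \<open>Smoothness relative to the fixed domain, a predicate of one argument, so that the
  simplifier can discharge the side conditions of the rules for \<open>pd\<close>.\<close>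

definition sm :: "(complex^'n \<Rightarrow> complex) \<Rightarrow> bool" where
  "sm f \<longleftrightarrow> smooth_on f W"

lemma sm_differentiable: "sm f \<Longrightarrow> z \<in> W \<Longrightarrow> f differentiable (at z)"
  unfolding sm_def by (rule smooth_on_differentiable)

lemma sm_const [simp, intro!]: "sm (\<lambda>y. k)"
  by (simp add: sm_def smooth_on_const)

lemma sm_add [simp, intro!]: "sm f \<Longrightarrow> sm h \<Longrightarrow> sm (\<lambda>y. f y + h y)"
  unfolding sm_def by (rule smooth_on_add[OF open_W])

lemma sm_mult [simp, intro!]: "sm f \<Longrightarrow> sm h \<Longrightarrow> sm (\<lambda>y. f y * h y)"
  unfolding sm_def by (rule smooth_on_mult[OF open_W])

lemma sm_minus [simp, intro!]: "sm f \<Longrightarrow> sm (\<lambda>y. - f y)"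
  using sm_mult[of "\<lambda>y. -1" f] by simp

lemma sm_diff [simp, intro!]: "sm f \<Longrightarrow> sm h \<Longrightarrow> sm (\<lambda>y. f y - h y)"
  using sm_add[of f "\<lambda>y. - h y"] by simp

lemma sm_sum [simp, intro!]: "(\<And>i. i \<in> I \<Longrightarrow> sm (f i)) \<Longrightarrow> sm (\<lambda>y. \<Sum>i\<in>I. f i y)"
  unfolding sm_def by (rule smooth_on_sum[OF open_W])

lemma sm_cnj [simp, intro!]: "sm f \<Longrightarrow> sm (\<lambda>y. cnj (f y))"
  unfolding sm_def by (rule smooth_on_bounded_linear[OF open_W bounded_linear_cnj])

lemma sm_pd [simp, intro!]:
  assumes "sm f"
  shows "sm (pd a f)"
proof -
  have 1: "sm (\<lambda>y. frechet_derivative f (at y) v)" for v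
    using assms unfolding sm_def by (rule smooth_on_frechet_derivative)
  have "sm (\<lambda>z. (1/2) * (frechet_derivative f (at z) (base_vec a)
     + (frame_sgn a * \<i>) * frechet_derivative f (at z) (\<i> *s base_vec a)))"
    by (intro sm_mult sm_add sm_const 1)
  then show ?thesis
    by (simp add: pd_def[abs_def])
qed

lemma pd_cong: "z \<in> W \<Longrightarrow> (\<And>y. y \<in> W \<Longrightarrow> f y = h y) \<Longrightarrow> pd a f z = pd a h z"
  using frechet_derivative_cong_open[OF open_W, of z f h] by (simp add: pd_def)

lemma pd_const [simp]: "pd a (\<lambda>y. k) z = 0"
  by (simp add: pd_def)

lemma pd_add [simp]: "sm f \<Longrightarrow> sm h \<Longrightarrow> z \<in> W \<Longrightarrow> pd a (\<lambda>y. f y + h y) z = pd a f z + pd a h z"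
  by (simp add: pd_def frechet_derivative_add sm_differentiable algebra_simps add_divide_distrib)

lemma pd_mult [simp]:
  "sm f \<Longrightarrow> sm h \<Longrightarrow> z \<in> W \<Longrightarrow> pd a (\<lambda>y. f y * h y) z = pd a f z * h z + f z * pd a h z"
  by (simp add: pd_def frechet_derivative_mult sm_differentiable algebra_simps add_divide_distrib)

lemma pd_minus [simp]: "sm f \<Longrightarrow> z \<in> W \<Longrightarrow> pd a (\<lambda>y. - f y) z = - pd a f z"
  using pd_mult[of "\<lambda>y. -1" f z a] by simp

lemma pd_diff [simp]: "sm f \<Longrightarrow> sm h \<Longrightarrow> z \<in> W \<Longrightarrow> pd a (\<lambda>y. f y - h y) z = pd a f z - pd a h z"
  using pd_add[of f "\<lambda>y. - h y" z a] by simp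

lemma pd_sum [simp]:
  "(\<And>i. i \<in> I \<Longrightarrow> sm (f i)) \<Longrightarrow> z \<in> W \<Longrightarrow> pd a (\<lambda>y. \<Sum>i\<in>I. f i y) z = (\<Sum>i\<in>I. pd a (f i) z)"
  by (induction I rule: infinite_finite_induct) simp_all

lemma pd_divide_const: "sm f \<Longrightarrow> z \<in> W \<Longrightarrow> pd a (\<lambda>y. f y / k) z = pd a f z / k"
  using pd_mult[of f "\<lambda>y. inverse k" z a] by (simp add: divide_inverse)

lemma pd_cnj: "sm f \<Longrightarrow> z \<in> W \<Longrightarrow> pd a (\<lambda>y. cnj (f y)) z = cnj (pd (conj_index a) f z)"
  by (simp add: pd_def frechet_derivative_bounded_linear[OF bounded_linear_cnj] sm_differentiable)

lemma pd_commute: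
  assumes f: "sm f" and z: "z \<in> W"
  shows "pd a (pd b f) z = pd b (pd a f) z"
proof -
  let ?D = "\<lambda>u v. frechet_derivative (\<lambda>y. frechet_derivative f (at y) u) (at z) v"
  have d: "(\<lambda>y. frechet_derivative f (at y) v) differentiable (at z)" for v
    using f z unfolding sm_def by (rule smooth_on_differentiable[OF smooth_on_frechet_derivative])
  have *: "frechet_derivative (pd b f) (at z) v =
      (?D (base_vec b) v + frame_sgn b * \<i> * ?D (\<i> *s base_vec b) v) / 2" for b v
  proof -
    have L: "bounded_linear (\<lambda>x::complex. k * x)" for k by (rule bounded_linear_mult_right)
    have eq: "pd b f = (\<lambda>y. (1/2) * (frechet_derivative f (at y) (base_vec b) +
        (frame_sgn b * \<i>) * frechet_derivative f (at y) (\<i> *s base_vec b)))"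
      by (auto simp: pd_def)
    show ?thesis unfolding eq
      by (simp only: frechet_derivative_bounded_linear[OF L] frechet_derivative_add
          differentiable_bounded_linear[OF L] differentiable_add d) simp
  qed
  have c: "?D u v = ?D v u" for u v
    using frechet_derivative_commute[OF open_W z] f unfolding sm_def by blast
  show ?thesis
    unfolding pd_def[of a "pd b f"] pd_def[of b "pd a f"] *
    by (simp add: c[of "base_vec b"] c[of "\<i> *s base_vec b"] algebra_simps add_divide_distrib)
qed

end

section \<open>Kaehler geometry in holomorphic coordinates\<close>

lemma sum_delta_left: "(\<Sum>j\<in>UNIV. (if i = j then 1 else 0) * f j) = (f i :: complex)" for i :: "'k::finite"
  by (simp add: if_distrib[of "\<lambda>x. x * _"] cong: if_cong)

lemma sum_delta_right: "(\<Sum>j\<in>UNIV. f j * (if j = i then 1 else 0)) = (f i :: complex)" for i :: "'k::finite"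
  by (simp add: if_distrib cong: if_cong)

text \<open>With upper indices first, \<open>X\<close> and \<open>Y\<close> are endomorphisms of the
  tensor square of an n-dimensional space, and this is the trace of their product.\<close>

definition tr2 :: "('n::finite \<Rightarrow> 'n \<Rightarrow> 'n \<Rightarrow> 'n \<Rightarrow> complex) \<Rightarrow> ('n \<Rightarrow> 'n \<Rightarrow> 'n \<Rightarrow> 'n \<Rightarrow> complex) \<Rightarrow> complex" where
  "tr2 X Y = (\<Sum>b\<in>UNIV. \<Sum>d\<in>UNIV. \<Sum>a\<in>UNIV. \<Sum>c\<in>UNIV. X b d a c * Y a c b d)"

lemma tr2_commute: "tr2 X Y = tr2 Y X"
  unfolding tr2_def sum.cartesian_product
  by (rule sum.reindex_bij_witness[of _ "\<lambda>(b,d,a,c). (a,c,b,d)" "\<lambda>(b,d,a,c). (a,c,b,d)"]) auto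

text \<open>\<open>G i j\<close> stands for g(d_i, d_jbar), and \<open>H\<close> is its inverse with
  the barred index written first, so \<open>H q p\<close> is g^(p qbar). The assumption
  \<open>closed\<close> is the Kaehler condition in complex coordinates.\<close>

locale kaehler_patch = open_domain W for W :: "(complex^'n::finite) set" +
  fixes G H :: "'n \<Rightarrow> 'n \<Rightarrow> complex^'n \<Rightarrow> complex"
  assumes sm_G [simp]: "sm (G i j)" and sm_H [simp]: "sm (H i j)"
    and G_herm: "z \<in> W \<Longrightarrow> cnj (G i j z) = G j i z"
    and H_herm: "z \<in> W \<Longrightarrow> cnj (H i j z) = H j i z"
    and GH: "z \<in> W \<Longrightarrow> (\<Sum>j\<in>UNIV. G i j z * H j k z) = (if i = k then 1 else 0)"
    and HG: "z \<in> W \<Longrightarrow> (\<Sum>j\<in>UNIV. H i j z * G j k z) = (if i = k then 1 else 0)"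
    and closed: "z \<in> W \<Longrightarrow> pd (Inl i) (G j l) z = pd (Inl j) (G i l) z"
begin

abbreviation dl :: "'n \<Rightarrow> (complex^'n \<Rightarrow> complex) \<Rightarrow> complex^'n \<Rightarrow> complex" where
  "dl i \<equiv> pd (Inl i)"

abbreviation dr :: "'n \<Rightarrow> (complex^'n \<Rightarrow> complex) \<Rightarrow> complex^'n \<Rightarrow> complex" where
  "dr i \<equiv> pd (Inr i)"

lemma cnj_dl: "sm f \<Longrightarrow> z \<in> W \<Longrightarrow> cnj (dl i f z) = dr i (\<lambda>y. cnj (f y)) z"
  by (simp add: pd_cnj)

lemma cnj_dr: "sm f \<Longrightarrow> z \<in> W \<Longrightarrow> cnj (dr i f z) = dl i (\<lambda>y. cnj (f y)) z"
  by (simp add: pd_cnj)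

lemma cnj_dl_G: "z \<in> W \<Longrightarrow> cnj (dl i (G j k) z) = dr i (G k j) z"
  by (simp add: cnj_dl, rule pd_cong) (simp_all add: G_herm)

lemma cnj_dr_G: "z \<in> W \<Longrightarrow> cnj (dr i (G j k) z) = dl i (G k j) z"
  by (simp add: cnj_dr, rule pd_cong) (simp_all add: G_herm)

lemma closed_bar: "z \<in> W \<Longrightarrow> dr i (G j l) z = dr l (G j i) z"
  using closed[of z i l j] by (metis cnj_dl_G)

text \<open>Differentiate G H = 1 and multiply by \<open>H\<close> from the left.\<close>

lemma pd_H:
  assumes z: "z \<in> W"
  shows "pd a (H q b) z = - (\<Sum>i\<in>UNIV. \<Sum>j\<in>UNIV. H q i z * pd a (G i j) z * H j b z)"
proof -
  have *: "(\<Sum>j\<in>UNIV. pd a (G i j) z * H j b z) = - (\<Sum>j\<in>UNIV. G i j z * pd a (H j b) z)" for i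
  proof -
    have "pd a (\<lambda>y. \<Sum>j\<in>UNIV. G i j y * H j b y) z = pd a (\<lambda>y. if i = b then 1 else 0) z"
      by (rule pd_cong[OF z]) (simp add: GH)
    then show ?thesis using z by (simp add: sum.distrib eq_neg_iff_add_eq_0)
  qed
  have "(\<Sum>i\<in>UNIV. \<Sum>j\<in>UNIV. H q i z * pd a (G i j) z * H j b z)
      = (\<Sum>i\<in>UNIV. H q i z * (\<Sum>j\<in>UNIV. pd a (G i j) z * H j b z))"
    by (simp add: sum_distrib_left mult_ac)
  also have "\<dots> = - (\<Sum>i\<in>UNIV. \<Sum>j\<in>UNIV. H q i z * G i j z * pd a (H j b) z)"
    unfolding * by (simp add: sum_distrib_left mult_ac sum_negf)
  also have "\<dots> = - (\<Sum>j\<in>UNIV. (\<Sum>i\<in>UNIV. H q i z * G i j z) * pd a (H j b) z)"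
    by (subst sum.swap) (simp add: sum_distrib_right)
  also have "\<dots> = - pd a (H q b) z"
    by (simp add: HG[OF z] sum_delta_left)
  finally show ?thesis by simp
qed

section \<open>The holomorphic Christoffel symbols\<close>

definition Gam :: "'n \<Rightarrow> 'n \<Rightarrow> 'n \<Rightarrow> complex^'n \<Rightarrow> complex" where
  "Gam k i j = (\<lambda>y. \<Sum>l\<in>UNIV. H l k y * dl i (G j l) y)"

lemma sm_Gam [simp]: "sm (Gam k i j)"
  by (simp add: Gam_def)

lemma Gam_sym: "z \<in> W \<Longrightarrow> Gam k i j z = Gam k j i z"
  by (simp add: Gam_def closed[of z i j])

text \<open>The inverse metric is parallel: along d_p only its unbarred index carries a connection
  term.\<close>

lemma dl_H: "z \<in> W \<Longrightarrow> dl p (H q b) z = - (\<Sum>k\<in>UNIV. H q k z * Gam b p k z)"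
  by (simp add: pd_H Gam_def sum_distrib_left mult_ac)

lemma Gam_G:
  assumes z: "z \<in> W"
  shows "(\<Sum>e\<in>UNIV. Gam e i k z * G e l z) = dl i (G k l) z"
proof -
  have "(\<Sum>e\<in>UNIV. Gam e i k z * G e l z) = (\<Sum>e\<in>UNIV. \<Sum>m\<in>UNIV. H m e z * dl i (G k m) z * G e l z)"
    by (simp add: Gam_def sum_distrib_right)
  also have "\<dots> = (\<Sum>m\<in>UNIV. dl i (G k m) z * (\<Sum>e\<in>UNIV. H m e z * G e l z))"
    by (subst sum.swap) (simp add: sum_distrib_left mult_ac)
  also have "\<dots> = dl i (G k l) z"
    by (simp add: HG[OF z] sum_delta_right)
  finally show ?thesis .
qed

text \<open>By \<open>pd_H\<close> both sides are three factors \<open>H\<close> contracted with a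
  barred derivative of \<open>G\<close>; closedness makes that derivative symmetric in the two
  barred indices, which exchanges p and b.\<close>

lemma raised_dr_H:
  assumes z: "z \<in> W"
  shows "(\<Sum>q\<in>UNIV. H q p z * dr q (H m b) z) = (\<Sum>q\<in>UNIV. H q b z * dr q (H m p) z)"
proof -
  have "(\<Sum>q\<in>UNIV. H q p z * dr q (H m b) z)
     = - (\<Sum>q\<in>UNIV. \<Sum>i\<in>UNIV. \<Sum>j\<in>UNIV. H q p z * (H m i z * dr q (G i j) z * H j b z))" for p b
    by (simp add: pd_H[OF z] sum_distrib_left sum_negf)
  note * = this
  have "(\<Sum>q\<in>UNIV. \<Sum>i\<in>UNIV. \<Sum>j\<in>UNIV. H q p z * (H m i z * dr q (G i j) z * H j b z))
     = (\<Sum>q\<in>UNIV. \<Sum>i\<in>UNIV. \<Sum>j\<in>UNIV. H q b z * (H m i z * dr q (G i j) z * H j p z))"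
    unfolding sum.cartesian_product
    by (rule sum.reindex_bij_witness[of _ "\<lambda>(q,i,j). (j,i,q)" "\<lambda>(q,i,j). (j,i,q)"])
       (auto simp: closed_bar[OF z] mult_ac)
  then show ?thesis by (simp add: *)
qed

lemma dl_Gam:
  assumes z: "z \<in> W"
  shows "dl p (Gam d a c) z + (\<Sum>f\<in>UNIV. Gam d p f z * Gam f a c z)
       = (\<Sum>l\<in>UNIV. H l d z * dl p (dl a (G c l)) z)"
proof -
  have "(\<Sum>l\<in>UNIV. dl p (H l d) z * dl a (G c l) z)
      = - (\<Sum>l\<in>UNIV. \<Sum>k\<in>UNIV. H l k z * Gam d p k z * dl a (G c l) z)"
    by (simp add: dl_H[OF z] sum_distrib_right sum_negf)
  also have "\<dots> = - (\<Sum>f\<in>UNIV. Gam d p f z * Gam f a c z)"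
    by (subst sum.swap) (simp add: Gam_def[of _ a c] sum_distrib_left mult_ac)
  finally show ?thesis
    using z by (simp add: Gam_def[of d a c] sum.distrib)
qed

text \<open>This is the vanishing of the (2,0) part of the curvature. The derivative of
  \<open>H\<close> inside \<open>Gam\<close> absorbs the quadratic term, and what remains is a
  second derivative of \<open>G\<close>, symmetric in p and a.\<close>

lemma Gam_flat:
  assumes z: "z \<in> W"
  shows "dl p (Gam d a c) z + (\<Sum>f\<in>UNIV. Gam d p f z * Gam f a c z)
       = dl a (Gam d p c) z + (\<Sum>f\<in>UNIV. Gam d a f z * Gam f p c z)"
  unfolding dl_Gam[OF z] by (simp add: pd_commute[OF _ z, of _ "Inl p"])

text \<open>The components \<open>R(\<partial>\<^sub>i, \<partial>\<^sub>\<bar>j, \<partial>\<^sub>k, \<partial>\<^sub>\<bar>l)\<close>, and the same tensor with the barred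
  indices raised; upper indices of \<open>A\<close> come first.\<close>

definition R :: "'n \<Rightarrow> 'n \<Rightarrow> 'n \<Rightarrow> 'n \<Rightarrow> complex^'n \<Rightarrow> complex" where
  "R i j k l = (\<lambda>y. - (\<Sum>e\<in>UNIV. dr j (Gam e i k) y * G e l y))"

definition A :: "'n \<Rightarrow> 'n \<Rightarrow> 'n \<Rightarrow> 'n \<Rightarrow> complex^'n \<Rightarrow> complex" where
  "A b d a c = (\<lambda>y. - (\<Sum>q\<in>UNIV. H q b y * dr q (Gam d a c) y))"

section \<open>Symmetries of the curvature and raising of its barred indices\<close>

lemma sm_R [simp]: "sm (R i j k l)"
  by (simp add: R_def)

lemma sm_A [simp]: "sm (A b d a c)"
  by (simp add: A_def)

text \<open>The classical form of the Kaehler curvature, from which the symmetry in the barred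
  indices and the Hermitian symmetry can be read off.\<close>

lemma R_eq:
  assumes z: "z \<in> W"
  shows "R i j k l z = - dr j (dl i (G k l)) z + (\<Sum>e\<in>UNIV. Gam e i k z * dr j (G e l) z)"
proof -
  have "dr j (\<lambda>y. \<Sum>e\<in>UNIV. Gam e i k y * G e l y) z = dr j (dl i (G k l)) z"
    by (rule pd_cong[OF z]) (simp add: Gam_G)
  then show ?thesis using z by (simp add: R_def sum.distrib algebra_simps)
qed

lemma dr_dl_G_sym: "z \<in> W \<Longrightarrow> dr j (dl i (G k l)) z = dr l (dl i (G k j)) z"
proof -
  assume z: "z \<in> W"
  have "dr j (dl i (G k l)) z = dl i (dr j (G k l)) z" by (rule pd_commute[OF sm_G z])
  also have "\<dots> = dl i (dr l (G k j)) z" by (rule pd_cong[OF z]) (rule closed_bar)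
  also have "\<dots> = dr l (dl i (G k j)) z" by (rule pd_commute[OF sm_G z])
  finally show ?thesis .
qed

lemma R_sym_bar: "z \<in> W \<Longrightarrow> R i j k l z = R i l k j z"
  by (simp add: R_eq dr_dl_G_sym[of z j i k l] closed_bar[of z j _ l])

lemma R_sym:
  assumes z: "z \<in> W"
  shows "R i j k l z = R k j i l z"
proof -
  have "dr j (Gam e i k) z = dr j (Gam e k i) z" for e
    by (rule pd_cong[OF z]) (rule Gam_sym)
  then show ?thesis by (simp add: R_def)
qed

lemma R_herm:
  assumes z: "z \<in> W"
  shows "cnj (R i j k l z) = R j i l k z"
proof -
  have "cnj (dr j (dl i (G k l)) z) = dl j (\<lambda>y. cnj (dl i (G k l) y)) z"
    using z by (simp add: cnj_dr)
  also have "\<dots> = dl j (dr i (G l k)) z"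
    by (rule pd_cong[OF z]) (rule cnj_dl_G)
  also have "\<dots> = dr i (dl j (G l k)) z"
    by (rule pd_commute[OF sm_G z])
  finally have 1: "cnj (dr j (dl i (G k l)) z) = dr i (dl j (G l k)) z" .
  have "cnj (\<Sum>e\<in>UNIV. Gam e i k z * dr j (G e l) z)
      = (\<Sum>e\<in>UNIV. \<Sum>m\<in>UNIV. H e m z * dr i (G m k) z * dl j (G l e) z)"
    using z by (simp add: Gam_def sum_distrib_right H_herm cnj_dl_G cnj_dr_G)
  also have "\<dots> = (\<Sum>e\<in>UNIV. Gam e j l z * dr i (G e k) z)"
    by (subst sum.swap) (simp add: Gam_def sum_distrib_right sum_distrib_left mult_ac)
  finally show ?thesis using 1 z by (simp add: R_eq)
qed

lemma A_R:
  assumes z: "z \<in> W"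
  shows "A b d a c z = (\<Sum>j\<in>UNIV. \<Sum>l\<in>UNIV. H j b z * H l d z * R a j c l z)"
proof -
  have "(\<Sum>l\<in>UNIV. H l d z * R a j c l z) = - dr j (Gam d a c) z" for j
  proof -
    have "(\<Sum>l\<in>UNIV. H l d z * R a j c l z)
        = - (\<Sum>l\<in>UNIV. \<Sum>e\<in>UNIV. H l d z * (dr j (Gam e a c) z * G e l z))"
      by (simp add: R_def sum_distrib_left sum_negf)
    also have "\<dots> = - (\<Sum>e\<in>UNIV. dr j (Gam e a c) z * (\<Sum>l\<in>UNIV. G e l z * H l d z))"
      by (subst sum.swap) (simp add: sum_distrib_left mult_ac)
    also have "\<dots> = - dr j (Gam d a c) z"
      by (simp add: GH[OF z] sum_delta_right)
    finally show ?thesis .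
  qed
  note * = this
  have "(\<Sum>j\<in>UNIV. \<Sum>l\<in>UNIV. H j b z * H l d z * R a j c l z)
      = (\<Sum>j\<in>UNIV. H j b z * (\<Sum>l\<in>UNIV. H l d z * R a j c l z))"
    by (simp add: sum_distrib_left mult_ac)
  then show ?thesis by (simp add: * A_def sum_negf)
qed

lemma R_A:
  assumes z: "z \<in> W"
  shows "R a j c l z = (\<Sum>b\<in>UNIV. \<Sum>d\<in>UNIV. A b d a c z * G b j z * G d l z)"
proof -
  have *: "(\<Sum>b\<in>UNIV. A b d a c z * G b j z) = - dr j (Gam d a c) z" for d
  proof -
    have "(\<Sum>b\<in>UNIV. A b d a c z * G b j z)
        = - (\<Sum>b\<in>UNIV. \<Sum>q\<in>UNIV. H q b z * dr q (Gam d a c) z * G b j z)"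
      by (simp add: A_def sum_distrib_right sum_negf)
    also have "\<dots> = - (\<Sum>q\<in>UNIV. dr q (Gam d a c) z * (\<Sum>b\<in>UNIV. H q b z * G b j z))"
      by (subst sum.swap) (simp add: sum_distrib_left mult_ac)
    also have "\<dots> = - dr j (Gam d a c) z"
      by (simp add: HG[OF z] sum_delta_right)
    finally show ?thesis .
  qed
  have "(\<Sum>b\<in>UNIV. \<Sum>d\<in>UNIV. A b d a c z * G b j z * G d l z)
     = (\<Sum>d\<in>UNIV. (\<Sum>b\<in>UNIV. A b d a c z * G b j z) * G d l z)"
    by (subst sum.swap) (simp add: sum_distrib_right)
  then show ?thesis by (simp add: * R_def sum_negf)
qed

lemma A_sym_upper:
  assumes z: "z \<in> W"
  shows "A b d a c z = A d b a c z"
  unfolding A_R[OF z] by (subst sum.swap) (simp add: R_sym_bar[OF z, of a _ c] mult_ac)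

lemma A_sym_lower:
  assumes z: "z \<in> W"
  shows "A b d a c z = A b d c a z"
  unfolding A_R[OF z] by (simp add: R_sym[OF z, of a])

section \<open>The second Bianchi identity in both types of directions\<close>

lemma bianchi_bar:
  assumes z: "z \<in> W"
  shows "(\<Sum>q\<in>UNIV. H q p z * dr q (A b d a c) z) = (\<Sum>q\<in>UNIV. H q b z * dr q (A p d a c) z)"
proof -
  have *: "(\<Sum>q\<in>UNIV. H q p z * dr q (A b d a c) z)
     = - (\<Sum>m\<in>UNIV. (\<Sum>q\<in>UNIV. H q p z * dr q (H m b) z) * dr m (Gam d a c) z)
       - (\<Sum>q\<in>UNIV. \<Sum>m\<in>UNIV. H q p z * H m b z * dr q (dr m (Gam d a c)) z)" for p b
  proof -
    have "(\<Sum>q\<in>UNIV. H q p z * dr q (A b d a c) z)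
       = - (\<Sum>q\<in>UNIV. \<Sum>m\<in>UNIV. H q p z * dr q (H m b) z * dr m (Gam d a c) z)
        - (\<Sum>q\<in>UNIV. \<Sum>m\<in>UNIV. H q p z * H m b z * dr q (dr m (Gam d a c)) z)"
      using z by (simp add: A_def sum_distrib_left sum.distrib sum_negf sum_subtractf algebra_simps)
    also have "(\<Sum>q\<in>UNIV. \<Sum>m\<in>UNIV. H q p z * dr q (H m b) z * dr m (Gam d a c) z)
      = (\<Sum>m\<in>UNIV. (\<Sum>q\<in>UNIV. H q p z * dr q (H m b) z) * dr m (Gam d a c) z)"
      by (subst sum.swap) (simp add: sum_distrib_right)
    finally show ?thesis .
  qed
  \<comment> \<open>One barred derivative is already inside \<open>A\<close>; the second one
    commutes with it. The terms in which \<open>H\<close> is differentiated are symmetric in p and b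
    by \<open>raised_dr_H\<close>.\<close>
  have "(\<Sum>q\<in>UNIV. \<Sum>m\<in>UNIV. H q p z * H m b z * dr q (dr m (Gam d a c)) z)
      = (\<Sum>q\<in>UNIV. \<Sum>m\<in>UNIV. H q b z * H m p z * dr q (dr m (Gam d a c)) z)"
    by (subst sum.swap) (simp add: pd_commute[OF sm_Gam z] mult_ac)
  then show ?thesis unfolding *[of p b] *[of b p] raised_dr_H[OF z, of p _ b] by simp
qed

text \<open>The covariant derivative in (1,0) directions of a tensor with unbarred indices, two upper and
  two lower ones; in (0,1) directions it is \<open>dr\<close>.\<close>

definition nab :: "'n \<Rightarrow> ('n \<Rightarrow> 'n \<Rightarrow> 'n \<Rightarrow> 'n \<Rightarrow> complex^'n \<Rightarrow> complex) \<Rightarrow>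
    'n \<Rightarrow> 'n \<Rightarrow> 'n \<Rightarrow> 'n \<Rightarrow> complex^'n \<Rightarrow> complex" where
  "nab p X b d a c = (\<lambda>y. dl p (X b d a c) y
     + (\<Sum>f\<in>UNIV. Gam b p f y * X f d a c y) + (\<Sum>f\<in>UNIV. Gam d p f y * X b f a c y)
     - (\<Sum>f\<in>UNIV. Gam f p a y * X b d f c y) - (\<Sum>f\<in>UNIV. Gam f p c y * X b d a f y))"

lemma sm_nab [simp]: "(\<And>b d a c. sm (X b d a c)) \<Longrightarrow> sm (nab p X b d a c)"
  by (simp add: nab_def)

text \<open>As the inverse metric is parallel, the derivative of the factor \<open>H\<close> in
  \<open>A\<close> cancels the connection term of the index b. Left under \<open>H\<close> is the
  covariant derivative of \<open>dr m Gam\<close> in its three unbarred indices.\<close>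

lemma nab_A:
  assumes z: "z \<in> W"
  shows "nab p A b d a c z = - (\<Sum>m\<in>UNIV. H m b z *
    (dl p (dr m (Gam d a c)) z + (\<Sum>f\<in>UNIV. Gam d p f z * dr m (Gam f a c) z)
     - (\<Sum>f\<in>UNIV. Gam f p a z * dr m (Gam d f c) z) - (\<Sum>f\<in>UNIV. Gam f p c z * dr m (Gam d a f) z)))"
proof -
  have 1: "(\<Sum>m\<in>UNIV. dl p (H m b) z * dr m (Gam d a c) z) = (\<Sum>f\<in>UNIV. Gam b p f z * A f d a c z)"
  proof -
    have "(\<Sum>m\<in>UNIV. dl p (H m b) z * dr m (Gam d a c) z)
      = - (\<Sum>m\<in>UNIV. \<Sum>f\<in>UNIV. H m f z * Gam b p f z * dr m (Gam d a c) z)"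
      by (simp add: dl_H[OF z] sum_distrib_right sum_negf)
    also have "\<dots> = (\<Sum>f\<in>UNIV. Gam b p f z * A f d a c z)"
      by (subst sum.swap) (simp add: A_def sum_distrib_left mult_ac sum_negf)
    finally show ?thesis .
  qed
  have 2: "(\<Sum>f\<in>UNIV. k f * A b (u f) (v f) (w f) z)
      = - (\<Sum>m\<in>UNIV. H m b z * (\<Sum>f\<in>UNIV. k f * dr m (Gam (u f) (v f) (w f)) z))" for k u v w
  proof -
    have "(\<Sum>f\<in>UNIV. k f * A b (u f) (v f) (w f) z)
      = - (\<Sum>f\<in>UNIV. \<Sum>m\<in>UNIV. k f * (H m b z * dr m (Gam (u f) (v f) (w f)) z))"
      by (simp add: A_def sum_distrib_left sum_negf)
    also have "\<dots> = - (\<Sum>m\<in>UNIV. H m b z * (\<Sum>f\<in>UNIV. k f * dr m (Gam (u f) (v f) (w f)) z))"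
      by (subst sum.swap) (simp add: sum_distrib_left mult_ac)
    finally show ?thesis .
  qed
  have 3: "dl p (A b d a c) z = - (\<Sum>m\<in>UNIV. dl p (H m b) z * dr m (Gam d a c) z)
      - (\<Sum>m\<in>UNIV. H m b z * dl p (dr m (Gam d a c)) z)"
    using z by (simp add: A_def sum.distrib)
  show ?thesis
    unfolding nab_def 3 1
    by (simp add: 2[of _ "\<lambda>f. f" "\<lambda>_. a" "\<lambda>_. c"] 2[of _ "\<lambda>_. d" "\<lambda>f. f" "\<lambda>_. c"]
      2[of _ "\<lambda>_. d" "\<lambda>_. a" "\<lambda>f. f"] sum.distrib sum_subtractf algebra_simps)
qed

lemma bianchi:
  assumes z: "z \<in> W"
  shows "nab p A b d a c z = nab a A b d p c z"
proof -
  \<comment> \<open>The barred derivative of the flatness identity: the product rule applied to the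
    quadratic terms produces the connection terms of d and c in \<open>nab_A\<close> on both sides,
    while the connection term of the remaining lower index is symmetric in p and a.\<close>
  have "dr m (\<lambda>y. dl p (Gam d a c) y + (\<Sum>f\<in>UNIV. Gam d p f y * Gam f a c y)) z
       = dr m (\<lambda>y. dl a (Gam d p c) y + (\<Sum>f\<in>UNIV. Gam d a f y * Gam f p c y)) z" for m
    by (rule pd_cong[OF z]) (rule Gam_flat)
  then have "dl p (dr m (Gam d a c)) z + (\<Sum>f\<in>UNIV. Gam d p f z * dr m (Gam f a c) z)
        + (\<Sum>f\<in>UNIV. Gam f a c z * dr m (Gam d p f) z)
      = dl a (dr m (Gam d p c)) z + (\<Sum>f\<in>UNIV. Gam d a f z * dr m (Gam f p c) z)
        + (\<Sum>f\<in>UNIV. Gam f p c z * dr m (Gam d a f) z)" for m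
    using z by (simp add: sum.distrib pd_commute[OF sm_Gam z, of "Inl p" "Inr m"]
        pd_commute[OF sm_Gam z, of "Inl a" "Inr m"] mult.commute add_ac)
  then have "dl p (dr m (Gam d a c)) z + (\<Sum>f\<in>UNIV. Gam d p f z * dr m (Gam f a c) z)
     - (\<Sum>f\<in>UNIV. Gam f p a z * dr m (Gam d f c) z) - (\<Sum>f\<in>UNIV. Gam f p c z * dr m (Gam d a f) z)
    = dl a (dr m (Gam d p c)) z + (\<Sum>f\<in>UNIV. Gam d a f z * dr m (Gam f p c) z)
     - (\<Sum>f\<in>UNIV. Gam f a p z * dr m (Gam d f c) z) - (\<Sum>f\<in>UNIV. Gam f a c z * dr m (Gam d p f) z)" for m
    by (simp add: Gam_sym[OF z, of _ p a] algebra_simps)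
  then show ?thesis by (simp add: nab_A[OF z])
qed

section \<open>Ricci identity, raising of the derivative index and product rules\<close>

text \<open>Since differentiation in (0,1) directions has no connection term, the commutator comes
  only from \<open>dr q\<close> falling on the coefficients \<open>Gam\<close> of
  \<open>nab\<close>; these derivatives are the curvature up to sign and raising.\<close>

lemma nab_commutator:
  assumes z: "z \<in> W" and X: "\<And>b d a c. sm (X b d a c)"
  shows "nab p (\<lambda>b d a c. dr q (X b d a c)) b d a c z = dr q (nab p X b d a c) z
    - (\<Sum>f\<in>UNIV. dr q (Gam b p f) z * X f d a c z) - (\<Sum>f\<in>UNIV. dr q (Gam d p f) z * X b f a c z)
    + (\<Sum>f\<in>UNIV. dr q (Gam f p a) z * X b d f c z) + (\<Sum>f\<in>UNIV. dr q (Gam f p c) z * X b d a f z)"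
  using z X by (simp add: nab_def sum.distrib pd_commute[OF X z, of "Inl p" "Inr q"])

lemma nab_sum_mult:
  assumes z: "z \<in> W" and h: "\<And>q. sm (h q)" and Y: "\<And>q b d a c. sm (Y q b d a c)"
  shows "nab p (\<lambda>b d a c y. \<Sum>q\<in>UNIV. h q y * Y q b d a c y) b d a c z
    = (\<Sum>q\<in>UNIV. dl p (h q) z * Y q b d a c z) + (\<Sum>q\<in>UNIV. h (q::'n) z * nab p (Y q) b d a c z)"
proof -
  have "(\<Sum>f\<in>UNIV. k f * (\<Sum>q\<in>UNIV. h q z * V q f)) = (\<Sum>q\<in>UNIV. h q z * (\<Sum>f\<in>UNIV. k f * V q f))"
    for k :: "'n \<Rightarrow> complex" and V
    unfolding sum_distrib_left by (subst sum.swap) (simp add: mult_ac)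
  note * = this
  show ?thesis using z h Y
    by (simp add: nab_def * sum.distrib sum_subtractf distrib_left right_diff_distrib)
qed

text \<open>The parameter q of \<open>Y\<close> plays the part of a barred index, on which
  \<open>nab p\<close> has no connection term. Once raised to e it does get one, and because
  \<open>nab\<close> knows only four slots this term is written separately.\<close>

lemma raised_nab:
  assumes z: "z \<in> W" and Y: "\<And>q b d a c. sm (Y q b d a c)"
  shows "(\<Sum>q\<in>UNIV. H q e z * nab p (Y q) b d a c z)
    = nab p (\<lambda>b d a c y. \<Sum>q\<in>UNIV. H q e y * Y q b d a c y) b d a c z
      + (\<Sum>f\<in>UNIV. Gam e p f z * (\<Sum>q\<in>UNIV. H q f z * Y q b d a c z))"
proof -
  have "(\<Sum>q\<in>UNIV. dl p (H q e) z * Y q b d a c z)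
      = - (\<Sum>q\<in>UNIV. \<Sum>f\<in>UNIV. H q f z * Gam e p f z * Y q b d a c z)"
    by (simp add: dl_H[OF z] sum_distrib_right sum_negf)
  also have "\<dots> = - (\<Sum>f\<in>UNIV. Gam e p f z * (\<Sum>q\<in>UNIV. H q f z * Y q b d a c z))"
    by (subst sum.swap) (simp add: sum_distrib_left mult_ac)
  finally show ?thesis
    by (simp add: nab_sum_mult[OF z sm_H Y])
qed

text \<open>Every index is contracted, so the connection terms cancel in pairs: each term of an
  upper index of one factor against that of the lower index of the other factor it is summed with.
  The four reindexings are these pairs.\<close>

lemma dl_tr2:
  assumes z: "z \<in> W" and X: "\<And>b d a c. sm (X b d a c)" and Y: "\<And>b d a c. sm (Y b d a c)"
  shows "dl p (\<lambda>y. tr2 (\<lambda>b d a c. X b d a c y) (\<lambda>b d a c. Y b d a c y)) z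
    = tr2 (\<lambda>b d a c. nab p X b d a c z) (\<lambda>b d a c. Y b d a c z)
    + tr2 (\<lambda>b d a c. X b d a c z) (\<lambda>b d a c. nab p Y b d a c z)"
proof -
  let ?S = "\<lambda>t. \<Sum>b\<in>UNIV. \<Sum>d\<in>UNIV. \<Sum>a\<in>UNIV. \<Sum>c\<in>UNIV. \<Sum>f\<in>UNIV. (t b d a c f :: complex)"
  let ?x = "\<lambda>b d a c. X b d a c z" and ?y = "\<lambda>b d a c. Y b d a c z"
  let ?g = "\<lambda>b p f. Gam b p f z"
  have 1: "?S (\<lambda>b d a c f. ?x b d a c * (?g f p b * ?y a c f d)) = ?S (\<lambda>b d a c f. ?g b p f * ?x f d a c * ?y a c b d)"
    unfolding sum.cartesian_product
    by (rule sum.reindex_bij_witness[of _ "\<lambda>(b,d,a,c,f). (f,d,a,c,b)" "\<lambda>(b,d,a,c,f). (f,d,a,c,b)"]) auto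
  have 2: "?S (\<lambda>b d a c f. ?x b d a c * (?g f p d * ?y a c b f)) = ?S (\<lambda>b d a c f. ?g d p f * ?x b f a c * ?y a c b d)"
    unfolding sum.cartesian_product
    by (rule sum.reindex_bij_witness[of _ "\<lambda>(b,d,a,c,f). (b,f,a,c,d)" "\<lambda>(b,d,a,c,f). (b,f,a,c,d)"]) auto
  have 3: "?S (\<lambda>b d a c f. ?x b d a c * (?g a p f * ?y f c b d)) = ?S (\<lambda>b d a c f. ?g f p a * ?x b d f c * ?y a c b d)"
    unfolding sum.cartesian_product
    by (rule sum.reindex_bij_witness[of _ "\<lambda>(b,d,a,c,f). (b,d,f,c,a)" "\<lambda>(b,d,a,c,f). (b,d,f,c,a)"]) auto
  have 4: "?S (\<lambda>b d a c f. ?x b d a c * (?g c p f * ?y a f b d)) = ?S (\<lambda>b d a c f. ?g f p c * ?x b d a f * ?y a c b d)"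
    unfolding sum.cartesian_product
    by (rule sum.reindex_bij_witness[of _ "\<lambda>(b,d,a,c,f). (b,d,a,f,c)" "\<lambda>(b,d,a,c,f). (b,d,a,f,c)"]) auto
  have nX: "tr2 (\<lambda>b d a c. nab p X b d a c z) ?y = tr2 (\<lambda>b d a c. dl p (X b d a c) z) ?y
     + ?S (\<lambda>b d a c f. ?g b p f * ?x f d a c * ?y a c b d) + ?S (\<lambda>b d a c f. ?g d p f * ?x b f a c * ?y a c b d)
     - ?S (\<lambda>b d a c f. ?g f p a * ?x b d f c * ?y a c b d) - ?S (\<lambda>b d a c f. ?g f p c * ?x b d a f * ?y a c b d)"
    by (simp add: tr2_def nab_def distrib_right left_diff_distrib sum_distrib_right sum.distrib sum_subtractf)
  have nY: "tr2 ?x (\<lambda>b d a c. nab p Y b d a c z) = tr2 ?x (\<lambda>b d a c. dl p (Y b d a c) z)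
     + ?S (\<lambda>b d a c f. ?x b d a c * (?g a p f * ?y f c b d)) + ?S (\<lambda>b d a c f. ?x b d a c * (?g c p f * ?y a f b d))
     - ?S (\<lambda>b d a c f. ?x b d a c * (?g f p b * ?y a c f d)) - ?S (\<lambda>b d a c f. ?x b d a c * (?g f p d * ?y a c b f))"
    by (simp add: tr2_def nab_def distrib_left right_diff_distrib sum_distrib_left sum.distrib sum_subtractf)
  have "dl p (\<lambda>y. tr2 (\<lambda>b d a c. X b d a c y) (\<lambda>b d a c. Y b d a c y)) z
     = tr2 (\<lambda>b d a c. dl p (X b d a c) z) ?y + tr2 ?x (\<lambda>b d a c. dl p (Y b d a c) z)"
    using z X Y by (simp add: tr2_def sum.distrib)
  then show ?thesis unfolding nX nY 1 2 3 4 by (simp only: add_diff_eq diff_add_eq) simp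
qed

lemma dr_tr2:
  assumes z: "z \<in> W" and X: "\<And>b d a c. sm (X b d a c)"
  shows "dr q (\<lambda>y. tr2 (\<lambda>b d a c. X b d a c y) (\<lambda>b d a c. X b d a c y)) z
    = 2 * tr2 (\<lambda>b d a c. dr q (X b d a c) z) (\<lambda>b d a c. X b d a c z)"
proof -
  have "dr q (\<lambda>y. tr2 (\<lambda>b d a c. X b d a c y) (\<lambda>b d a c. X b d a c y)) z
     = tr2 (\<lambda>b d a c. dr q (X b d a c) z) (\<lambda>b d a c. X b d a c z)
     + tr2 (\<lambda>b d a c. X b d a c z) (\<lambda>b d a c. dr q (X b d a c) z)"
    using z X by (simp add: tr2_def sum.distrib)
  then show ?thesis by (simp add: tr2_commute)
qed

lemma sm_tr2 [simp]:
  "(\<And>b d a c. sm (X b d a c)) \<Longrightarrow> (\<And>b d a c. sm (Y b d a c)) \<Longrightarrow>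
    sm (\<lambda>y. tr2 (\<lambda>b d a c. X b d a c y) (\<lambda>b d a c. Y b d a c y))"
  by (simp add: tr2_def)

section \<open>The rough Laplacian of the raised curvature\<close>

text \<open>The tensor X of the overview. The barred index q of \<open>dr q A\<close> gets no
  connection term, because Christoffel symbols with mixed lower indices vanish.\<close>

definition lapA :: "'n \<Rightarrow> 'n \<Rightarrow> 'n \<Rightarrow> 'n \<Rightarrow> complex^'n \<Rightarrow> complex" where
  "lapA b d a c z = (\<Sum>p\<in>UNIV. \<Sum>q\<in>UNIV. H q p z * nab p (\<lambda>b d a c. dr q (A b d a c)) b d a c z)"

lemma laplacian_tr2_A:
  assumes z: "z \<in> W"
  shows "(\<Sum>p\<in>UNIV. \<Sum>q\<in>UNIV. H q p z * dl p (dr q (\<lambda>y. tr2 (\<lambda>b d a c. A b d a c y) (\<lambda>b d a c. A b d a c y))) z)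
    = 2 * tr2 (\<lambda>b d a c. lapA b d a c z) (\<lambda>b d a c. A b d a c z)
    + 2 * (\<Sum>p\<in>UNIV. \<Sum>q\<in>UNIV. H q p z *
        tr2 (\<lambda>b d a c. dr q (A b d a c) z) (\<lambda>b d a c. nab p A b d a c z))"
proof -
  have 1: "dl p (dr q (\<lambda>y. tr2 (\<lambda>b d a c. A b d a c y) (\<lambda>b d a c. A b d a c y))) z
     = 2 * (tr2 (\<lambda>b d a c. nab p (\<lambda>b d a c. dr q (A b d a c)) b d a c z) (\<lambda>b d a c. A b d a c z)
       + tr2 (\<lambda>b d a c. dr q (A b d a c) z) (\<lambda>b d a c. nab p A b d a c z))" for p q
  proof -
    have "dl p (dr q (\<lambda>y. tr2 (\<lambda>b d a c. A b d a c y) (\<lambda>b d a c. A b d a c y))) z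
      = dl p (\<lambda>y. 2 * tr2 (\<lambda>b d a c. dr q (A b d a c) y) (\<lambda>b d a c. A b d a c y)) z"
      by (rule pd_cong[OF z]) (simp add: dr_tr2)
    also have "\<dots> = 2 * dl p (\<lambda>y. tr2 (\<lambda>b d a c. dr q (A b d a c) y) (\<lambda>b d a c. A b d a c y)) z"
      using z by simp
    finally show ?thesis using z by (simp add: dl_tr2)
  qed
  have 2: "tr2 (\<lambda>b d a c. lapA b d a c z) (\<lambda>b d a c. A b d a c z)
     = (\<Sum>p\<in>UNIV. \<Sum>q\<in>UNIV. H q p z *
       tr2 (\<lambda>b d a c. nab p (\<lambda>b d a c. dr q (A b d a c)) b d a c z) (\<lambda>b d a c. A b d a c z))"
    unfolding tr2_def lapA_def sum_distrib_left sum_distrib_right sum.cartesian_product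
    by (rule sum.reindex_bij_witness[of _ "\<lambda>(p,q,b,d,a,c). (b,d,a,c,p,q)" "\<lambda>(b,d,a,c,p,q). (p,q,b,d,a,c)"])
       (auto simp: mult_ac)
  show ?thesis unfolding 1 2
    by (simp add: algebra_simps sum.distrib sum_distrib_left)
qed

end

section \<open>Consequences of the Einstein condition\<close>

locale einstein_patch = kaehler_patch W G H for W :: "(complex^'n::finite) set" and G H +
  fixes lam :: complex
  assumes einstein: "z \<in> W \<Longrightarrow> (\<Sum>c\<in>UNIV. A b c a c z) = (if b = a then lam else 0)"
begin

lemma einstein': "z \<in> W \<Longrightarrow> (\<Sum>p\<in>UNIV. A p d p c z) = (if d = c then lam else 0)"
  using einstein[of z d c] by (simp add: A_sym_upper[of z _ d] A_sym_lower[of z _ _ _ c])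

text \<open>The Bianchi identity moves the derivative onto a contracted pair of indices, where
  \<open>nab a\<close> acts on the Ricci endomorphism. That is \<open>lam\<close> times the
  identity, whose covariant derivative vanishes.\<close>

lemma divergence_A:
  assumes z: "z \<in> W"
  shows "(\<Sum>p\<in>UNIV. nab p A p d a c z) = 0"
proof -
  have "(\<Sum>p\<in>UNIV. nab p A p d a c z) = (\<Sum>p\<in>UNIV. nab a A p d p c z)"
    by (simp add: bianchi[OF z, of _ _ d a])
  also have "\<dots> = (\<Sum>p\<in>UNIV. dl a (A p d p c) z)
     + (\<Sum>p\<in>UNIV. \<Sum>f\<in>UNIV. Gam p a f z * A f d p c z) + (\<Sum>p\<in>UNIV. \<Sum>f\<in>UNIV. Gam d a f z * A p f p c z)
     - (\<Sum>p\<in>UNIV. \<Sum>f\<in>UNIV. Gam f a p z * A p d f c z) - (\<Sum>p\<in>UNIV. \<Sum>f\<in>UNIV. Gam f a c z * A p d p f z)"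
    by (simp add: nab_def sum.distrib sum_subtractf)
  also have "(\<Sum>p\<in>UNIV. \<Sum>f\<in>UNIV. Gam f a p z * A p d f c z) = (\<Sum>p\<in>UNIV. \<Sum>f\<in>UNIV. Gam p a f z * A f d p c z)"
    by (rule sum.swap)
  also have "(\<Sum>p\<in>UNIV. \<Sum>f\<in>UNIV. Gam d a f z * A p f p c z) = Gam d a c z * lam"
    by (subst sum.swap) (simp add: sum_distrib_left[symmetric] einstein'[OF z] if_distrib cong: if_cong)
  also have "(\<Sum>p\<in>UNIV. \<Sum>f\<in>UNIV. Gam f a c z * A p d p f z) = Gam d a c z * lam"
    by (subst sum.swap) (simp add: sum_distrib_left[symmetric] einstein'[OF z] if_distrib cong: if_cong)
  also have "(\<Sum>p\<in>UNIV. dl a (A p d p c) z) = dl a (\<lambda>y. \<Sum>p\<in>UNIV. A p d p c y) z"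
    using z by simp
  also have "\<dots> = dl a (\<lambda>y. if d = c then lam else 0) z"
    by (rule pd_cong[OF z]) (rule einstein')
  finally show ?thesis by simp
qed

lemma lapA_eq:
  assumes z: "z \<in> W"
  shows "lapA b d a c z = lam * A b d a c z
    + (\<Sum>p\<in>UNIV. \<Sum>f\<in>UNIV. A b d p f z * A p f a c z)
    - (\<Sum>p\<in>UNIV. \<Sum>f\<in>UNIV. A b f p a z * A p d f c z)
    - (\<Sum>p\<in>UNIV. \<Sum>f\<in>UNIV. A b f p c z * A p d a f z)"
proof -
  let ?Y = "\<lambda>q b d a c. dr q (A b d a c)"
  \<comment> \<open>The derivative index is raised first because only then does the barred Bianchi
    identity become a symmetry in two upper indices, here e and b.\<close>
  define D where "D e b d a c = (\<lambda>y. \<Sum>q\<in>UNIV. H q e y * dr q (A b d a c) y)" for e b d a c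
  have smD [simp]: "sm (D e b d a c)" for e b d a c by (simp add: D_def)
  have D_sym: "D e b d a c y = D b e d a c y" if "y \<in> W" for e b d a c y
    unfolding D_def by (rule bianchi_bar[OF that])
  have rn: "(\<Sum>q\<in>UNIV. H q e z * nab p (?Y q) b d a c z)
      = nab p (D e) b d a c z + (\<Sum>f\<in>UNIV. Gam e p f z * D f b d a c z)" for e p b d a c
    unfolding D_def by (rule raised_nab[OF z]) simp
  \<comment> \<open>On both sides the full expression is the covariant derivative of the five-index
    tensor \<open>D\<close>; the separate sum is the connection term of whichever index stands
    outside the four slots.\<close>
  have swap: "nab p (D p) b d a c z + (\<Sum>f\<in>UNIV. Gam p p f z * D f b d a c z)
      = nab p (D b) p d a c z + (\<Sum>f\<in>UNIV. Gam b p f z * D f p d a c z)" for p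
  proof -
    have "dl p (D p b d a c) z = dl p (D b p d a c) z"
      by (rule pd_cong[OF z]) (rule D_sym)
    moreover have "(\<Sum>f\<in>UNIV. k f * D p f d a c z) = (\<Sum>f\<in>UNIV. k f * D f p d a c z)"
      and "(\<Sum>f\<in>UNIV. k f * D f b d a c z) = (\<Sum>f\<in>UNIV. k f * D b f d a c z)" for k :: "'n \<Rightarrow> complex"
      by (rule sum.cong[OF refl], rule arg_cong[of _ _ "(*) _"], rule D_sym[OF z])+
    ultimately show ?thesis
      by (simp add: nab_def D_sym[OF z, of p b])
  qed
  have contract: "(\<Sum>p\<in>UNIV. \<Sum>q\<in>UNIV. \<Sum>f\<in>UNIV. H q b z * (dr q (Gam (u p f) (v p f) (w p f)) z * k p f))
      = - (\<Sum>p\<in>UNIV. \<Sum>f\<in>UNIV. A b (u p f) (v p f) (w p f) z * k p f)" for u v w and k :: "'n \<Rightarrow> 'n \<Rightarrow> complex"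
  proof -
    have "(\<Sum>q\<in>UNIV. \<Sum>f\<in>UNIV. H q b z * (dr q (Gam (u p f) (v p f) (w p f)) z * k p f))
      = - (\<Sum>f\<in>UNIV. A b (u p f) (v p f) (w p f) z * k p f)" for p
      by (subst sum.swap) (simp add: A_def sum_distrib_right sum_distrib_left sum_negf mult_ac)
    then show ?thesis by (simp add: sum_negf)
  qed
  \<comment> \<open>Now p is contracted with an index of \<open>A\<close> itself, so that commuting
    the two derivatives exposes the divergence of \<open>A\<close>.\<close>
  have "lapA b d a c z = (\<Sum>p\<in>UNIV. \<Sum>q\<in>UNIV. H q b z * nab p (?Y q) p d a c z)"
    unfolding lapA_def rn swap ..
  also have "\<dots> = (\<Sum>p\<in>UNIV. \<Sum>q\<in>UNIV. H q b z * dr q (nab p A p d a c) z)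
    - (\<Sum>p\<in>UNIV. \<Sum>q\<in>UNIV. \<Sum>f\<in>UNIV. H q b z * (dr q (Gam p p f) z * A f d a c z))
    - (\<Sum>p\<in>UNIV. \<Sum>q\<in>UNIV. \<Sum>f\<in>UNIV. H q b z * (dr q (Gam d p f) z * A p f a c z))
    + (\<Sum>p\<in>UNIV. \<Sum>q\<in>UNIV. \<Sum>f\<in>UNIV. H q b z * (dr q (Gam f p a) z * A p d f c z))
    + (\<Sum>p\<in>UNIV. \<Sum>q\<in>UNIV. \<Sum>f\<in>UNIV. H q b z * (dr q (Gam f p c) z * A p d a f z))"
    by (simp add: nab_commutator[OF z] distrib_left right_diff_distrib sum.distrib sum_subtractf sum_distrib_left)
  also have "(\<Sum>p\<in>UNIV. \<Sum>q\<in>UNIV. H q b z * dr q (nab p A p d a c) z) = 0"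
  proof -
    have "(\<Sum>p\<in>UNIV. dr q (nab p A p d a c) z) = 0" for q
    proof -
      have "dr q (\<lambda>y. \<Sum>p\<in>UNIV. nab p A p d a c y) z = dr q (\<lambda>y. 0) z"
        by (rule pd_cong[OF z]) (rule divergence_A)
      then show ?thesis using z by simp
    qed
    then show ?thesis by (subst sum.swap) (simp add: sum_distrib_left[symmetric])
  qed
  also have "(\<Sum>p\<in>UNIV. \<Sum>q\<in>UNIV. \<Sum>f\<in>UNIV. H q b z * (dr q (Gam p p f) z * A f d a c z))
      = - (\<Sum>p\<in>UNIV. \<Sum>f\<in>UNIV. A b p p f z * A f d a c z)"
    by (rule contract)
  also have "(\<Sum>p\<in>UNIV. \<Sum>q\<in>UNIV. \<Sum>f\<in>UNIV. H q b z * (dr q (Gam d p f) z * A p f a c z))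
      = - (\<Sum>p\<in>UNIV. \<Sum>f\<in>UNIV. A b d p f z * A p f a c z)"
    by (rule contract)
  also have "(\<Sum>p\<in>UNIV. \<Sum>q\<in>UNIV. \<Sum>f\<in>UNIV. H q b z * (dr q (Gam f p a) z * A p d f c z))
      = - (\<Sum>p\<in>UNIV. \<Sum>f\<in>UNIV. A b f p a z * A p d f c z)"
    by (rule contract)
  also have "(\<Sum>p\<in>UNIV. \<Sum>q\<in>UNIV. \<Sum>f\<in>UNIV. H q b z * (dr q (Gam f p c) z * A p d a f z))
      = - (\<Sum>p\<in>UNIV. \<Sum>f\<in>UNIV. A b f p c z * A p d a f z)"
    by (rule contract)
  \<comment> \<open>The commutator on the contracted index p is a Ricci contraction, the origin of
    the linear term \<open>lam * A\<close>.\<close>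
  also have "(\<Sum>p\<in>UNIV. \<Sum>f\<in>UNIV. A b p p f z * A f d a c z) = lam * A b d a c z"
  proof -
    have "(\<Sum>p\<in>UNIV. A b p p f z) = (if b = f then lam else 0)" for f
      using einstein[OF z, of b f] by (simp add: A_sym_lower[OF z, of b _ f])
    then show ?thesis
      by (subst sum.swap) (simp add: sum_distrib_right[symmetric] if_distrib[of "\<lambda>x. x * _"] cong: if_cong)
  qed
  finally show ?thesis by simp
qed

end

section \<open>Coordinate expressions of the metric, connection and curvature\<close>

lemma sum_UNIV_Plus: "(\<Sum>a\<in>UNIV. f a) = (\<Sum>i\<in>UNIV. f (Inl i)) + (\<Sum>i\<in>UNIV. f (Inr i))"
  for f :: "'n::finite + 'n \<Rightarrow> 'b::comm_monoid_add"
  unfolding UNIV_Plus_UNIV[symmetric] by (subst sum.Plus) simp_all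

lemma matrix_inv_eqI:
  fixes A B :: "complex^'k::finite^'k"
  assumes "A ** B = mat 1"
  shows "matrix_inv A = B"
proof -
  have BA: "B ** A = mat 1" using assms by (simp add: matrix_left_right_inverse)
  have "A ** matrix_inv A = mat 1 \<and> matrix_inv A ** A = mat 1"
    unfolding matrix_inv_def by (rule someI[of _ B]) (simp add: assms BA)
  then have "B ** (A ** matrix_inv A) = B" by simp
  then show ?thesis by (simp add: matrix_mul_assoc BA)
qed

lemma i_smult_i_smult: "\<i> *s (\<i> *s v) = - (v :: complex^'n)"
  by (simp add: vec_eq_iff)

locale kaehler_chart =
  fixes W :: "(complex^'n::finite) set" and g :: "'n metric" and Z :: "complex^'n \<Rightarrow> 'n \<Rightarrow> complex^'n"
  assumes metric: "kaehler_metric_on g W" and frame: "unitary_frame_on g W Z"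
begin

sublocale open_domain W
  using frame by unfold_locales (simp add: unitary_frame_on_def)

section \<open>The metric in the coordinate frame and its dual coframe\<close>

lemma
  assumes z: "z \<in> W"
  shows g_bilinear: "bilinear (g z)" and g_sym: "g z u v = g z v u"
    and g_J: "g z (\<i> *s u) (\<i> *s v) = g z u v"
  using metric z unfolding kaehler_metric_on_def hermitian_metric_on_def by blast+

lemma g_minus: "z \<in> W \<Longrightarrow> g z (- u) v = - g z u v" "z \<in> W \<Longrightarrow> g z u (- v) = - g z u v"
  using bilinear_lneg[OF g_bilinear] bilinear_rneg[OF g_bilinear] by auto

lemma g_J_left: "z \<in> W \<Longrightarrow> g z (\<i> *s u) v = - g z u (\<i> *s v)"
  using g_J[of z "\<i> *s u" v] by (simp add: i_smult_i_smult g_minus)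

text \<open>The mixed block of \<open>metric_mat\<close>: invariance under J makes its four terms
  equal in pairs, which turns the 1/4 into 1/2.\<close>

definition Gm :: "'n \<Rightarrow> 'n \<Rightarrow> complex^'n \<Rightarrow> complex" where
  "Gm i j = (\<lambda>y. (of_real (g y (axis i 1) (axis j 1)) + \<i> * of_real (g y (axis i 1) (\<i> *s axis j 1))) / 2)"

text \<open>The inverse metric, written through the unitary frame rather than as a matrix inverse:
  its smoothness is then immediate, and frame sums in the Laplacian and the norms turn into
  contractions with it.\<close>

definition Hm :: "'n \<Rightarrow> 'n \<Rightarrow> complex^'n \<Rightarrow> complex" where
  "Hm j i = (\<lambda>y. \<Sum>\<alpha>\<in>UNIV. cnj (Z y \<alpha> $ j) * Z y \<alpha> $ i)"

lemma metric_mat_blocks: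
  assumes z: "z \<in> W"
  shows "metric_mat g z $ Inl i $ Inl j = 0" "metric_mat g z $ Inr i $ Inr j = 0"
    "metric_mat g z $ Inl i $ Inr j = Gm i j z" "metric_mat g z $ Inr i $ Inl j = Gm j i z"
  using g_sym[OF z, of "axis j 1" "axis i 1"] g_sym[OF z, of "axis j 1" "\<i> *s axis i 1"]
  by (simp_all add: metric_mat_def Gm_def g_J[OF z] g_J_left[OF z] i_smult_i_smult g_minus[OF z])

lemma sm_g: "sm (\<lambda>y. of_real (g y u v))"
  unfolding sm_def
  using metric smooth_on_bounded_linear[OF open_W bounded_linear_of_real]
  unfolding kaehler_metric_on_def hermitian_metric_on_def by blast

lemma sm_Gm: "sm (Gm i j)"
proof -
  have "sm (\<lambda>y. (1/2) * (of_real (g y (axis i 1) (axis j 1)) + \<i> * of_real (g y (axis i 1) (\<i> *s axis j 1))))"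
    by (intro sm_mult sm_add sm_const sm_g)
  then show ?thesis by (simp add: Gm_def)
qed

lemma sm_Z [simp]: "sm (\<lambda>y. Z y \<alpha> $ i)"
  unfolding sm_def
  using frame by (intro smooth_on_bounded_linear[OF open_W bounded_linear_vec_nth])
    (simp add: unitary_frame_on_def)

lemma sm_Hm: "sm (Hm i j)"
  by (simp add: Hm_def)

lemma Gm_herm: "z \<in> W \<Longrightarrow> cnj (Gm i j z) = Gm j i z"
  using g_sym[of z "axis j 1" "axis i 1"] g_sym[of z "axis j 1" "\<i> *s axis i 1"] g_J_left[of z "axis i 1" "axis j 1"]
  by (simp add: Gm_def)

lemma Hm_herm: "cnj (Hm i j z) = Hm j i z"
  by (simp add: Hm_def mult.commute)

lemma metric_ext_frame:
  assumes z: "z \<in> W"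
  shows "metric_ext g z (hol_vec u) (antihol_vec v) = (\<Sum>i\<in>UNIV. \<Sum>j\<in>UNIV. Gm i j z * u $ i * cnj (v $ j))"
  by (simp add: metric_ext_def sum_UNIV_Plus hol_vec_def antihol_vec_def metric_mat_blocks[OF z])

lemma frame_unitary:
  assumes z: "z \<in> W"
  shows "(\<Sum>i\<in>UNIV. \<Sum>j\<in>UNIV. Gm i j z * Z z \<alpha> $ i * cnj (Z z \<beta> $ j)) = (if \<alpha> = \<beta> then 1 else 0)"
  using frame z by (simp add: unitary_frame_on_def unitary_basis_at_def metric_ext_frame)

text \<open>The dual coframe of the frame \<open>Z\<close>.\<close>

definition Q :: "'n \<Rightarrow> 'n \<Rightarrow> complex^'n \<Rightarrow> complex" where
  "Q b \<beta> = (\<lambda>y. \<Sum>j\<in>UNIV. Gm b j y * cnj (Z y \<beta> $ j))"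

lemma frame_coframe:
  assumes z: "z \<in> W"
  shows "(\<Sum>i\<in>UNIV. Z z \<alpha> $ i * Q i \<beta> z) = (if \<alpha> = \<beta> then 1 else 0)"
  using frame_unitary[OF z, of \<alpha> \<beta>] by (simp add: Q_def sum_distrib_left mult_ac)

text \<open>Unitarity says that frame and coframe matrices are inverse in one order; for square
  matrices the other order follows.\<close>

lemma coframe_frame:
  assumes z: "z \<in> W"
  shows "(\<Sum>\<alpha>\<in>UNIV. Z z \<alpha> $ a * Q b \<alpha> z) = (if a = b then 1 else 0)"
proof -
  let ?P = "(\<chi> \<alpha> i. Z z \<alpha> $ i) :: complex^'n^'n" and ?Q = "(\<chi> i \<beta>. Q i \<beta> z) :: complex^'n^'n"
  have "?P ** ?Q = mat 1"
    by (simp add: matrix_matrix_mult_def vec_eq_iff mat_def frame_coframe[OF z])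
  then have "?Q ** ?P = mat 1" by (simp add: matrix_left_right_inverse)
  then have "(?Q ** ?P) $ b $ a = (mat 1 :: complex^'n^'n) $ b $ a" by simp
  then show ?thesis
    by (simp add: matrix_matrix_mult_def mat_def mult.commute eq_commute)
qed

lemma Gm_Hm:
  assumes z: "z \<in> W"
  shows "(\<Sum>j\<in>UNIV. Gm i j z * Hm j k z) = (if i = k then 1 else 0)"
proof -
  have "(\<Sum>j\<in>UNIV. Gm i j z * Hm j k z) = (\<Sum>\<alpha>\<in>UNIV. Z z \<alpha> $ k * Q i \<alpha> z)"
    unfolding Hm_def Q_def sum_distrib_left by (subst sum.swap) (simp add: mult_ac)
  then show ?thesis by (simp add: coframe_frame[OF z] eq_commute)
qed

lemma Hm_Gm:
  assumes z: "z \<in> W"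
  shows "(\<Sum>j\<in>UNIV. Hm i j z * Gm j k z) = (if i = k then 1 else 0)"
proof -
  have "cnj (\<Sum>j\<in>UNIV. Gm k j z * Hm j i z) = (\<Sum>j\<in>UNIV. Hm i j z * Gm j k z)"
    by (simp add: Gm_herm[OF z] Hm_herm mult.commute)
  then show ?thesis by (simp add: Gm_Hm[OF z] split: if_splits)
qed

lemma Gm_closed:
  assumes z: "z \<in> W"
  shows "pd (Inl i) (Gm j l) z = pd (Inl j) (Gm i l) z"
proof -
  define d where "d u v w = frechet_derivative (\<lambda>y. g y v w) (at z) u" for u v w
  have dg: "(\<lambda>y. g y v w) differentiable (at z)" for v w
    using metric z unfolding kaehler_metric_on_def hermitian_metric_on_def
    by (meson smooth_on_differentiable)
  have neg: "frechet_derivative (\<lambda>y. - g y v w) (at z) = (\<lambda>u. - d u v w)" for v w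
    unfolding d_def using frechet_derivative_bounded_linear[OF bounded_linear_minus[OF bounded_linear_ident] dg] .
  have d_sym: "d u v w = d u w v" for u v w
    unfolding d_def by (rule fun_cong[OF frechet_derivative_cong_open[OF open_W z]]) (rule g_sym)
  have d_J: "d u (\<i> *s v) (\<i> *s w) = d u v w" for u v w
    unfolding d_def by (rule fun_cong[OF frechet_derivative_cong_open[OF open_W z]]) (rule g_J)
  have d_J_left: "d u (\<i> *s v) w = - d u v (\<i> *s w)" for u v w
  proof -
    have "frechet_derivative (\<lambda>y. g y (\<i> *s v) w) (at z) = frechet_derivative (\<lambda>y. - g y v (\<i> *s w)) (at z)"
      by (rule frechet_derivative_cong_open[OF open_W z]) (rule g_J_left)
    then show ?thesis by (simp add: neg) (simp add: d_def)
  qed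
  have d_minus: "d u v (- w) = - d u v w" for u v w
    using d_J_left[of u v "\<i> *s w"] by (simp add: i_smult_i_smult d_J)
  have d_minus_left: "d u (- v) w = - d u v w" for u v w
    using d_minus[of u w v] by (simp only: d_sym[of u w])
  have ed: "d u (\<i> *s v) w - d v (\<i> *s u) w + d w (\<i> *s u) v = 0" for u v w
    using metric z unfolding kaehler_metric_on_def ext_deriv2_def kaehler_form_def d_def by blast
  have G: "pd (Inl i) (Gm j l) z =
     (complex_of_real (d (axis i 1) (axis j 1) (axis l 1) + d (\<i> *s axis i 1) (axis j 1) (\<i> *s axis l 1))
     + \<i> * complex_of_real (d (axis i 1) (axis j 1) (\<i> *s axis l 1) - d (\<i> *s axis i 1) (axis j 1) (axis l 1))) / 4" for i j
  proof -
    have p: "pd a (\<lambda>y. complex_of_real (g y u v)) z = (complex_of_real (d (base_vec a) u v)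
        + frame_sgn a * \<i> * complex_of_real (d (\<i> *s base_vec a) u v)) / 2" for a u v
      by (simp add: pd_def d_def frechet_derivative_bounded_linear[OF bounded_linear_of_real dg])
    show ?thesis unfolding Gm_def using z sm_g
      by (simp add: pd_divide_const p field_simps)
  qed
  let ?i = "axis i 1 :: complex^'n" and ?j = "axis j 1 :: complex^'n" and ?l = "axis l 1 :: complex^'n"
  \<comment> \<open>Real part of the claim: the closedness equations for (e_i, e_j, J e_l) and (J
    e_i, J e_j, J e_l) share the derivative along J e_l, which subtraction removes. The imaginary
    part uses e_l as last argument in the same way.\<close>
  have "d ?i ?j ?l + d (\<i> *s ?i) ?j (\<i> *s ?l) = d ?j ?i ?l + d (\<i> *s ?j) ?i (\<i> *s ?l)"
    using ed[of ?i ?j "\<i> *s ?l"] ed[of "\<i> *s ?i" "\<i> *s ?j" "\<i> *s ?l"]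
    by (simp add: d_J d_J_left d_minus d_minus_left i_smult_i_smult)
  moreover have "d ?i ?j (\<i> *s ?l) - d (\<i> *s ?i) ?j ?l = d ?j ?i (\<i> *s ?l) - d (\<i> *s ?j) ?i ?l"
    using ed[of ?i ?j "?l"] ed[of "\<i> *s ?i" "\<i> *s ?j" "?l"]
    by (simp add: d_J d_J_left d_minus d_minus_left i_smult_i_smult)
  ultimately show ?thesis unfolding G[of i j] G[of j i] by simp
qed

sublocale kaehler_patch W Gm Hm
  by unfold_locales (simp_all add: sm_Gm sm_Hm Gm_herm Hm_herm Gm_Hm Hm_Gm Gm_closed)

section \<open>Reduction of the Levi-Civita connection and its curvature to holomorphic
  components\<close>

lemma metric_mat_inv_blocks:
  assumes z: "z \<in> W"
  shows "matrix_inv (metric_mat g z) $ Inl i $ Inl j = 0" "matrix_inv (metric_mat g z) $ Inr i $ Inr j = 0"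
    "matrix_inv (metric_mat g z) $ Inl i $ Inr j = Hm j i z" "matrix_inv (metric_mat g z) $ Inr i $ Inl j = Hm i j z"
proof -
  let ?N = "(\<chi> a b. case a of Inl i \<Rightarrow> (case b of Inl j \<Rightarrow> 0 | Inr j \<Rightarrow> Hm j i z)
     | Inr i \<Rightarrow> (case b of Inl j \<Rightarrow> Hm i j z | Inr j \<Rightarrow> 0)) :: complex^('n + 'n)^('n + 'n)"
  have "(\<Sum>j\<in>UNIV. Gm j i z * Hm k j z) = (if i = k then 1 else 0)" for i k
    using Hm_Gm[OF z, of k i] by (simp add: mult.commute eq_commute)
  then have "(metric_mat g z ** ?N) $ a $ b = mat 1 $ a $ b" for a b
    by (cases a; cases b)
      (simp_all add: matrix_matrix_mult_def sum_UNIV_Plus metric_mat_blocks[OF z] mat_def Gm_Hm[OF z])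
  then have "metric_mat g z ** ?N = mat 1" by (simp add: vec_eq_iff)
  from matrix_inv_eqI[OF this]
  show "matrix_inv (metric_mat g z) $ Inl i $ Inl j = 0" "matrix_inv (metric_mat g z) $ Inr i $ Inr j = 0"
    "matrix_inv (metric_mat g z) $ Inl i $ Inr j = Hm j i z" "matrix_inv (metric_mat g z) $ Inr i $ Inl j = Hm i j z"
    by simp_all
qed

fun chr :: "'n + 'n \<Rightarrow> 'n + 'n \<Rightarrow> 'n + 'n \<Rightarrow> complex^'n \<Rightarrow> complex" where
  "chr (Inl k) (Inl i) (Inl j) = Gam k i j"
| "chr (Inr k) (Inr i) (Inr j) = (\<lambda>y. cnj (Gam k i j y))"
| "chr _ _ _ = (\<lambda>y. 0)"

lemma sm_chr [simp]: "sm (chr c a b)"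
  by (cases "(c, a, b)" rule: chr.cases) simp_all

lemma pd_metric_mat:
  assumes z: "z \<in> W"
  shows "pd a (\<lambda>y. metric_mat g y $ Inl i $ Inl j) z = 0" "pd a (\<lambda>y. metric_mat g y $ Inr i $ Inr j) z = 0"
    "pd a (\<lambda>y. metric_mat g y $ Inl i $ Inr j) z = pd a (Gm i j) z"
    "pd a (\<lambda>y. metric_mat g y $ Inr i $ Inl j) z = pd a (Gm j i) z"
proof -
  have "pd a (\<lambda>y. metric_mat g y $ Inl i $ Inl j) z = pd a (\<lambda>y. 0) z"
    "pd a (\<lambda>y. metric_mat g y $ Inr i $ Inr j) z = pd a (\<lambda>y. 0) z"
    by (rule pd_cong[OF z], simp add: metric_mat_blocks)+
  then show "pd a (\<lambda>y. metric_mat g y $ Inl i $ Inl j) z = 0" "pd a (\<lambda>y. metric_mat g y $ Inr i $ Inr j) z = 0"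
    by simp_all
  show "pd a (\<lambda>y. metric_mat g y $ Inl i $ Inr j) z = pd a (Gm i j) z"
    "pd a (\<lambda>y. metric_mat g y $ Inr i $ Inl j) z = pd a (Gm j i) z"
    by (rule pd_cong[OF z], simp add: metric_mat_blocks)+
qed

text \<open>For indices of one type, one of the three metric derivatives concerns a vanishing block
  and closedness makes the other two equal, which cancels the factor 1/2. In all other cases the
  derivatives vanish or cancel by closedness.\<close>

lemma christoffel_eq:
  assumes z: "z \<in> W"
  shows "christoffel g c a b z = chr c a b z"
proof -
  show ?thesis
    by (cases c; cases a; cases b)
      (simp_all add: christoffel_def sum_UNIV_Plus metric_mat_inv_blocks[OF z] pd_metric_mat[OF z] Gam_def
         closed[OF z, of _ _] closed_bar[OF z] H_herm[OF z] cnj_dl_G[OF z],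
       simp_all add: sum_distrib_left mult_ac)
qed

lemma chr_conj: "chr (conj_index c) (conj_index a) (conj_index b) = (\<lambda>y. cnj (chr c a b y))"
  by (cases "(c, a, b)" rule: chr.cases) simp_all

lemma curv_op_eq:
  assumes z: "z \<in> W"
  shows "curv_op g e a b c z = pd a (chr e b c) z - pd b (chr e a c) z
     + (\<Sum>f\<in>UNIV. chr e a f z * chr f b c z - chr e b f z * chr f a c z)"
proof -
  have "pd a (christoffel g e b c) z = pd a (chr e b c) z" for a b
    by (rule pd_cong[OF z]) (rule christoffel_eq)
  then show ?thesis by (simp add: curv_op_def christoffel_eq[OF z])
qed

lemma sum_UNIV_conj_index: "(\<Sum>a\<in>UNIV. f (conj_index a)) = (\<Sum>a\<in>UNIV. f (a::'n+'n))"
  for f :: "'n + 'n \<Rightarrow> complex"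
  by (simp add: sum_UNIV_Plus add.commute)

lemma curv_op_conj:
  assumes z: "z \<in> W"
  shows "curv_op g (conj_index e) (conj_index a) (conj_index b) (conj_index c) z = cnj (curv_op g e a b c z)"
proof -
  have [simp]: "conj_index (conj_index a) = a" for a :: "'n + 'n" by (cases a) simp_all
  have "pd (conj_index a) (chr (conj_index e) (conj_index b) (conj_index c)) z = cnj (pd a (chr e b c) z)" for a b
    by (simp add: chr_conj pd_cnj[OF sm_chr z])
  moreover have "(\<Sum>f\<in>UNIV. chr (conj_index e) (conj_index a) f z * chr f (conj_index b) (conj_index c) z
       - chr (conj_index e) (conj_index b) f z * chr f (conj_index a) (conj_index c) z)
    = (\<Sum>f\<in>UNIV. cnj (chr e a f z * chr f b c z - chr e b f z * chr f a c z))"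
    by (subst sum_UNIV_conj_index[symmetric]) (simp add: chr_conj)
  ultimately show ?thesis by (simp add: curv_op_eq[OF z])
qed

lemma curv_op_hol:
  assumes z: "z \<in> W"
  shows "curv_op g (Inr e) a b (Inl k) z = 0"
    "curv_op g (Inl e) (Inl i) (Inl j) (Inl k) z = 0" "curv_op g (Inl e) (Inr i) (Inr j) (Inl k) z = 0"
    "curv_op g (Inl e) (Inl i) (Inr j) (Inl k) z = - dr j (Gam e i k) z"
    "curv_op g (Inl e) (Inr j) (Inl i) (Inl k) z = dr j (Gam e i k) z"
proof -
  show "curv_op g (Inr e) a b (Inl k) z = 0"
    by (cases a; cases b) (simp_all add: curv_op_eq[OF z] sum_UNIV_Plus)
  show "curv_op g (Inl e) (Inl i) (Inl j) (Inl k) z = 0"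
    using Gam_flat[OF z, of i e j k]
    by (simp add: curv_op_eq[OF z] sum_UNIV_Plus sum_subtractf algebra_simps)
qed (simp_all add: curv_op_eq[OF z] sum_UNIV_Plus)

fun Rc :: "'n + 'n \<Rightarrow> 'n + 'n \<Rightarrow> 'n + 'n \<Rightarrow> 'n + 'n \<Rightarrow> complex^'n \<Rightarrow> complex" where
  "Rc (Inl i) (Inr j) (Inl k) (Inr l) = R i j k l"
| "Rc (Inr j) (Inl i) (Inl k) (Inr l) = (\<lambda>y. - R i j k l y)"
| "Rc (Inl i) (Inr j) (Inr l) (Inl k) = (\<lambda>y. - R i j k l y)"
| "Rc (Inr j) (Inl i) (Inr l) (Inl k) = R i j k l"
| "Rc _ _ _ _ = (\<lambda>y. 0)"

lemma sm_Rc [simp]: "sm (Rc a b c d)"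
  by (cases "(a, b, c, d)" rule: Rc.cases) simp_all

lemma Rc_conj: "z \<in> W \<Longrightarrow> Rc (conj_index a) (conj_index b) (conj_index c) (conj_index d) z = cnj (Rc a b c d z)"
  by (cases "(a, b, c, d)" rule: Rc.cases) (simp_all add: R_herm)

lemma curv_conj:
  assumes z: "z \<in> W"
  shows "curv g (conj_index a) (conj_index b) (conj_index c) (conj_index d) z = cnj (curv g a b c d z)"
proof -
  have "metric_mat g z $ conj_index e $ conj_index d = cnj (metric_mat g z $ e $ d)" for e
    by (cases e; cases d) (simp_all add: metric_mat_blocks[OF z] G_herm[OF z])
  then show ?thesis
    unfolding curv_def by (subst sum_UNIV_conj_index[symmetric]) (simp add: curv_op_conj[OF z])
qed

text \<open>Computed directly when the third index is unbarred; since the curvature is a real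
  tensor, the other case is the complex conjugate of this one.\<close>

lemma curv_eq:
  assumes z: "z \<in> W"
  shows "curv g a b c d z = Rc a b c d z"
proof -
  have hol: "curv g a b (Inl k) d z = Rc a b (Inl k) d z" for a b k d
    by (cases a; cases b; cases d)
      (simp_all add: curv_def sum_UNIV_Plus curv_op_hol[OF z] metric_mat_blocks[OF z] R_def sum_negf)
  show ?thesis
  proof (cases c)
    case (Inl k)
    then show ?thesis by (simp add: hol)
  next
    case (Inr l)
    have [simp]: "conj_index (conj_index a) = a" for a :: "'n + 'n" by (cases a) simp_all
    show ?thesis
      using curv_conj[OF z, of "conj_index a" "conj_index b" "Inl l" "conj_index d"]
        Rc_conj[OF z, of "conj_index a" "conj_index b" "Inl l" "conj_index d"]
      by (simp add: hol Inr)
  qed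
qed

lemma curv_deriv_eq:
  assumes z: "z \<in> W"
  shows "curv_deriv g m a b c d z = pd m (Rc a b c d) z
     - (\<Sum>f\<in>UNIV. chr f m a z * Rc f b c d z + chr f m b z * Rc a f c d z
                 + chr f m c z * Rc a b f d z + chr f m d z * Rc a b c f z)"
proof -
  have "pd m (curv g a b c d) z = pd m (Rc a b c d) z"
    by (rule pd_cong[OF z]) (rule curv_eq)
  then show ?thesis by (simp add: curv_deriv_def curv_eq[OF z] christoffel_eq[OF z])
qed

text \<open>Lowering indices commutes with covariant differentiation: by \<open>Gam_G\<close>, the
  derivatives of the two metric factors are the connection terms of the upper indices b and
  d.\<close>

lemma curv_deriv_hol:
  assumes z: "z \<in> W"
  shows "curv_deriv g (Inl m) (Inl a) (Inr j) (Inl c) (Inr l) z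
    = (\<Sum>b\<in>UNIV. \<Sum>d\<in>UNIV. nab m A b d a c z * Gm b j z * Gm d l z)"
proof -
  have "dl m (R a j c l) z = dl m (\<lambda>y. \<Sum>b\<in>UNIV. \<Sum>d\<in>UNIV. A b d a c y * Gm b j y * Gm d l y) z"
    by (rule pd_cong[OF z]) (rule R_A)
  also have "\<dots> = (\<Sum>b\<in>UNIV. \<Sum>d\<in>UNIV. dl m (A b d a c) z * Gm b j z * Gm d l z)
     + (\<Sum>b\<in>UNIV. \<Sum>d\<in>UNIV. A b d a c z * dl m (Gm b j) z * Gm d l z)
     + (\<Sum>b\<in>UNIV. \<Sum>d\<in>UNIV. A b d a c z * Gm b j z * dl m (Gm d l) z)"
    using z by (simp add: sum.distrib distrib_right)
  finally have 1: "dl m (R a j c l) z = (\<Sum>b\<in>UNIV. \<Sum>d\<in>UNIV. dl m (A b d a c) z * Gm b j z * Gm d l z)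
     + (\<Sum>b\<in>UNIV. \<Sum>d\<in>UNIV. A b d a c z * dl m (Gm b j) z * Gm d l z)
     + (\<Sum>b\<in>UNIV. \<Sum>d\<in>UNIV. A b d a c z * Gm b j z * dl m (Gm d l) z)" .
  have 2: "(\<Sum>b\<in>UNIV. \<Sum>d\<in>UNIV. A b d a c z * dl m (Gm b j) z * Gm d l z)
      = (\<Sum>b\<in>UNIV. \<Sum>d\<in>UNIV. \<Sum>f\<in>UNIV. Gam b m f z * A f d a c z * Gm b j z * Gm d l z)"
    unfolding Gam_G[OF z, symmetric] sum_distrib_left sum_distrib_right sum.cartesian_product
    by (rule sum.reindex_bij_witness[of _ "\<lambda>(b,d,f). (f,d,b)" "\<lambda>(b,d,f). (f,d,b)"]) (auto simp: mult_ac)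
  have 3: "(\<Sum>b\<in>UNIV. \<Sum>d\<in>UNIV. A b d a c z * Gm b j z * dl m (Gm d l) z)
      = (\<Sum>b\<in>UNIV. \<Sum>d\<in>UNIV. \<Sum>f\<in>UNIV. Gam d m f z * A b f a c z * Gm b j z * Gm d l z)"
    unfolding Gam_G[OF z, symmetric] sum_distrib_left sum_distrib_right sum.cartesian_product
    by (rule sum.reindex_bij_witness[of _ "\<lambda>(b,d,f). (b,f,d)" "\<lambda>(b,d,f). (b,f,d)"]) (auto simp: mult_ac)
  have 4: "(\<Sum>f\<in>UNIV. k f * R (u f) j (v f) l z)
     = (\<Sum>b\<in>UNIV. \<Sum>d\<in>UNIV. \<Sum>f\<in>UNIV. k f * A b d (u f) (v f) z * Gm b j z * Gm d l z)" for k u v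
    unfolding R_A[OF z] sum_distrib_left sum_distrib_right sum.cartesian_product
    by (rule sum.reindex_bij_witness[of _ "\<lambda>(b,d,f). (f,b,d)" "\<lambda>(f,b,d). (b,d,f)"]) (auto simp: mult_ac)
  show ?thesis
    using z
    by (simp add: curv_deriv_eq[OF z] sum_UNIV_Plus sum.distrib 1 2 3 4 nab_def distrib_right left_diff_distrib
        sum_subtractf sum_distrib_right)
qed

lemma curv_deriv_conj:
  assumes z: "z \<in> W"
  shows "curv_deriv g (conj_index m) (conj_index a) (conj_index b) (conj_index c) (conj_index d) z
     = cnj (curv_deriv g m a b c d z)"
proof -
  have "pd (conj_index m) (Rc (conj_index a) (conj_index b) (conj_index c) (conj_index d)) z
      = pd (conj_index m) (\<lambda>y. cnj (Rc a b c d y)) z"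
    by (rule pd_cong[OF z]) (rule Rc_conj)
  also have "\<dots> = cnj (pd m (Rc a b c d) z)"
    using pd_cnj[OF sm_Rc z] by (cases m) simp_all
  finally show ?thesis
    unfolding curv_deriv_eq[OF z] by (subst sum_UNIV_conj_index[symmetric]) (simp add: chr_conj Rc_conj[OF z])
qed

text \<open>Here the derivatives of the metric factors are the connection terms of the barred
  indices j and l, and they cancel against those of \<open>curv_deriv\<close>; only the plain
  derivative of \<open>A\<close> survives.\<close>

lemma curv_deriv_antihol:
  assumes z: "z \<in> W"
  shows "curv_deriv g (Inr m) (Inl a) (Inr j) (Inl c) (Inr l) z
    = (\<Sum>b\<in>UNIV. \<Sum>d\<in>UNIV. dr m (A b d a c) z * Gm b j z * Gm d l z)"
proof -
  have "dr m (R a j c l) z = dr m (\<lambda>y. \<Sum>b\<in>UNIV. \<Sum>d\<in>UNIV. A b d a c y * Gm b j y * Gm d l y) z"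
    by (rule pd_cong[OF z]) (rule R_A)
  also have "\<dots> = (\<Sum>b\<in>UNIV. \<Sum>d\<in>UNIV. dr m (A b d a c) z * Gm b j z * Gm d l z)
     + (\<Sum>b\<in>UNIV. \<Sum>d\<in>UNIV. A b d a c z * dr m (Gm b j) z * Gm d l z)
     + (\<Sum>b\<in>UNIV. \<Sum>d\<in>UNIV. A b d a c z * Gm b j z * dr m (Gm d l) z)"
    using z by (simp add: sum.distrib distrib_right)
  finally have 1: "dr m (R a j c l) z = (\<Sum>b\<in>UNIV. \<Sum>d\<in>UNIV. dr m (A b d a c) z * Gm b j z * Gm d l z)
     + (\<Sum>b\<in>UNIV. \<Sum>d\<in>UNIV. A b d a c z * dr m (Gm b j) z * Gm d l z)
     + (\<Sum>b\<in>UNIV. \<Sum>d\<in>UNIV. A b d a c z * Gm b j z * dr m (Gm d l) z)" .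
  have G': "(\<Sum>e\<in>UNIV. cnj (Gam e m k z) * Gm l e z) = dr m (Gm l k) z" for k l
    using arg_cong[OF Gam_G[OF z, of m k l], of cnj] by (simp add: G_herm[OF z] cnj_dl_G[OF z])
  have 2: "(\<Sum>b\<in>UNIV. \<Sum>d\<in>UNIV. A b d a c z * dr m (Gm b j) z * Gm d l z)
      = (\<Sum>f\<in>UNIV. cnj (Gam f m j z) * R a f c l z)"
    unfolding G'[symmetric] R_A[OF z] sum_distrib_left sum_distrib_right sum.cartesian_product
    by (rule sum.reindex_bij_witness[of _ "\<lambda>(f,b,d). (b,d,f)" "\<lambda>(b,d,f). (f,b,d)"]) (auto simp: mult_ac)
  have 3: "(\<Sum>b\<in>UNIV. \<Sum>d\<in>UNIV. A b d a c z * Gm b j z * dr m (Gm d l) z)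
      = (\<Sum>f\<in>UNIV. cnj (Gam f m l z) * R a j c f z)"
    unfolding G'[symmetric] R_A[OF z] sum_distrib_left sum_distrib_right sum.cartesian_product
    by (rule sum.reindex_bij_witness[of _ "\<lambda>(f,b,d). (b,d,f)" "\<lambda>(b,d,f). (f,b,d)"]) (auto simp: mult_ac)
  show ?thesis
    using z by (simp add: curv_deriv_eq[OF z] sum_UNIV_Plus sum.distrib 1 2 3)
qed

end

section \<open>Unitary frames and the Bochner formula\<close>

lemma sum_UNIV_prod: "(\<Sum>p\<in>UNIV. f p) = (\<Sum>a\<in>UNIV. \<Sum>b\<in>UNIV. f (a, b))"
  for f :: "'a::finite \<times> 'b::finite \<Rightarrow> complex"
  by (simp add: sum.cartesian_product UNIV_Times_UNIV[symmetric] del: UNIV_Times_UNIV)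

section \<open>Invariance of contractions under a change of frame\<close>

definition contr :: "('x::finite \<Rightarrow> 'i::finite \<Rightarrow> complex) \<Rightarrow> ('x \<Rightarrow> 'i \<Rightarrow> complex) \<Rightarrow> bool" where
  "contr L K \<longleftrightarrow> (\<forall>i j. (\<Sum>x\<in>UNIV. L x i * K x j) = (if i = j then 1 else 0))"

text \<open>The matrix \<open>M\<close> in new frames. The index types of rows and columns are
  independent, so that a row or column may be a pair of tensor indices.\<close>

definition bil :: "('x \<Rightarrow> 'i::finite \<Rightarrow> complex) \<Rightarrow> ('y \<Rightarrow> 'j::finite \<Rightarrow> complex) \<Rightarrow> ('i \<Rightarrow> 'j \<Rightarrow> complex) \<Rightarrow>
    'x \<Rightarrow> 'y \<Rightarrow> complex" where
  "bil L K M x y = (\<Sum>i\<in>UNIV. \<Sum>j\<in>UNIV. L x i * K y j * M i j)"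

lemma contr_commute: "contr L K \<Longrightarrow> contr K L"
  unfolding contr_def
proof (intro allI)
  fix i j
  assume "\<forall>i j. (\<Sum>x\<in>UNIV. L x i * K x j) = (if i = j then 1 else 0)"
  then have "(\<Sum>x\<in>UNIV. L x j * K x i) = (if j = i then 1 else 0)" by blast
  then show "(\<Sum>x\<in>UNIV. K x i * L x j) = (if i = j then 1 else 0)"
    by (simp add: mult.commute[of "L _ _"] split: if_splits)
qed

lemma contr_prod:
  assumes "contr L K" "contr L' K'"
  shows "contr (\<lambda>(x, y) (i, j). L x i * L' y j) (\<lambda>(x, y) (i, j). K x i * K' y j)"
proof -
  have "(\<Sum>x\<in>UNIV. \<Sum>y\<in>UNIV. (L x i * L' y j) * (K x k * K' y l))
     = (\<Sum>x\<in>UNIV. L x i * K x k) * (\<Sum>y\<in>UNIV. L' y j * K' y l)" for i j k l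
    unfolding sum_product by (simp add: mult_ac)
  then show ?thesis using assms by (auto simp: contr_def sum_UNIV_prod)
qed

lemma contr_sum:
  assumes "contr L K"
  shows "(\<Sum>x\<in>UNIV. (\<Sum>i\<in>UNIV. L x i * f i) * (\<Sum>j\<in>UNIV. K x j * h j)) = (\<Sum>i\<in>UNIV. f i * h i)"
proof -
  have "(\<Sum>x\<in>UNIV. (\<Sum>i\<in>UNIV. L x i * f i) * (\<Sum>j\<in>UNIV. K x j * h j))
      = (\<Sum>i\<in>UNIV. f i * (\<Sum>j\<in>UNIV. (\<Sum>x\<in>UNIV. L x i * K x j) * h j))"
    unfolding sum_product sum_distrib_left sum_distrib_right sum.cartesian_product
    by (rule sum.reindex_bij_witness[of _ "\<lambda>(i,j,x). (x,j,i)" "\<lambda>(x,j,i). (i,j,x)"]) (auto simp: mult_ac)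
  also have "\<dots> = (\<Sum>i\<in>UNIV. f i * h i)"
    using assms by (simp add: contr_def sum_delta_left)
  finally show ?thesis .
qed

lemma bil_mult:
  assumes "contr K K'"
  shows "(\<Sum>y\<in>UNIV. bil L K M x y * bil K' L' N y w) = bil L L' (\<lambda>i k. \<Sum>j\<in>UNIV. M i j * N j k) x w"
proof -
  have 1: "bil L K M x y = (\<Sum>j\<in>UNIV. K y j * (\<Sum>i\<in>UNIV. L x i * M i j))" for y
    unfolding bil_def by (subst sum.swap) (simp add: sum_distrib_left mult_ac)
  have 2: "bil K' L' N y w = (\<Sum>j\<in>UNIV. K' y j * (\<Sum>k\<in>UNIV. L' w k * N j k))" for y
    unfolding bil_def by (simp add: sum_distrib_left mult_ac)
  show ?thesis
    unfolding 1 2 contr_sum[OF assms]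
    unfolding bil_def sum_distrib_left sum_distrib_right sum.cartesian_product
    by (rule sum.reindex_bij_witness[of _ "\<lambda>(i,k,j). (j,k,i)" "\<lambda>(j,k,i). (i,k,j)"]) (auto simp: mult_ac)
qed

lemma bil_trace:
  assumes "contr L K"
  shows "(\<Sum>x\<in>UNIV. bil L K M x x) = (\<Sum>i\<in>UNIV. M i i)"
proof -
  have "(\<Sum>x\<in>UNIV. bil L K M x x) = (\<Sum>i\<in>UNIV. \<Sum>j\<in>UNIV. (\<Sum>x\<in>UNIV. L x i * K x j) * M i j)"
    unfolding bil_def sum_distrib_right sum.cartesian_product
    by (rule sum.reindex_bij_witness[of _ "\<lambda>(i,j,x). (x,i,j)" "\<lambda>(x,i,j). (i,j,x)"]) auto
  also have "\<dots> = (\<Sum>i\<in>UNIV. M i i)"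
    using assms by (simp add: contr_def sum_delta_left)
  finally show ?thesis .
qed

definition comp4 :: "('n \<Rightarrow> 'n \<Rightarrow> 'n \<Rightarrow> 'n \<Rightarrow> complex) \<Rightarrow> ('n \<Rightarrow> 'n \<Rightarrow> 'n \<Rightarrow> 'n \<Rightarrow> complex) \<Rightarrow>
    'n::finite \<Rightarrow> 'n \<Rightarrow> 'n \<Rightarrow> 'n \<Rightarrow> complex" where
  "comp4 X Y b d a c = (\<Sum>p\<in>UNIV. \<Sum>f\<in>UNIV. X b d p f * Y p f a c)"

text \<open>The product in the last two terms of X. Each factor gives up one upper and one lower
  index, so this is not a composition of endomorphisms of the tensor square.\<close>

definition twist4 :: "('n \<Rightarrow> 'n \<Rightarrow> 'n \<Rightarrow> 'n \<Rightarrow> complex) \<Rightarrow> ('n \<Rightarrow> 'n \<Rightarrow> 'n \<Rightarrow> 'n \<Rightarrow> complex) \<Rightarrow>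
    'n::finite \<Rightarrow> 'n \<Rightarrow> 'n \<Rightarrow> 'n \<Rightarrow> complex" where
  "twist4 X Y b d a c = (\<Sum>p\<in>UNIV. \<Sum>f\<in>UNIV. X b f p a * Y p d f c)"

definition frame4 :: "('n::finite \<Rightarrow> 'n \<Rightarrow> complex) \<Rightarrow> ('n \<Rightarrow> 'n \<Rightarrow> complex) \<Rightarrow>
   ('n \<Rightarrow> 'n \<Rightarrow> 'n \<Rightarrow> 'n \<Rightarrow> complex) \<Rightarrow> 'n \<Rightarrow> 'n \<Rightarrow> 'n \<Rightarrow> 'n \<Rightarrow> complex" where
  "frame4 q p X \<beta> \<delta> \<alpha> \<gamma> = (\<Sum>b\<in>UNIV. \<Sum>d\<in>UNIV. \<Sum>a\<in>UNIV. \<Sum>c\<in>UNIV.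
     q \<beta> b * q \<delta> d * (p \<alpha> a * p \<gamma> c) * X b d a c)"

lemma frame4_bil: "frame4 q p X \<beta> \<delta> \<alpha> \<gamma> =
    bil (\<lambda>(x, y) (i, j). q x i * q y j) (\<lambda>(x, y) (i, j). p x i * p y j)
      (\<lambda>(b, d) (a, c). X b d a c) (\<beta>, \<delta>) (\<alpha>, \<gamma>)"
  by (simp add: frame4_def bil_def sum_UNIV_prod)

text \<open>Regrouping the indices turns the contraction in \<open>twist4\<close> into a matrix product.\<close>

lemma frame4_bil_left: "frame4 q p X \<beta> \<phi> \<pi> \<alpha> =
    bil (\<lambda>(x, y) (i, j). q x i * p y j) (\<lambda>(x, y) (i, j). p x i * q y j)
      (\<lambda>(b, a) (k, f). X b f k a) (\<beta>, \<alpha>) (\<pi>, \<phi>)"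
  unfolding bil_def sum_UNIV_prod split_conv
  unfolding frame4_def sum_UNIV_prod split_conv sum.cartesian_product
  by (rule sum.reindex_bij_witness[of _ "\<lambda>(b,a,k,f). (b,f,k,a)" "\<lambda>(b,f,k,a). (b,a,k,f)"]) (auto simp: mult_ac)

lemma frame4_bil_right: "frame4 q p X \<pi> \<delta> \<phi> \<gamma> =
    bil (\<lambda>(x, y) (i, j). q x i * p y j) (\<lambda>(x, y) (i, j). q x i * p y j)
      (\<lambda>(k, f) (d, c). X k d f c) (\<pi>, \<phi>) (\<delta>, \<gamma>)"
  unfolding bil_def sum_UNIV_prod split_conv
  unfolding frame4_def sum_UNIV_prod split_conv sum.cartesian_product
  by (rule sum.reindex_bij_witness[of _ "\<lambda>(k,f,d,c). (k,d,f,c)" "\<lambda>(k,d,f,c). (k,f,d,c)"]) (auto simp: mult_ac)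

lemma frame4_comp4:
  assumes "contr p q"
  shows "comp4 (frame4 q p X) (frame4 q p Y) = frame4 q p (comp4 X Y)"
proof (intro ext)
  fix \<beta> \<delta> \<alpha> \<gamma>
  have "comp4 (frame4 q p X) (frame4 q p Y) \<beta> \<delta> \<alpha> \<gamma> = (\<Sum>y\<in>UNIV.
    bil (\<lambda>(x, y) (i, j). q x i * q y j) (\<lambda>(x, y) (i, j). p x i * p y j)
      (\<lambda>(b, d) (a, c). X b d a c) (\<beta>, \<delta>) y *
    bil (\<lambda>(x, y) (i, j). q x i * q y j) (\<lambda>(x, y) (i, j). p x i * p y j)
      (\<lambda>(b, d) (a, c). Y b d a c) y (\<alpha>, \<gamma>))"
    by (simp add: comp4_def frame4_bil sum_UNIV_prod)
  also have "\<dots> = frame4 q p (comp4 X Y) \<beta> \<delta> \<alpha> \<gamma>"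
    unfolding bil_mult[OF contr_prod[OF assms assms]] frame4_bil
    by (rule arg_cong[where f="\<lambda>M. bil _ _ M _ _"]) (auto simp: fun_eq_iff comp4_def sum_UNIV_prod)
  finally show "comp4 (frame4 q p X) (frame4 q p Y) \<beta> \<delta> \<alpha> \<gamma> = frame4 q p (comp4 X Y) \<beta> \<delta> \<alpha> \<gamma>" .
qed

lemma frame4_twist4:
  assumes "contr p q"
  shows "twist4 (frame4 q p X) (frame4 q p Y) = frame4 q p (twist4 X Y)"
proof (intro ext)
  fix \<beta> \<delta> \<alpha> \<gamma>
  have "twist4 (frame4 q p X) (frame4 q p Y) \<beta> \<delta> \<alpha> \<gamma> = (\<Sum>y\<in>UNIV.
    bil (\<lambda>(x, y) (i, j). q x i * p y j) (\<lambda>(x, y) (i, j). p x i * q y j)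
      (\<lambda>(b, a) (k, f). X b f k a) (\<beta>, \<alpha>) y *
    bil (\<lambda>(x, y) (i, j). q x i * p y j) (\<lambda>(x, y) (i, j). q x i * p y j)
      (\<lambda>(k, f) (d, c). Y k d f c) y (\<delta>, \<gamma>))"
    unfolding sum_UNIV_prod twist4_def frame4_bil_left[symmetric] frame4_bil_right[symmetric] ..
  also have "\<dots> = bil (\<lambda>(x, y) (i, j). q x i * p y j) (\<lambda>(x, y) (i, j). q x i * p y j)
      (\<lambda>(b, a) (d, c). twist4 X Y b d a c) (\<beta>, \<alpha>) (\<delta>, \<gamma>)"
    unfolding bil_mult[OF contr_prod[OF assms contr_commute[OF assms]]]
    by (rule arg_cong[where f="\<lambda>M. bil _ _ M _ _"]) (auto simp: fun_eq_iff twist4_def sum_UNIV_prod)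
  also have "\<dots> = frame4 q p (twist4 X Y) \<beta> \<delta> \<alpha> \<gamma>"
    by (rule frame4_bil_right[symmetric])
  finally show "twist4 (frame4 q p X) (frame4 q p Y) \<beta> \<delta> \<alpha> \<gamma> = frame4 q p (twist4 X Y) \<beta> \<delta> \<alpha> \<gamma>" .
qed

lemma tr2_frame4:
  assumes "contr p q"
  shows "tr2 (frame4 q p X) (frame4 q p Y) = tr2 X Y"
proof -
  \<comment> \<open>As the trace of a composition, \<open>tr2\<close> inherits its invariance from
    that of \<open>comp4\<close> and of the plain trace.\<close>
  have *: "tr2 X Y = (\<Sum>b\<in>UNIV. \<Sum>d\<in>UNIV. comp4 X Y b d b d)" for X Y
    by (simp add: tr2_def comp4_def)
  have "(\<Sum>x\<in>UNIV. \<Sum>y\<in>UNIV. frame4 q p V x y x y) = (\<Sum>b\<in>UNIV. \<Sum>d\<in>UNIV. V b d b d)" for V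
    using bil_trace[OF contr_prod[OF contr_commute[OF assms] contr_commute[OF assms]], of "\<lambda>(b, d) (a, c). V b d a c"]
    unfolding sum_UNIV_prod frame4_bil[symmetric] split_conv .
  then show ?thesis
    unfolding * frame4_comp4[OF assms] .
qed

section \<open>Curvature, its derivatives and their norms in the unitary frame\<close>

context kaehler_chart
begin

definition frm :: "complex^'n \<Rightarrow> ('n \<Rightarrow> 'n \<Rightarrow> 'n \<Rightarrow> 'n \<Rightarrow> complex) \<Rightarrow> 'n \<Rightarrow> 'n \<Rightarrow> 'n \<Rightarrow> 'n \<Rightarrow> complex" where
  "frm z = frame4 (\<lambda>\<beta> b. Q b \<beta> z) (\<lambda>\<alpha> a. Z z \<alpha> $ a)"

lemma contr_frame: "z \<in> W \<Longrightarrow> contr (\<lambda>\<alpha> a. Z z \<alpha> $ a) (\<lambda>\<beta> b. Q b \<beta> z)"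
  by (simp add: contr_def coframe_frame)

lemma tr2_frm: "z \<in> W \<Longrightarrow> tr2 (frm z X) (frm z Y) = tr2 X Y"
  unfolding frm_def by (rule tr2_frame4[OF contr_frame])

text \<open>\<open>Q\<close> is the metric dual of the conjugate frame: a lowered index evaluated on
  a conjugate frame vector is the raised index evaluated on the coframe.\<close>

lemma frm_eq:
  "(\<Sum>i\<in>UNIV. \<Sum>j\<in>UNIV. \<Sum>k\<in>UNIV. \<Sum>l\<in>UNIV.
      (\<Sum>b\<in>UNIV. \<Sum>d\<in>UNIV. X b d i k * Gm b j z * Gm d l z)
        * Z z \<alpha> $ i * cnj (Z z \<beta> $ j) * Z z \<gamma> $ k * cnj (Z z \<delta> $ l)) = frm z X \<beta> \<delta> \<alpha> \<gamma>"
proof -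
  have "frm z X \<beta> \<delta> \<alpha> \<gamma> = (\<Sum>b\<in>UNIV. \<Sum>d\<in>UNIV. \<Sum>a\<in>UNIV. \<Sum>c\<in>UNIV. \<Sum>j\<in>UNIV. \<Sum>l\<in>UNIV.
     Gm b j z * cnj (Z z \<beta> $ j) * (Gm d l z * cnj (Z z \<delta> $ l)) * (Z z \<alpha> $ a * Z z \<gamma> $ c) * X b d a c)"
    unfolding frm_def frame4_def Q_def sum_product unfolding sum_distrib_right ..
  also have "\<dots> = (\<Sum>i\<in>UNIV. \<Sum>j\<in>UNIV. \<Sum>k\<in>UNIV. \<Sum>l\<in>UNIV. \<Sum>b\<in>UNIV. \<Sum>d\<in>UNIV.
       X b d i k * Gm b j z * Gm d l z * Z z \<alpha> $ i * cnj (Z z \<beta> $ j) * Z z \<gamma> $ k * cnj (Z z \<delta> $ l))"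
    unfolding sum.cartesian_product
    by (rule sum.reindex_bij_witness[of _ "\<lambda>(i,j,k,l,b,d). (b,d,i,k,j,l)" "\<lambda>(b,d,i,k,j,l). (i,j,k,l,b,d)"])
      (auto simp: mult_ac)
  finally show ?thesis unfolding sum_distrib_right by (rule sym)
qed

lemma Riem_frame:
  assumes z: "z \<in> W"
  shows "Riem g z (hol_vec (Z z \<alpha>)) (antihol_vec (Z z \<beta>)) (hol_vec (Z z \<gamma>)) (antihol_vec (Z z \<delta>))
     = frm z (\<lambda>b d a c. A b d a c z) \<beta> \<delta> \<alpha> \<gamma>"
  unfolding frm_eq[symmetric] R_A[OF z, symmetric]
  by (simp add: Riem_def curv_eq[OF z] sum_UNIV_Plus hol_vec_def antihol_vec_def)

text \<open>The direction of differentiation is contracted beforehand, so that the result has four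
  slots again and \<open>frm\<close> applies to it.\<close>

definition slice :: "('n \<Rightarrow> 'n \<Rightarrow> 'n \<Rightarrow> 'n \<Rightarrow> 'n \<Rightarrow> complex) \<Rightarrow> ('n \<Rightarrow> complex) \<Rightarrow> 'n \<Rightarrow> 'n \<Rightarrow> 'n \<Rightarrow> 'n \<Rightarrow> complex" where
  "slice X v b d a c = (\<Sum>m\<in>UNIV. v m * X m b d a c)"

lemma nabla_Riem_frame:
  assumes z: "z \<in> W"
  shows "nabla_Riem g z (hol_vec v) (hol_vec (Z z \<alpha>)) (antihol_vec (Z z \<beta>)) (hol_vec (Z z \<gamma>)) (antihol_vec (Z z \<delta>))
     = frm z (slice (\<lambda>m b d a c. nab m A b d a c z) (\<lambda>m. v $ m)) \<beta> \<delta> \<alpha> \<gamma>" (is ?hol)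
    and "nabla_Riem g z (antihol_vec v) (hol_vec (Z z \<alpha>)) (antihol_vec (Z z \<beta>)) (hol_vec (Z z \<gamma>)) (antihol_vec (Z z \<delta>))
     = frm z (slice (\<lambda>m b d a c. dr m (A b d a c) z) (\<lambda>m. cnj (v $ m))) \<beta> \<delta> \<alpha> \<gamma>" (is ?antihol)
proof -
  have *: "(\<Sum>b\<in>UNIV. \<Sum>d\<in>UNIV. slice X w b d i k * Gm b j z * Gm d l z)
      = (\<Sum>m\<in>UNIV. w m * (\<Sum>b\<in>UNIV. \<Sum>d\<in>UNIV. X m b d i k * Gm b j z * Gm d l z))" for X w i j k l
    unfolding slice_def sum_distrib_right sum_distrib_left sum.cartesian_product
    by (rule sum.reindex_bij_witness[of _ "\<lambda>(m,b,d). (b,d,m)" "\<lambda>(b,d,m). (m,b,d)"]) (auto simp: mult_ac)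
  have **: "(\<Sum>i\<in>UNIV. \<Sum>j\<in>UNIV. \<Sum>k\<in>UNIV. \<Sum>l\<in>UNIV. (\<Sum>m\<in>UNIV. w m * Y m i j k l) * p i * q j * r k * s l)
    = (\<Sum>m\<in>UNIV. \<Sum>i\<in>UNIV. \<Sum>j\<in>UNIV. \<Sum>k\<in>UNIV. \<Sum>l\<in>UNIV. Y m i j k l * w m * p i * q j * r k * s l)"
    for w p q r s and Y :: "'n \<Rightarrow> 'n \<Rightarrow> 'n \<Rightarrow> 'n \<Rightarrow> 'n \<Rightarrow> complex"
    unfolding sum_distrib_right sum.cartesian_product
    by (rule sum.reindex_bij_witness[of _ "\<lambda>(m,i,j,k,l). (i,j,k,l,m)" "\<lambda>(i,j,k,l,m). (m,i,j,k,l)"]) (auto simp: mult_ac)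
  show ?hol
    unfolding frm_eq[symmetric] * curv_deriv_hol[OF z, symmetric] **
    by (simp add: nabla_Riem_def sum_UNIV_Plus hol_vec_def antihol_vec_def)
  show ?antihol
    unfolding frm_eq[symmetric] * curv_deriv_antihol[OF z, symmetric] **
    by (simp add: nabla_Riem_def sum_UNIV_Plus hol_vec_def antihol_vec_def)
qed

lemma Rc_swap: "Rc b a d c = Rc a b c d"
  by (cases "(a, b, c, d)" rule: Rc.cases) (auto simp: fun_eq_iff)

lemma curv_deriv_swap:
  assumes z: "z \<in> W"
  shows "curv_deriv g m b a d c z = curv_deriv g m a b c d z"
  unfolding curv_deriv_eq[OF z] Rc_swap[of _ a _ c] Rc_swap[of _ _ d _]
  by (simp add: add_ac Rc_swap)

lemma cnj_nabla_Riem: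
  assumes z: "z \<in> W"
  shows "cnj (nabla_Riem g z (hol_vec v) (hol_vec x) (antihol_vec y) (hol_vec u) (antihol_vec w))
    = nabla_Riem g z (antihol_vec v) (hol_vec y) (antihol_vec x) (hol_vec w) (antihol_vec u)"
proof -
  \<comment> \<open>Conjugation puts the bars on the first and third arguments; exchanging the
    arguments within both pairs restores the pattern at no cost in sign.\<close>
  have *: "cnj (curv_deriv g (Inl m) (Inl i) (Inr j) (Inl k) (Inr l) z)
      = curv_deriv g (Inr m) (Inl j) (Inr i) (Inl l) (Inr k) z" for m i j k l
    using curv_deriv_conj[OF z, of "Inl m" "Inl i" "Inr j" "Inl k" "Inr l"]
    by (simp add: curv_deriv_swap[OF z, of _ "Inr i" "Inl j"])
  have "cnj (nabla_Riem g z (hol_vec v) (hol_vec x) (antihol_vec y) (hol_vec u) (antihol_vec w))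
    = (\<Sum>m\<in>UNIV. \<Sum>i\<in>UNIV. \<Sum>j\<in>UNIV. \<Sum>k\<in>UNIV. \<Sum>l\<in>UNIV. curv_deriv g (Inr m) (Inl j) (Inr i) (Inl l) (Inr k) z
       * cnj (v $ m) * cnj (x $ i) * y $ j * cnj (u $ k) * w $ l)"
    by (simp add: nabla_Riem_def sum_UNIV_Plus hol_vec_def antihol_vec_def *)
  also have "\<dots> = (\<Sum>m\<in>UNIV. \<Sum>i\<in>UNIV. \<Sum>j\<in>UNIV. \<Sum>k\<in>UNIV. \<Sum>l\<in>UNIV. curv_deriv g (Inr m) (Inl i) (Inr j) (Inl k) (Inr l) z
       * cnj (v $ m) * y $ i * cnj (x $ j) * w $ k * cnj (u $ l))"
    unfolding sum.cartesian_product
    by (rule sum.reindex_bij_witness[of _ "\<lambda>(m,i,j,k,l). (m,j,i,l,k)" "\<lambda>(m,i,j,k,l). (m,j,i,l,k)"])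
      (auto simp: mult_ac)
  also have "\<dots> = nabla_Riem g z (antihol_vec v) (hol_vec y) (antihol_vec x) (hol_vec w) (antihol_vec u)"
    by (simp add: nabla_Riem_def sum_UNIV_Plus hol_vec_def antihol_vec_def)
  finally show ?thesis .
qed

lemma cnj_nabla_Riem_antihol:
  assumes z: "z \<in> W"
  shows "cnj (nabla_Riem g z (antihol_vec v) (hol_vec x) (antihol_vec y) (hol_vec u) (antihol_vec w))
    = nabla_Riem g z (hol_vec v) (hol_vec y) (antihol_vec x) (hol_vec w) (antihol_vec u)"
  unfolding cnj_nabla_Riem[OF z, symmetric] by simp

lemma cnj_Riem:
  assumes z: "z \<in> W"
  shows "cnj (Riem g z (hol_vec x) (antihol_vec y) (hol_vec u) (antihol_vec w))
    = Riem g z (hol_vec y) (antihol_vec x) (hol_vec w) (antihol_vec u)"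
proof -
  have "cnj (Riem g z (hol_vec x) (antihol_vec y) (hol_vec u) (antihol_vec w))
    = (\<Sum>i\<in>UNIV. \<Sum>j\<in>UNIV. \<Sum>k\<in>UNIV. \<Sum>l\<in>UNIV. R j i l k z
       * cnj (x $ i) * y $ j * cnj (u $ k) * w $ l)"
    by (simp add: Riem_def sum_UNIV_Plus hol_vec_def antihol_vec_def curv_eq[OF z] R_herm[OF z])
  also have "\<dots> = (\<Sum>i\<in>UNIV. \<Sum>j\<in>UNIV. \<Sum>k\<in>UNIV. \<Sum>l\<in>UNIV. R i j k l z
       * y $ i * cnj (x $ j) * w $ k * cnj (u $ l))"
    unfolding sum.cartesian_product
    by (rule sum.reindex_bij_witness[of _ "\<lambda>(i,j,k,l). (j,i,l,k)" "\<lambda>(i,j,k,l). (j,i,l,k)"])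
      (auto simp: mult_ac)
  also have "\<dots> = Riem g z (hol_vec y) (antihol_vec x) (hol_vec w) (antihol_vec u)"
    by (simp add: Riem_def sum_UNIV_Plus hol_vec_def antihol_vec_def curv_eq[OF z])
  finally show ?thesis .
qed

text \<open>Conjugation exchanges upper and lower indices of the frame components, so the squared
  norm becomes a bilinear trace free of conjugates, which can be differentiated as such.\<close>

lemma mixed_norm_sq_tr2:
  assumes F: "\<And>\<alpha> \<beta> \<gamma> \<delta>. T (hol_vec (E \<alpha>)) (antihol_vec (E \<beta>)) (hol_vec (E \<gamma>)) (antihol_vec (E \<delta>)) = F \<beta> \<delta> \<alpha> \<gamma>"
    and F': "\<And>\<alpha> \<beta> \<gamma> \<delta>. cnj (F \<beta> \<delta> \<alpha> \<gamma>) = F' \<alpha> \<gamma> \<beta> \<delta>"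
  shows "complex_of_real (mixed_norm_sq E T) = tr2 F F'"
proof -
  have "complex_of_real (mixed_norm_sq E T)
     = (\<Sum>\<alpha>\<in>UNIV. \<Sum>\<beta>\<in>UNIV. \<Sum>\<gamma>\<in>UNIV. \<Sum>\<delta>\<in>UNIV. F \<beta> \<delta> \<alpha> \<gamma> * F' \<alpha> \<gamma> \<beta> \<delta>)"
    unfolding mixed_norm_sq_def F of_real_sum complex_norm_square F' ..
  also have "\<dots> = tr2 F F'"
    unfolding tr2_def sum.cartesian_product
    by (rule sum.reindex_bij_witness[of _ "\<lambda>(b,d,a,c). (a,b,c,d)" "\<lambda>(a,b,c,d). (b,d,a,c)"]) auto
  finally show ?thesis .
qed

lemma mixed_norm_sq_Riem:
  assumes z: "z \<in> W"
  shows "complex_of_real (mixed_norm_sq (Z z) (Riem g z))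
    = tr2 (\<lambda>b d a c. A b d a c z) (\<lambda>b d a c. A b d a c z)"
proof -
  let ?F = "frm z (\<lambda>b d a c. A b d a c z)"
  have "complex_of_real (mixed_norm_sq (Z z) (Riem g z)) = tr2 ?F ?F"
    by (rule mixed_norm_sq_tr2, rule Riem_frame[OF z])
      (simp add: Riem_frame[OF z, symmetric] cnj_Riem[OF z])
  then show ?thesis by (simp add: tr2_frm[OF z])
qed

text \<open>Conjugation exchanges the derivatives along v and its conjugate. Both norms are
  therefore the same trace, which is why the two gradient terms of the Bochner formula are
  equal.\<close>

lemma mixed_norm_sq_nabla_Riem:
  assumes z: "z \<in> W"
  defines "X \<equiv> \<lambda>v. slice (\<lambda>m b d a c. nab m A b d a c z) (\<lambda>m. v $ m)"
    and "Y \<equiv> \<lambda>v. slice (\<lambda>m b d a c. dr m (A b d a c) z) (\<lambda>m. cnj (v $ m))"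
  shows "complex_of_real (mixed_norm_sq (Z z) (nabla_Riem g z (hol_vec v))) = tr2 (X v) (Y v)"
    and "complex_of_real (mixed_norm_sq (Z z) (nabla_Riem g z (antihol_vec v))) = tr2 (X v) (Y v)"
proof -
  have "complex_of_real (mixed_norm_sq (Z z) (nabla_Riem g z (hol_vec v))) = tr2 (frm z (X v)) (frm z (Y v))"
    unfolding X_def Y_def
    by (rule mixed_norm_sq_tr2, rule nabla_Riem_frame(1)[OF z])
      (simp add: nabla_Riem_frame[OF z, symmetric] cnj_nabla_Riem[OF z])
  then show "complex_of_real (mixed_norm_sq (Z z) (nabla_Riem g z (hol_vec v))) = tr2 (X v) (Y v)"
    by (simp add: tr2_frm[OF z])
  have "complex_of_real (mixed_norm_sq (Z z) (nabla_Riem g z (antihol_vec v))) = tr2 (frm z (Y v)) (frm z (X v))"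
    unfolding X_def Y_def
    by (rule mixed_norm_sq_tr2, rule nabla_Riem_frame(2)[OF z])
      (simp add: nabla_Riem_frame[OF z, symmetric] cnj_nabla_Riem_antihol[OF z])
  then show "complex_of_real (mixed_norm_sq (Z z) (nabla_Riem g z (antihol_vec v))) = tr2 (X v) (Y v)"
    by (simp add: tr2_frm[OF z] tr2_commute)
qed

section \<open>The Bochner formula\<close>

lemma sum_tr2_slice:
  "(\<Sum>\<mu>\<in>UNIV. tr2 (slice X (\<lambda>m. Z z \<mu> $ m)) (slice Y (\<lambda>m. cnj (Z z \<mu> $ m))))
    = (\<Sum>p\<in>UNIV. \<Sum>q\<in>UNIV. Hm q p z * tr2 (Y q) (X p))"
proof -
  have "(\<Sum>\<mu>\<in>UNIV. tr2 (slice X (\<lambda>m. Z z \<mu> $ m)) (slice Y (\<lambda>m. cnj (Z z \<mu> $ m))))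
    = (\<Sum>\<mu>\<in>UNIV. \<Sum>b\<in>UNIV. \<Sum>d\<in>UNIV. \<Sum>a\<in>UNIV. \<Sum>c\<in>UNIV. \<Sum>p\<in>UNIV. \<Sum>q\<in>UNIV.
        (Z z \<mu> $ p * X p b d a c) * (cnj (Z z \<mu> $ q) * Y q a c b d))"
    unfolding tr2_def slice_def sum_product ..
  also have "\<dots> = (\<Sum>p\<in>UNIV. \<Sum>q\<in>UNIV. \<Sum>b\<in>UNIV. \<Sum>d\<in>UNIV. \<Sum>a\<in>UNIV. \<Sum>c\<in>UNIV. \<Sum>\<mu>\<in>UNIV.
        cnj (Z z \<mu> $ q) * Z z \<mu> $ p * (X p b d a c * Y q a c b d))"
    unfolding sum.cartesian_product
    by (rule sum.reindex_bij_witness[of _ "\<lambda>(p,q,b,d,a,c,\<mu>). (\<mu>,b,d,a,c,p,q)" "\<lambda>(\<mu>,b,d,a,c,p,q). (p,q,b,d,a,c,\<mu>)"])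
      (auto simp: mult_ac)
  also have "\<dots> = (\<Sum>p\<in>UNIV. \<Sum>q\<in>UNIV. Hm q p z * tr2 (X p) (Y q))"
    unfolding Hm_def tr2_def sum_distrib_left sum_distrib_right ..
  finally show ?thesis by (simp add: tr2_commute)
qed

text \<open>Mixed Christoffel symbols vanish, so both orders give the plain mixed derivative. The
  function \<open>u\<close> may differ from the smooth \<open>u'\<close> outside \<open>W\<close>,
  where the frame has no meaning.\<close>

lemma Hess_mixed:
  assumes z: "z \<in> W" and u: "\<And>y. y \<in> W \<Longrightarrow> u y = u' y" and sm: "sm u'"
  shows "Hess g u z (hol_vec v) (antihol_vec w) = (\<Sum>i\<in>UNIV. \<Sum>j\<in>UNIV. dl i (dr j u') z * v $ i * cnj (w $ j))"
    and "Hess g u z (antihol_vec w) (hol_vec v) = (\<Sum>i\<in>UNIV. \<Sum>j\<in>UNIV. dl i (dr j u') z * v $ i * cnj (w $ j))"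
proof -
  have p: "pd a (pd b u) z = pd a (pd b u') z" for a b
    by (rule pd_cong[OF z], rule pd_cong) (simp_all add: u)
  show "Hess g u z (hol_vec v) (antihol_vec w) = (\<Sum>i\<in>UNIV. \<Sum>j\<in>UNIV. dl i (dr j u') z * v $ i * cnj (w $ j))"
    by (simp add: Hess_def sum_UNIV_Plus hol_vec_def antihol_vec_def christoffel_eq[OF z] p)
  have "Hess g u z (antihol_vec w) (hol_vec v) = (\<Sum>j\<in>UNIV. \<Sum>i\<in>UNIV. dl i (dr j u') z * v $ i * cnj (w $ j))"
    by (simp add: Hess_def sum_UNIV_Plus hol_vec_def antihol_vec_def christoffel_eq[OF z] p
        pd_commute[OF sm z, of "Inr _" "Inl _"] mult_ac)
  then show "Hess g u z (antihol_vec w) (hol_vec v) = (\<Sum>i\<in>UNIV. \<Sum>j\<in>UNIV. dl i (dr j u') z * v $ i * cnj (w $ j))"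
    by (subst sum.swap)
qed

lemma laplacian_eq:
  assumes z: "z \<in> W" and u: "\<And>y. y \<in> W \<Longrightarrow> u y = u' y" and sm: "sm u'"
  shows "laplacian_C g Z u z = (\<Sum>p\<in>UNIV. \<Sum>q\<in>UNIV. Hm q p z * dl p (dr q u') z)"
proof -
  have "laplacian_C g Z u z = (\<Sum>\<mu>\<in>UNIV. \<Sum>p\<in>UNIV. \<Sum>q\<in>UNIV. dl p (dr q u') z * Z z \<mu> $ p * cnj (Z z \<mu> $ q))"
    by (simp add: laplacian_C_def Hess_mixed[OF z _ sm] u sum_distrib_left[symmetric])
  also have "\<dots> = (\<Sum>p\<in>UNIV. \<Sum>q\<in>UNIV. \<Sum>\<mu>\<in>UNIV. cnj (Z z \<mu> $ q) * Z z \<mu> $ p * dl p (dr q u') z)"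
    unfolding sum.cartesian_product
    by (rule sum.reindex_bij_witness[of _ "\<lambda>(p,q,\<mu>). (\<mu>,p,q)" "\<lambda>(\<mu>,p,q). (p,q,\<mu>)"]) (auto simp: mult_ac)
  finally show ?thesis by (simp add: Hm_def sum_distrib_right)
qed

lemma Ric_L_eq:
  assumes z: "z \<in> W"
  shows "Ric_L g Z z = 16 * tr2 (\<lambda>b d a c. lapA b d a c z) (\<lambda>b d a c. A b d a c z)"
proof -
  have "laplacian_C g Z (\<lambda>y. complex_of_real (mixed_norm_sq (Z y) (Riem g y))) z
     = (\<Sum>p\<in>UNIV. \<Sum>q\<in>UNIV. Hm q p z * dl p (dr q (\<lambda>y. tr2 (\<lambda>b d a c. A b d a c y) (\<lambda>b d a c. A b d a c y))) z)"
    by (rule laplacian_eq[OF z mixed_norm_sq_Riem]) simp_all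
  then show ?thesis
    unfolding Ric_L_def of_real_sum mixed_norm_sq_nabla_Riem[OF z] sum_tr2_slice
    by (simp add: laplacian_tr2_A[OF z])
qed

section \<open>The Bochner term of an Einstein metric in the unitary frame\<close>

definition Rf :: "complex^'n \<Rightarrow> 'n \<Rightarrow> 'n \<Rightarrow> 'n \<Rightarrow> 'n \<Rightarrow> complex" where
  "Rf z = frm z (\<lambda>b d a c. A b d a c z)"

lemma tr2_linear:
  "tr2 (\<lambda>b d a c. X b d a c + Y b d a c) V = tr2 X V + tr2 Y V"
  "tr2 (\<lambda>b d a c. X b d a c - Y b d a c) V = tr2 X V - tr2 Y V"
  "tr2 (\<lambda>b d a c. k * X b d a c) V = k * tr2 X V"
  by (simp_all add: tr2_def distrib_right left_diff_distrib sum.distrib sum_subtractf sum_distrib_left mult.assoc)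

lemma einstein_coordinates:
  assumes z: "z \<in> W"
    and ric: "\<And>\<alpha> \<beta>. Ricci g z (Z z) \<alpha> \<beta> = lam * metric_ext g z (hol_vec (Z z \<alpha>)) (antihol_vec (Z z \<beta>))"
  shows "(\<Sum>c\<in>UNIV. A b c a c z) = (if b = a then lam else 0)"
proof -
  let ?q = "\<lambda>\<beta> b. Q b \<beta> z" and ?p = "\<lambda>\<alpha> a. Z z \<alpha> $ a" and ?r = "\<lambda>b a. \<Sum>c\<in>UNIV. A b c a c z"
  have con: "contr ?p ?q" by (rule contr_frame[OF z])
  have r: "bil ?q ?p ?r \<beta> \<alpha> = (if \<alpha> = \<beta> then lam else 0)" for \<alpha> \<beta>
  proof -
    have "(\<Sum>\<gamma>\<in>UNIV. frm z (\<lambda>b d a c. A b d a c z) \<beta> \<gamma> \<alpha> \<gamma>)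
      = (\<Sum>b\<in>UNIV. \<Sum>a\<in>UNIV. \<Sum>d\<in>UNIV. \<Sum>c\<in>UNIV. (\<Sum>\<gamma>\<in>UNIV. ?q \<gamma> d * ?p \<gamma> c) * (?q \<beta> b * ?p \<alpha> a * A b d a c z))"
      unfolding frm_def frame4_def sum_distrib_right sum.cartesian_product
      by (rule sum.reindex_bij_witness[of _ "\<lambda>(b,a,d,c,\<gamma>). (\<gamma>,b,d,a,c)" "\<lambda>(\<gamma>,b,d,a,c). (b,a,d,c,\<gamma>)"])
        (auto simp: mult_ac)
    also have "\<dots> = bil ?q ?p ?r \<beta> \<alpha>"
      using contr_commute[OF con] by (simp add: contr_def sum_delta_left bil_def sum_distrib_left)
    finally have "bil ?q ?p ?r \<beta> \<alpha> = Ricci g z (Z z) \<alpha> \<beta>"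
      by (simp add: Ricci_def Riem_frame[OF z])
    also have "\<dots> = (if \<alpha> = \<beta> then lam else 0)"
      using frame z by (simp add: ric unitary_frame_on_def unitary_basis_at_def)
    finally show ?thesis .
  qed
  \<comment> \<open>In the frame the Ricci endomorphism is \<open>lam\<close> times the identity
    matrix; completeness of frame and coframe carries this back to coordinates.\<close>
  have "?r b a = (\<Sum>i\<in>UNIV. (if b = i then 1 else 0) * (\<Sum>j\<in>UNIV. (if j = a then 1 else 0) * ?r i j))"
    by (simp only: sum_delta_left eq_commute[of _ a])
  also have "\<dots> = (\<Sum>\<beta>\<in>UNIV. \<Sum>\<alpha>\<in>UNIV. Z z \<beta> $ b * Q a \<alpha> z * bil ?q ?p ?r \<beta> \<alpha>)"
  proof -
    have "(\<Sum>\<beta>\<in>UNIV. \<Sum>\<alpha>\<in>UNIV. Z z \<beta> $ b * Q a \<alpha> z * bil ?q ?p V \<beta> \<alpha>)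
      = (\<Sum>i\<in>UNIV. (\<Sum>\<beta>\<in>UNIV. Z z \<beta> $ b * Q i \<beta> z) * (\<Sum>j\<in>UNIV. (\<Sum>\<alpha>\<in>UNIV. Z z \<alpha> $ j * Q a \<alpha> z) * V i j))" for V
    proof -
      have "(\<Sum>\<beta>\<in>UNIV. \<Sum>\<alpha>\<in>UNIV. Z z \<beta> $ b * Q a \<alpha> z * bil ?q ?p V \<beta> \<alpha>)
        = (\<Sum>\<beta>\<in>UNIV. \<Sum>\<alpha>\<in>UNIV. \<Sum>i\<in>UNIV. \<Sum>j\<in>UNIV.
            Z z \<beta> $ b * Q a \<alpha> z * (Q i \<beta> z * Z z \<alpha> $ j * V i j))"
        unfolding bil_def sum_distrib_left ..
      also have "\<dots> = (\<Sum>i\<in>UNIV. \<Sum>j\<in>UNIV. \<Sum>\<alpha>\<in>UNIV. \<Sum>\<beta>\<in>UNIV.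
            Z z \<beta> $ b * Q i \<beta> z * (Z z \<alpha> $ j * Q a \<alpha> z * V i j))"
        unfolding sum.cartesian_product
        by (rule sum.reindex_bij_witness[of _ "\<lambda>(i,j,\<alpha>,\<beta>). (\<beta>,\<alpha>,i,j)" "\<lambda>(\<beta>,\<alpha>,i,j). (i,j,\<alpha>,\<beta>)"])
          (auto simp: mult_ac)
      finally show ?thesis by (simp add: sum_distrib_left sum_distrib_right)
    qed
    then show ?thesis by (simp only: coframe_frame[OF z])
  qed
  also have "\<dots> = (\<Sum>\<beta>\<in>UNIV. Z z \<beta> $ b * Q a \<beta> z * lam)"
    unfolding r by (simp add: if_distrib cong: if_cong)
  also have "\<dots> = (if b = a then lam else 0)"
    by (simp add: sum_distrib_right[symmetric] coframe_frame[OF z])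
  finally show ?thesis .
qed

lemma Ric_L_einstein:
  assumes z: "z \<in> W"
    and ric: "\<And>y \<alpha> \<beta>. y \<in> W \<Longrightarrow>
      Ricci g y (Z y) \<alpha> \<beta> = lam * metric_ext g y (hol_vec (Z y \<alpha>)) (antihol_vec (Z y \<beta>))"
  shows "Ric_L g Z z = 16 * (lam * tr2 (Rf z) (Rf z) + tr2 (comp4 (Rf z) (Rf z)) (Rf z)
      - 2 * tr2 (twist4 (Rf z) (Rf z)) (Rf z))"
proof -
  interpret einstein_patch W Gm Hm lam
    by unfold_locales (rule einstein_coordinates[OF _ ric])
  let ?A = "\<lambda>b d a c. A b d a c z"
  have "tr2 (\<lambda>b d a c. lapA b d a c z) ?A
     = lam * tr2 ?A ?A + tr2 (comp4 ?A ?A) ?A - tr2 (twist4 ?A ?A) ?A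
       - tr2 (\<lambda>b d a c. \<Sum>p\<in>UNIV. \<Sum>f\<in>UNIV. A b f p c z * A p d a f z) ?A"
    unfolding lapA_eq[OF z] tr2_linear comp4_def twist4_def ..
  \<comment> \<open>The last term of \<open>lapA_eq\<close> is the preceding one with a and c
    exchanged, a difference that the trace against the symmetric \<open>A\<close> does not
    see.\<close>
  also have "tr2 (\<lambda>b d a c. \<Sum>p\<in>UNIV. \<Sum>f\<in>UNIV. A b f p c z * A p d a f z) ?A
     = tr2 (\<lambda>b d a c. twist4 ?A ?A b d c a) ?A"
    by (simp add: twist4_def A_sym_lower[OF z, of _ _ _ _])
  also have "\<dots> = tr2 (twist4 ?A ?A) ?A"
    unfolding tr2_def sum.cartesian_product
    by (rule sum.reindex_bij_witness[of _ "\<lambda>(b,d,a,c). (b,d,c,a)" "\<lambda>(b,d,a,c). (b,d,c,a)"])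
      (auto simp: A_sym_upper[OF z])
  finally show ?thesis
    unfolding Ric_L_eq[OF z] Rf_def frm_def frame4_comp4[OF contr_frame[OF z]] frame4_twist4[OF contr_frame[OF z]]
      tr2_frame4[OF contr_frame[OF z]]
    by simp
qed

end

section \<open>Eigenbases of the Calabi operator\<close>

lemma herm_inner_add: "herm_inner (h + h') k = herm_inner h k + herm_inner h' k"
  by (simp add: herm_inner_def distrib_right sum.distrib)

lemma herm_inner_scale: "herm_inner (c *s h) k = c * herm_inner h k"
  by (simp add: herm_inner_def sum_distrib_left mult.assoc)

lemma herm_inner_sum: "herm_inner (\<Sum>i\<in>I. h i) k = (\<Sum>i\<in>I. herm_inner (h i) k)"
  by (induction I rule: infinite_finite_induct) (simp_all add: herm_inner_add, simp_all add: herm_inner_def)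

lemma unitary_basis_expansion:
  assumes U: "unitary_basis_of V I S" and h: "h \<in> V"
  shows "h = (\<Sum>A\<in>I. herm_inner h (S A) *s S A)"
proof -
  have fin: "finite I" and orth: "\<And>A B. A \<in> I \<Longrightarrow> B \<in> I \<Longrightarrow> herm_inner (S A) (S B) = (if A = B then 1 else 0)"
    and h': "h \<in> vec.span (S ` I)"
    using U h by (auto simp: unitary_basis_of_def)
  from h' show ?thesis
  proof (induction rule: vec.span_induct_alt)
    case base
    then show ?case by (simp add: herm_inner_def)
  next
    case (step c x y)
    then obtain B where B: "B \<in> I" "x = S B" by blast
    have "(\<Sum>A\<in>I. herm_inner x (S A) *s S A) = (\<Sum>A\<in>I. if A = B then S A else 0)"
      using B orth by (intro sum.cong) auto
    also have "\<dots> = x" using B fin by simp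
    finally have "(\<Sum>A\<in>I. herm_inner x (S A) *s S A) = x" .
    moreover have "(\<Sum>A\<in>I. herm_inner (c *s x + y) (S A) *s S A)
        = c *s (\<Sum>A\<in>I. herm_inner x (S A) *s S A) + (\<Sum>A\<in>I. herm_inner y (S A) *s S A)"
      by (simp add: herm_inner_add herm_inner_scale vec.scale_left_distrib sum.distrib vec.scale_sum_right)
    ultimately show ?case using step.IH by simp
  qed
qed

text \<open>\<open>trace_on\<close> uses an unspecified basis \<open>B\<close>. Summing over
  \<open>B\<close> the b-coefficient of \<open>S A\<close> times the inner product of b with
  \<open>S A\<close> reassembles the inner product of \<open>S A\<close> with itself, which is 1;
  bases need not be compared.\<close>

lemma trace_on_eigenbasis:
  assumes U: "unitary_basis_of V I S"
    and L: "\<And>h. h \<in> V \<Longrightarrow> L h = (\<Sum>A\<in>I. (c A * herm_inner h (S A)) *s S A)"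
  shows "trace_on V L = (\<Sum>A\<in>I. c A)"
proof -
  have orth: "\<And>A. A \<in> I \<Longrightarrow> herm_inner (S A) (S A) = 1"
    and V: "vec.span (S ` I) = V"
    using U by (auto simp: unitary_basis_of_def)
  define B where "B = (SOME B. vec.independent B \<and> vec.span B = V)"
  \<comment> \<open>The choice in \<open>trace_on\<close> is meaningful only once some basis of
    \<open>V\<close> is known to exist.\<close>
  obtain B' where "B' \<subseteq> V" "vec.independent B'" "V \<subseteq> vec.span B'"
    by (rule vec.maximal_independent_subset)
  moreover have "vec.span V = V" unfolding V[symmetric] by (rule vec.span_span)
  ultimately have "vec.independent B' \<and> vec.span B' = V" using vec.span_mono by blast
  then have "vec.independent B \<and> vec.span B = V" unfolding B_def by (rule someI)
  then have B: "vec.independent B" "vec.span B = V" by blast+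
  have fin: "finite B" using B(1) by (rule vec.finiteI_independent)
  have SV: "S A \<in> vec.span B" if "A \<in> I" for A
    unfolding B(2) V[symmetric] by (rule vec.span_base) (use that in blast)
  have rep: "vec.representation B (L b) b
      = (\<Sum>A\<in>I. c A * (vec.representation B (S A) b * herm_inner b (S A)))" if "b \<in> B" for b
  proof -
    have "b \<in> V" unfolding B(2)[symmetric] by (rule vec.span_base[OF that])
    then show ?thesis
      by (simp add: L vec.representation_sum[OF B(1)] vec.representation_scale[OF B(1)] SV vec.span_scale mult_ac)
  qed
  have "trace_on V L = (\<Sum>b\<in>B. vec.representation B (L b) b)"
    by (simp only: trace_on_def B_def Let_def)
  also have "\<dots> = (\<Sum>A\<in>I. c A * (\<Sum>b\<in>B. vec.representation B (S A) b * herm_inner b (S A)))"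
    by (simp add: rep sum_distrib_left) (rule sum.swap)
  also have "\<dots> = (\<Sum>A\<in>I. c A)"
  proof (rule sum.cong[OF refl])
    fix A assume A: "A \<in> I"
    have "(\<Sum>b\<in>B. vec.representation B (S A) b * herm_inner b (S A))
        = herm_inner (\<Sum>b\<in>B. vec.representation B (S A) b *s b) (S A)"
      by (simp add: herm_inner_sum herm_inner_scale)
    also have "\<dots> = 1"
      using vec.sum_representation_eq[OF B(1) SV[OF A] fin order_refl] orth[OF A] by simp
    finally show "c A * (\<Sum>b\<in>B. vec.representation B (S A) b * herm_inner b (S A)) = c A" by simp
  qed
  finally show ?thesis .
qed

section \<open>Spectral decomposition of the Calabi operator\<close>

text \<open>Pure linear algebra at one point: \<open>F\<close> stands for the frame components of
  \<open>A\<close>, upper indices first, and \<open>F_ric\<close> is all that remains of the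
  Einstein condition.\<close>

locale calabi_eigenbasis =
  fixes F :: "'n::finite \<Rightarrow> 'n \<Rightarrow> 'n \<Rightarrow> 'n \<Rightarrow> complex"
    and C :: "complex^('n \<times> 'n) \<Rightarrow> complex^('n \<times> 'n)"
    and I :: "'i set" and S :: "'i \<Rightarrow> complex^('n \<times> 'n)" and \<sigma> :: "'i \<Rightarrow> real" and lam :: complex
  assumes F_upper: "F b d a c = F d b a c" and F_lower: "F b d a c = F b d c a"
    and F_herm: "cnj (F b d a c) = F a c b d"
    and F_ric: "(\<Sum>c\<in>UNIV. F c b c a) = (if b = a then lam else 0)"
    and C_def: "C h = (\<chi> p. \<Sum>\<alpha>\<in>UNIV. \<Sum>\<gamma>\<in>UNIV. F (fst p) (snd p) \<alpha> \<gamma> * h $ (\<alpha>, \<gamma>))"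
    and basis: "unitary_basis_of S20 I S"
    and eigen: "A \<in> I \<Longrightarrow> C (S A) = complex_of_real (\<sigma> A) *s S A"
begin

lemma S_in_S20: "A \<in> I \<Longrightarrow> S A \<in> S20"
  using basis vec.span_base unfolding unitary_basis_of_def by blast

lemma C_combination: "C (\<Sum>A\<in>I. k A *s S A) = (\<Sum>A\<in>I. (k A * complex_of_real (\<sigma> A)) *s S A)"
proof -
  have "C (\<Sum>A\<in>I. k A *s S A) $ p = (\<Sum>A\<in>I. (k A * complex_of_real (\<sigma> A)) *s S A) $ p" for p
  proof -
    have "C (\<Sum>A\<in>I. k A *s S A) $ p
      = (\<Sum>\<alpha>\<in>UNIV. \<Sum>\<gamma>\<in>UNIV. \<Sum>A\<in>I. F (fst p) (snd p) \<alpha> \<gamma> * (k A * S A $ (\<alpha>, \<gamma>)))"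
      by (simp add: C_def sum_distrib_left)
    also have "\<dots> = (\<Sum>A\<in>I. \<Sum>\<alpha>\<in>UNIV. \<Sum>\<gamma>\<in>UNIV. F (fst p) (snd p) \<alpha> \<gamma> * (k A * S A $ (\<alpha>, \<gamma>)))"
      unfolding sum.cartesian_product
      by (rule sum.reindex_bij_witness[of _ "\<lambda>(A,\<alpha>,\<gamma>). (\<alpha>,\<gamma>,A)" "\<lambda>(\<alpha>,\<gamma>,A). (A,\<alpha>,\<gamma>)"]) auto
    also have "\<dots> = (\<Sum>A\<in>I. k A * C (S A) $ p)"
      by (simp add: C_def sum_distrib_left mult_ac)
    also have "\<dots> = (\<Sum>A\<in>I. k A * (complex_of_real (\<sigma> A) * S A $ p))"
      by (rule sum.cong[OF refl]) (simp add: eigen)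
    finally show ?thesis by (simp add: mult.assoc)
  qed
  then show ?thesis by (simp add: vec_eq_iff)
qed

lemma C_power:
  assumes h: "h \<in> S20"
  shows "(C ^^ k) h = (\<Sum>A\<in>I. (complex_of_real (\<sigma> A ^ k) * herm_inner h (S A)) *s S A)"
proof (induction k)
  case 0
  then show ?case using unitary_basis_expansion[OF basis h] by simp
next
  case (Suc k)
  then show ?case by (simp add: C_combination mult_ac)
qed

lemma trace_C_power: "trace_on S20 (C ^^ k) = (\<Sum>A\<in>I. complex_of_real (\<sigma> A ^ k))"
  by (rule trace_on_eigenbasis[OF basis C_power])

text \<open>This follows by applying \<open>C\<close> to the symmetrisation of \<open>e\<^sub>\<alpha> \<otimes> e\<^sub>\<gamma>\<close>.\<close>

lemma kernel: "(\<Sum>A\<in>I. complex_of_real (\<sigma> A) * S A $ (\<beta>, \<delta>) * cnj (S A $ (\<alpha>, \<gamma>))) = F \<beta> \<delta> \<alpha> \<gamma>"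
proof -
  \<comment> \<open>The eigenbasis spans symmetric tensors only, hence the symmetrisation; for
    \<alpha> = \<gamma> both indicators hit the same entry and the factor 1/2 keeps it equal to
    1.\<close>
  define h :: "complex^('n \<times> 'n)" where
    "h = (\<chi> q. ((if q = (\<alpha>, \<gamma>) then 1 else 0) + (if q = (\<gamma>, \<alpha>) then 1 else 0)) / 2)"
  have h: "h \<in> S20" by (simp add: S20_def h_def conj_commute add.commute)
  have ind: "k * (((if P then 1 else 0) + (if Q then 1 else 0)) / 2)
      = ((if P then k else 0) + (if Q then k else 0)) / 2" for k :: complex and P Q
    by simp
  have delta: "(\<Sum>q\<in>UNIV. f q * h $ q) = (f (\<alpha>, \<gamma>) + f (\<gamma>, \<alpha>)) / 2" for f
  proof -
    have "f q * h $ q = ((if q = (\<alpha>, \<gamma>) then f q else 0) + (if q = (\<gamma>, \<alpha>) then f q else 0)) / 2" for q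
      unfolding h_def vec_lambda_beta by (rule ind)
    then have "(\<Sum>q\<in>UNIV. f q * h $ q)
       = ((\<Sum>q\<in>UNIV. if q = (\<alpha>, \<gamma>) then f q else 0) + (\<Sum>q\<in>UNIV. if q = (\<gamma>, \<alpha>) then f q else 0)) / 2"
      by (simp only: sum.distrib sum_divide_distrib[symmetric])
    also have "\<dots> = (f (\<alpha>, \<gamma>) + f (\<gamma>, \<alpha>)) / 2"
      by (simp only: sum.delta[OF finite] UNIV_I if_True)
    finally show ?thesis .
  qed
  have "C h $ (\<beta>, \<delta>) = (\<Sum>q\<in>UNIV. F \<beta> \<delta> (fst q) (snd q) * h $ q)"
    by (simp add: C_def sum_UNIV_prod)
  also have "\<dots> = F \<beta> \<delta> \<alpha> \<gamma>"
    unfolding delta by (simp add: F_lower[of \<beta> \<delta> \<gamma> \<alpha>])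
  finally have 1: "C h $ (\<beta>, \<delta>) = F \<beta> \<delta> \<alpha> \<gamma>" .
  have 2: "herm_inner h (S A) = cnj (S A $ (\<alpha>, \<gamma>))" if "A \<in> I" for A
  proof -
    have "S A $ (\<gamma>, \<alpha>) = S A $ (\<alpha>, \<gamma>)" using S_in_S20[OF that] unfolding S20_def by blast
    then show ?thesis using delta[of "\<lambda>q. cnj (S A $ q)"] by (simp add: herm_inner_def mult.commute)
  qed
  have "C h = (\<Sum>A\<in>I. (complex_of_real (\<sigma> A) * herm_inner h (S A)) *s S A)"
    using C_power[OF h, of 1] by simp
  then have "F \<beta> \<delta> \<alpha> \<gamma> = (\<Sum>A\<in>I. (complex_of_real (\<sigma> A) * herm_inner h (S A)) * S A $ (\<beta>, \<delta>))"
    using 1 by simp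
  also have "\<dots> = (\<Sum>A\<in>I. complex_of_real (\<sigma> A) * S A $ (\<beta>, \<delta>) * cnj (S A $ (\<alpha>, \<gamma>)))"
    by (rule sum.cong) (simp_all add: 2 mult_ac)
  finally show ?thesis by simp
qed

lemma C_S: "A \<in> I \<Longrightarrow> complex_of_real (\<sigma> A) * S A $ (\<beta>, \<delta>) = (\<Sum>\<pi>\<in>UNIV. \<Sum>\<phi>\<in>UNIV. F \<beta> \<delta> \<pi> \<phi> * S A $ (\<pi>, \<phi>))"
  using arg_cong[OF eigen, of A "\<lambda>h. h $ (\<beta>, \<delta>)"] by (simp add: C_def)

text \<open>One eigenvalue is spent on replacing the first factor \<open>S A\<close> by its image
  under \<open>C\<close>; the kernels of the powers of \<open>C\<close> are thus the iterated
  compositions of \<open>F\<close>.\<close>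

lemma kernel_Suc:
  assumes K: "\<And>\<beta> \<delta> \<alpha> \<gamma>. (\<Sum>A\<in>I. complex_of_real (\<sigma> A ^ k) * S A $ (\<beta>, \<delta>) * cnj (S A $ (\<alpha>, \<gamma>))) = K \<beta> \<delta> \<alpha> \<gamma>"
  shows "(\<Sum>A\<in>I. complex_of_real (\<sigma> A ^ Suc k) * S A $ (\<beta>, \<delta>) * cnj (S A $ (\<alpha>, \<gamma>))) = comp4 F K \<beta> \<delta> \<alpha> \<gamma>"
proof -
  have "(\<Sum>A\<in>I. complex_of_real (\<sigma> A ^ Suc k) * S A $ (\<beta>, \<delta>) * cnj (S A $ (\<alpha>, \<gamma>)))
    = (\<Sum>A\<in>I. complex_of_real (\<sigma> A ^ k) * (complex_of_real (\<sigma> A) * S A $ (\<beta>, \<delta>)) * cnj (S A $ (\<alpha>, \<gamma>)))"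
    by (simp add: mult_ac)
  also have "\<dots> = (\<Sum>A\<in>I. \<Sum>\<pi>\<in>UNIV. \<Sum>\<phi>\<in>UNIV. F \<beta> \<delta> \<pi> \<phi> * (complex_of_real (\<sigma> A ^ k) * S A $ (\<pi>, \<phi>) * cnj (S A $ (\<alpha>, \<gamma>))))"
    by (rule sum.cong[OF refl]) (simp add: C_S sum_distrib_left sum_distrib_right mult_ac)
  also have "\<dots> = (\<Sum>\<pi>\<in>UNIV. \<Sum>\<phi>\<in>UNIV. \<Sum>A\<in>I. F \<beta> \<delta> \<pi> \<phi> * (complex_of_real (\<sigma> A ^ k) * S A $ (\<pi>, \<phi>) * cnj (S A $ (\<alpha>, \<gamma>))))"
    unfolding sum.cartesian_product
    by (rule sum.reindex_bij_witness[of _ "\<lambda>(\<pi>,\<phi>,A). (A,\<pi>,\<phi>)" "\<lambda>(A,\<pi>,\<phi>). (\<pi>,\<phi>,A)"]) auto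
  also have "\<dots> = comp4 F K \<beta> \<delta> \<alpha> \<gamma>"
    by (simp only: sum_distrib_left[symmetric] K comp4_def)
  finally show ?thesis .
qed

lemma trace_kernel:
  assumes K: "\<And>\<beta> \<delta> \<alpha> \<gamma>. (\<Sum>A\<in>I. complex_of_real (\<sigma> A ^ k) * S A $ (\<beta>, \<delta>) * cnj (S A $ (\<alpha>, \<gamma>))) = K \<beta> \<delta> \<alpha> \<gamma>"
  shows "trace_on S20 (C ^^ k) = (\<Sum>\<beta>\<in>UNIV. \<Sum>\<delta>\<in>UNIV. K \<beta> \<delta> \<beta> \<delta>)"
proof -
  have "trace_on S20 (C ^^ k) = (\<Sum>A\<in>I. complex_of_real (\<sigma> A ^ k) * herm_inner (S A) (S A))"
    unfolding trace_C_power using basis by (intro sum.cong) (auto simp: unitary_basis_of_def)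
  also have "\<dots> = (\<Sum>A\<in>I. \<Sum>\<beta>\<in>UNIV. \<Sum>\<delta>\<in>UNIV. complex_of_real (\<sigma> A ^ k) * S A $ (\<beta>, \<delta>) * cnj (S A $ (\<beta>, \<delta>)))"
    by (simp add: herm_inner_def sum_UNIV_prod sum_distrib_left mult.assoc)
  also have "\<dots> = (\<Sum>\<beta>\<in>UNIV. \<Sum>\<delta>\<in>UNIV. \<Sum>A\<in>I. complex_of_real (\<sigma> A ^ k) * S A $ (\<beta>, \<delta>) * cnj (S A $ (\<beta>, \<delta>)))"
    unfolding sum.cartesian_product
    by (rule sum.reindex_bij_witness[of _ "\<lambda>(\<pi>,\<phi>,A). (A,\<pi>,\<phi>)" "\<lambda>(A,\<pi>,\<phi>). (\<pi>,\<phi>,A)"]) auto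
  finally show ?thesis by (simp only: K)
qed

lemma trace_C2: "trace_on S20 (C ^^ 2) = tr2 F F"
  and trace_C3: "trace_on S20 (C ^^ 3) = tr2 (comp4 F F) F"
proof -
  have k1: "(\<Sum>A\<in>I. complex_of_real (\<sigma> A ^ 1) * S A $ (\<beta>, \<delta>) * cnj (S A $ (\<alpha>, \<gamma>))) = F \<beta> \<delta> \<alpha> \<gamma>" for \<beta> \<delta> \<alpha> \<gamma>
    using kernel by simp
  note k2 = kernel_Suc[OF k1]
  note k3 = kernel_Suc[OF k2]
  show "trace_on S20 (C ^^ 2) = tr2 F F"
    using trace_kernel[OF k2] by (simp add: numeral_2_eq_2 tr2_def comp4_def)
  have "trace_on S20 (C ^^ 3) = tr2 F (comp4 F F)"
    using trace_kernel[OF k3] by (simp add: numeral_3_eq_3 tr2_def comp4_def)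
  then show "trace_on S20 (C ^^ 3) = tr2 (comp4 F F) F"
    by (simp add: tr2_commute)
qed

text \<open>The component of \<open>S\<^sub>A R\<close> with arguments \<open>Z\<^sub>\<bar>x, Z\<^sub>\<bar>y, Z\<^sub>c, Z\<^sub>\<bar>d\<close> is \<open>act y x c d - act x y c d\<close>.\<close>

definition act :: "'i \<Rightarrow> 'n \<Rightarrow> 'n \<Rightarrow> 'n \<Rightarrow> 'n \<Rightarrow> complex" where
  "act A x y c d = (\<Sum>\<gamma>\<in>UNIV. S A $ (x, \<gamma>) * F y d \<gamma> c)"

text \<open>The eigenvalue sum touches only the product of \<open>S A\<close> with its conjugate,
  and \<open>kernel\<close> replaces it by a third curvature factor: this makes the expression
  cubic.\<close>

lemma sum_act_kernel:
  "(\<Sum>A\<in>I. complex_of_real (\<sigma> A) * (act A x y c d * cnj (act A x' y' c d)))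
    = (\<Sum>\<gamma>\<in>UNIV. \<Sum>\<epsilon>\<in>UNIV. F x \<gamma> x' \<epsilon> * (F y d \<gamma> c * F \<epsilon> c y' d))"
proof -
  have "(\<Sum>A\<in>I. complex_of_real (\<sigma> A) * (act A x y c d * cnj (act A x' y' c d)))
    = (\<Sum>A\<in>I. \<Sum>\<epsilon>\<in>UNIV. \<Sum>\<gamma>\<in>UNIV. complex_of_real (\<sigma> A) * S A $ (x, \<gamma>) * cnj (S A $ (x', \<epsilon>)) * (F y d \<gamma> c * F \<epsilon> c y' d))"
    by (simp add: act_def sum_product sum_distrib_left F_herm mult_ac)
  also have "\<dots> = (\<Sum>\<gamma>\<in>UNIV. \<Sum>\<epsilon>\<in>UNIV. \<Sum>A\<in>I. complex_of_real (\<sigma> A) * S A $ (x, \<gamma>) * cnj (S A $ (x', \<epsilon>)) * (F y d \<gamma> c * F \<epsilon> c y' d))"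
    unfolding sum.cartesian_product
    by (rule sum.reindex_bij_witness[of _ "\<lambda>(\<gamma>,\<epsilon>,A). (A,\<epsilon>,\<gamma>)" "\<lambda>(A,\<epsilon>,\<gamma>). (\<gamma>,\<epsilon>,A)"]) auto
  finally show ?thesis by (simp only: sum_distrib_right[symmetric] kernel)
qed

lemma sum_eigenvalue_action:
  "(\<Sum>A\<in>I. complex_of_real (\<sigma> A * (\<Sum>x\<in>UNIV. \<Sum>y\<in>UNIV. \<Sum>c\<in>UNIV. \<Sum>d\<in>UNIV. (cmod (act A x y c d - act A y x c d))\<^sup>2)))
    = 2 * lam * tr2 F F - 2 * tr2 (twist4 F F) F"
proof -
  let ?S = "\<lambda>t. \<Sum>x\<in>UNIV. \<Sum>y\<in>UNIV. \<Sum>c\<in>UNIV. \<Sum>d\<in>UNIV. (t x y c d :: complex)"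
  define N where "N x y x' y' c d = (\<Sum>A\<in>I. complex_of_real (\<sigma> A) * (act A x y c d * cnj (act A x' y' c d)))" for x y x' y' c d
  have N_eq: "N x y x' y' c d = (\<Sum>\<gamma>\<in>UNIV. \<Sum>\<epsilon>\<in>UNIV. F x \<gamma> x' \<epsilon> * (F y d \<gamma> c * F \<epsilon> c y' d))" for x y x' y' c d
    unfolding N_def by (rule sum_act_kernel)
  have "(\<Sum>A\<in>I. complex_of_real (\<sigma> A * (\<Sum>x\<in>UNIV. \<Sum>y\<in>UNIV. \<Sum>c\<in>UNIV. \<Sum>d\<in>UNIV. (cmod (act A x y c d - act A y x c d))\<^sup>2)))
    = (\<Sum>A\<in>I. ?S (\<lambda>x y c d. complex_of_real (\<sigma> A) * ((act A x y c d - act A y x c d) * cnj (act A x y c d - act A y x c d))))"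
    by (simp only: of_real_mult of_real_sum complex_norm_square sum_distrib_left)
  also have "\<dots> = ?S (\<lambda>x y c d. \<Sum>A\<in>I. complex_of_real (\<sigma> A) * ((act A x y c d - act A y x c d) * cnj (act A x y c d - act A y x c d)))"
    unfolding sum.cartesian_product
    by (rule sum.reindex_bij_witness[of _ "\<lambda>(x,y,c,d,A). (A,x,y,c,d)" "\<lambda>(A,x,y,c,d). (x,y,c,d,A)"]) auto
  also have "\<dots> = ?S (\<lambda>x y c d. N x y x y c d + N y x y x c d - N x y y x c d - N y x x y c d)"
    by (simp add: N_def algebra_simps sum.distrib sum_subtractf)
  \<comment> \<open>Expanding the square: in the two diagonal terms x is contracted within one
    curvature factor, a Ricci contraction by \<open>F_ric\<close>; the two cross terms are the
    twisted cubic form.\<close>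
  also have "\<dots> = ?S (\<lambda>x y c d. N x y x y c d) + ?S (\<lambda>x y c d. N y x y x c d)
      - ?S (\<lambda>x y c d. N x y y x c d) - ?S (\<lambda>x y c d. N y x x y c d)"
    by (simp add: sum.distrib sum_subtractf)
  also have "?S (\<lambda>x y c d. N y x y x c d) = ?S (\<lambda>x y c d. N x y x y c d)" by (rule sum.swap)
  also have "?S (\<lambda>x y c d. N y x x y c d) = ?S (\<lambda>x y c d. N x y y x c d)" by (rule sum.swap)
  also have "?S (\<lambda>x y c d. N x y x y c d) = lam * tr2 F F"
  proof -
    have "?S (\<lambda>x y c d. N x y x y c d) = (\<Sum>y\<in>UNIV. \<Sum>d\<in>UNIV. \<Sum>\<gamma>\<in>UNIV. \<Sum>c\<in>UNIV. \<Sum>\<epsilon>\<in>UNIV. \<Sum>x\<in>UNIV. F x \<gamma> x \<epsilon> * (F y d \<gamma> c * F \<epsilon> c y d))"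
      unfolding N_eq sum.cartesian_product
      by (rule sum.reindex_bij_witness[of _ "\<lambda>(y,d,\<gamma>,c,\<epsilon>,x). (x,y,c,d,\<gamma>,\<epsilon>)" "\<lambda>(x,y,c,d,\<gamma>,\<epsilon>). (y,d,\<gamma>,c,\<epsilon>,x)"]) auto
    also have "\<dots> = lam * tr2 F F"
      by (simp add: sum_distrib_right[symmetric] F_ric tr2_def sum_distrib_left if_distrib[of "\<lambda>x. x * _"] cong: if_cong)
    finally show ?thesis .
  qed
  also have "?S (\<lambda>x y c d. N x y y x c d) = tr2 (twist4 F F) F"
    unfolding N_eq tr2_def twist4_def sum_distrib_right sum.cartesian_product
    by (rule sum.reindex_bij_witness[of _ "\<lambda>(x,d,\<epsilon>,c,y,\<gamma>). (x,y,c,d,\<gamma>,\<epsilon>)" "\<lambda>(x,y,c,d,\<gamma>,\<epsilon>). (x,d,\<epsilon>,c,y,\<gamma>)"]) auto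
  finally show ?thesis by simp
qed

end

context kaehler_chart
begin

section \<open>The action of symmetric tensors on the curvature\<close>

lemma Riem_swap:
  assumes z: "z \<in> W"
  shows "Riem g z y x v w = - Riem g z x y v w" "Riem g z x y w v = - Riem g z x y v w"
proof -
  have *: "Rc b a c d = (\<lambda>y. - Rc a b c d y)" "Rc a b d c = (\<lambda>y. - Rc a b c d y)" for a b c d
    by (cases "(a, b, c, d)" rule: Rc.cases; simp)+
  have 1: "Rc b a c d z * y $ b * x $ a * v $ c * w $ d = - (Rc a b c d z * x $ a * y $ b * v $ c * w $ d)" for a b c d
    unfolding *(1)[of b a c d] by simp
  have 2: "Rc a b d c z * x $ a * y $ b * w $ d * v $ c = - (Rc a b c d z * x $ a * y $ b * v $ c * w $ d)" for a b c d
    unfolding *(2)[of a b d c] by simp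
  have "Riem g z y x v w = (\<Sum>a\<in>UNIV. \<Sum>b\<in>UNIV. \<Sum>c\<in>UNIV. \<Sum>d\<in>UNIV. Rc b a c d z * y $ b * x $ a * v $ c * w $ d)"
    unfolding Riem_def curv_eq[OF z] by (rule sum.swap)
  then show "Riem g z y x v w = - Riem g z x y v w"
    unfolding 1 sum_negf by (simp only: Riem_def curv_eq[OF z])
  have "Riem g z x y w v = (\<Sum>a\<in>UNIV. \<Sum>b\<in>UNIV. \<Sum>c\<in>UNIV. \<Sum>d\<in>UNIV. Rc a b d c z * x $ a * y $ b * w $ d * v $ c)"
    unfolding Riem_def curv_eq[OF z] by (intro sum.cong refl sum.swap)
  then show "Riem g z x y w v = - Riem g z x y v w"
    unfolding 2 sum_negf by (simp only: Riem_def curv_eq[OF z])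
qed

fun Rfull :: "complex^'n \<Rightarrow> 'n + 'n \<Rightarrow> 'n + 'n \<Rightarrow> 'n + 'n \<Rightarrow> 'n + 'n \<Rightarrow> complex" where
  "Rfull z (Inl a) (Inr b) (Inl c) (Inr d) = Rf z b d a c"
| "Rfull z (Inr b) (Inl a) (Inl c) (Inr d) = - Rf z b d a c"
| "Rfull z (Inl a) (Inr b) (Inr d) (Inl c) = - Rf z b d a c"
| "Rfull z (Inr b) (Inl a) (Inr d) (Inl c) = Rf z b d a c"
| "Rfull z _ _ _ _ = 0"

lemma Riem_full_frame:
  assumes z: "z \<in> W"
  shows "Riem g z (full_frame (Z z) a) (full_frame (Z z) b) (full_frame (Z z) c) (full_frame (Z z) d) = Rfull z a b c d"
proof -
  have same: "Riem g z (hol_vec u) (hol_vec v) x y = 0" "Riem g z (antihol_vec u) (antihol_vec v) x y = 0"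
    "Riem g z x y (hol_vec u) (hol_vec v) = 0" "Riem g z x y (antihol_vec u) (antihol_vec v) = 0" for u v x y
    by (simp_all add: Riem_def curv_eq[OF z] sum_UNIV_Plus hol_vec_def antihol_vec_def)
  have swap: "Riem g z (antihol_vec u) (hol_vec v) x y = - Riem g z (hol_vec v) (antihol_vec u) x y"
    "Riem g z x y (antihol_vec u) (hol_vec v) = - Riem g z x y (hol_vec v) (antihol_vec u)" for u v x y
    by (rule Riem_swap[OF z])+
  show ?thesis
    by (cases "(z, a, b, c, d)" rule: Rfull.cases) (simp_all add: same swap Riem_frame[OF z] Rf_def)
qed

lemma Riem_sum:
  "Riem g z (\<Sum>\<gamma>\<in>UNIV. k \<gamma> *s u \<gamma>) y v w = (\<Sum>\<gamma>\<in>UNIV. k \<gamma> * Riem g z (u \<gamma>) y v w)"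
  "Riem g z y (\<Sum>\<gamma>\<in>UNIV. k \<gamma> *s u \<gamma>) v w = (\<Sum>\<gamma>\<in>UNIV. k \<gamma> * Riem g z y (u \<gamma>) v w)"
  "Riem g z y v (\<Sum>\<gamma>\<in>UNIV. k \<gamma> *s u \<gamma>) w = (\<Sum>\<gamma>\<in>UNIV. k \<gamma> * Riem g z y v (u \<gamma>) w)"
  "Riem g z y v w (\<Sum>\<gamma>\<in>UNIV. k \<gamma> *s u \<gamma>) = (\<Sum>\<gamma>\<in>UNIV. k \<gamma> * Riem g z y v w (u \<gamma>))"
  for k :: "'n \<Rightarrow> complex"
  unfolding Riem_def sum_component vector_smult_component sum_distrib_left sum_distrib_right sum.cartesian_product
  by (rule sum.reindex_bij_witness[of _ "\<lambda>(\<gamma>,a,b,c,d). (a,b,c,d,\<gamma>)" "\<lambda>(a,b,c,d,\<gamma>). (\<gamma>,a,b,c,d)"]; auto simp: mult_ac)+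

text \<open>The matrix of \<open>tensor_map\<close> in the full frame; its image is of type (1,0),
  so one index of the frame suffices for the target.\<close>

fun tmat :: "complex^('n \<times> 'n) \<Rightarrow> 'n + 'n \<Rightarrow> 'n \<Rightarrow> complex" where
  "tmat h (Inl \<alpha>) \<gamma> = 0"
| "tmat h (Inr \<alpha>) \<gamma> = h $ (\<alpha>, \<gamma>)"

lemma tensor_map_full_frame:
  assumes z: "z \<in> W"
  shows "tensor_map g z (Z z) h (full_frame (Z z) a) = (\<Sum>\<gamma>\<in>UNIV. tmat h a \<gamma> *s full_frame (Z z) (Inl \<gamma>))"
proof (cases a)
  case (Inl \<alpha>)
  have "metric_ext g z (hol_vec u) (hol_vec v) = 0" for u v
    by (simp add: metric_ext_def sum_UNIV_Plus hol_vec_def metric_mat_blocks[OF z])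
  then show ?thesis by (simp add: Inl tensor_map_def)
next
  case (Inr \<alpha>)
  have "metric_ext g z (hol_vec (Z z \<beta>)) (antihol_vec (Z z \<alpha>)) = (if \<beta> = \<alpha> then 1 else 0)" for \<beta>
    using frame z by (simp add: unitary_frame_on_def unitary_basis_at_def)
  then have "tensor_map g z (Z z) h (full_frame (Z z) a)
    = (\<Sum>\<beta>\<in>UNIV. if \<beta> = \<alpha> then (\<Sum>\<gamma>\<in>UNIV. h $ (\<beta>, \<gamma>) *s hol_vec (Z z \<gamma>)) else 0)"
    unfolding tensor_map_def Inr full_frame.simps by (intro sum.cong refl) simp
  then show ?thesis by (simp add: Inr)
qed

lemma Rf_upper: "z \<in> W \<Longrightarrow> Rf z b d a c = Rf z d b a c"
  and Rf_lower: "z \<in> W \<Longrightarrow> Rf z b d a c = Rf z b d c a"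
proof -
  assume z: "z \<in> W"
  show "Rf z b d a c = Rf z d b a c"
    unfolding Rf_def frm_def frame4_def sum.cartesian_product
    by (rule sum.reindex_bij_witness[of _ "\<lambda>(b,d,a,c). (d,b,a,c)" "\<lambda>(b,d,a,c). (d,b,a,c)"])
      (auto simp: mult_ac A_sym_upper[OF z])
  show "Rf z b d a c = Rf z b d c a"
    unfolding Rf_def frm_def frame4_def sum.cartesian_product
    by (rule sum.reindex_bij_witness[of _ "\<lambda>(b,d,a,c). (b,d,c,a)" "\<lambda>(b,d,a,c). (b,d,c,a)"])
      (auto simp: mult_ac A_sym_lower[OF z])
qed

lemma Rf_herm: "z \<in> W \<Longrightarrow> cnj (Rf z b d a c) = Rf z a c b d"
  unfolding Rf_def by (simp add: Riem_frame[symmetric] cnj_Riem)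

text \<open>\<open>S\<close> turns a barred argument into an unbarred one and the curvature has two
  bars, so the action lives on components with three bars. The one unbarred slot has four positions,
  and by the symmetries of the curvature each contributes the same sum: hence the 4.\<close>

lemma tensor_norm_sq_action:
  assumes z: "z \<in> W"
  defines "act \<equiv> \<lambda>h x y c d. \<Sum>\<gamma>\<in>UNIV. h $ (x, \<gamma>) * Rf z y d \<gamma> c"
  shows "tensor_norm_sq (Z z) (tensor_action (tensor_map g z (Z z) h) (Riem g z))
    = 4 * (\<Sum>x\<in>UNIV. \<Sum>y\<in>UNIV. \<Sum>c\<in>UNIV. \<Sum>d\<in>UNIV. (cmod (act h x y c d - act h y x c d))\<^sup>2)"
proof -
  let ?e = "full_frame (Z z)"
  let ?T = "\<lambda>a b c d. - (\<Sum>\<gamma>\<in>UNIV. tmat h a \<gamma> * Rfull z (Inl \<gamma>) b c d) - (\<Sum>\<gamma>\<in>UNIV. tmat h b \<gamma> * Rfull z a (Inl \<gamma>) c d)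
      - (\<Sum>\<gamma>\<in>UNIV. tmat h c \<gamma> * Rfull z a b (Inl \<gamma>) d) - (\<Sum>\<gamma>\<in>UNIV. tmat h d \<gamma> * Rfull z a b c (Inl \<gamma>))"
  have T: "tensor_action (tensor_map g z (Z z) h) (Riem g z) (?e a) (?e b) (?e c) (?e d) = ?T a b c d" for a b c d
    unfolding tensor_action_def tensor_map_full_frame[OF z] Riem_sum Riem_full_frame[OF z] ..
  have F: "(\<Sum>\<gamma>\<in>UNIV. h $ (x, \<gamma>) * Rf z d y c \<gamma>) = act h x y c d"
    "(\<Sum>\<gamma>\<in>UNIV. h $ (x, \<gamma>) * Rf z y d \<gamma> c) = act h x y c d" for x y c d
    unfolding act_def using Rf_upper[OF z, of d y] Rf_lower[OF z, of y d c] by simp_all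
  define D where "D x y c d = (cmod (act h x y c d - act h y x c d))\<^sup>2" for x y c d
  have D: "D y x c d = D x y c d" for x y c d
    unfolding D_def by (simp add: norm_minus_commute)
  have blocks: "(cmod (?T (Inr x) (Inr y) (Inl c) (Inr d)))\<^sup>2 = D x y c d"
     "(cmod (?T (Inr x) (Inr y) (Inr d) (Inl c)))\<^sup>2 = D x y c d"
     "(cmod (?T (Inl c) (Inr d) (Inr x) (Inr y)))\<^sup>2 = D x y c d"
     "(cmod (?T (Inr d) (Inl c) (Inr x) (Inr y)))\<^sup>2 = D x y c d" for x y c d
    by (simp_all add: F sum_negf D_def[symmetric] D[of y x])
  \<comment> \<open>These are the remaining twelve of the sixteen patterns of bars: those with at
    least two unbarred arguments or with none.\<close>
  have zero: "?T (Inl a) (Inl b) k l = 0" "?T k l (Inl a) (Inl b) = 0"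
    "?T (Inl a) (Inr b) (Inl c) (Inr d) = 0" "?T (Inl a) (Inr b) (Inr d) (Inl c) = 0"
    "?T (Inr b) (Inl a) (Inl c) (Inr d) = 0" "?T (Inr b) (Inl a) (Inr d) (Inl c) = 0"
    "?T (Inr a) (Inr b) (Inr c) (Inr d) = 0" for a b c d k l
    by (cases k; cases l; simp; fail)+
  have "tensor_norm_sq (Z z) (tensor_action (tensor_map g z (Z z) h) (Riem g z))
    = (\<Sum>x\<in>UNIV. \<Sum>y\<in>UNIV. \<Sum>c\<in>UNIV. \<Sum>d\<in>UNIV. D x y c d) + (\<Sum>x\<in>UNIV. \<Sum>y\<in>UNIV. \<Sum>d\<in>UNIV. \<Sum>c\<in>UNIV. D x y c d)
    + (\<Sum>c\<in>UNIV. \<Sum>d\<in>UNIV. \<Sum>x\<in>UNIV. \<Sum>y\<in>UNIV. D x y c d) + (\<Sum>d\<in>UNIV. \<Sum>c\<in>UNIV. \<Sum>x\<in>UNIV. \<Sum>y\<in>UNIV. D x y c d)"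
    unfolding tensor_norm_sq_def T sum_UNIV_Plus
    by (simp only: blocks zero norm_zero power_zero_numeral sum.distrib sum.neutral_const add_0_left add_0_right)
  also have "(\<Sum>x\<in>UNIV. \<Sum>y\<in>UNIV. \<Sum>d\<in>UNIV. \<Sum>c\<in>UNIV. D x y c d) = (\<Sum>x\<in>UNIV. \<Sum>y\<in>UNIV. \<Sum>c\<in>UNIV. \<Sum>d\<in>UNIV. D x y c d)"
    by (intro sum.cong refl sum.swap)
  also have "(\<Sum>d\<in>UNIV. \<Sum>c\<in>UNIV. \<Sum>x\<in>UNIV. \<Sum>y\<in>UNIV. D x y c d) = (\<Sum>c\<in>UNIV. \<Sum>d\<in>UNIV. \<Sum>x\<in>UNIV. \<Sum>y\<in>UNIV. D x y c d)"
    by (rule sum.swap)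
  also have "(\<Sum>c\<in>UNIV. \<Sum>d\<in>UNIV. \<Sum>x\<in>UNIV. \<Sum>y\<in>UNIV. D x y c d) = (\<Sum>x\<in>UNIV. \<Sum>y\<in>UNIV. \<Sum>c\<in>UNIV. \<Sum>d\<in>UNIV. D x y c d)"
    unfolding sum.cartesian_product
    by (rule sum.reindex_bij_witness[of _ "\<lambda>(x,y,c,d). (c,d,x,y)" "\<lambda>(c,d,x,y). (x,y,c,d)"]) auto
  finally show ?thesis by (simp add: D_def)
qed

section \<open>Assembly of the formula\<close>

lemma Ric_L_calabi:
  fixes I :: "'i set"
  assumes z: "z \<in> W"
    and ric: "\<And>y \<alpha> \<beta>. y \<in> W \<Longrightarrow>
      Ricci g y (Z y) \<alpha> \<beta> = lam * metric_ext g y (hol_vec (Z y \<alpha>)) (antihol_vec (Z y \<beta>))"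
    and basis: "unitary_basis_of S20 I S"
    and eigen: "\<And>B. B \<in> I \<Longrightarrow> Calabi g z (Z z) (S B) = complex_of_real (\<sigma> B) *s S B"
  shows "Ric_L g Z z = 4 * (\<Sum>B\<in>I. of_real (\<sigma> B *
        tensor_norm_sq (Z z) (tensor_action (tensor_map g z (Z z) (S B)) (Riem g z))))
      + 16 * trace_on S20 (Calabi g z (Z z) ^^ 3) - 16 * lam * trace_on S20 (Calabi g z (Z z) ^^ 2)"
proof -
  have C: "Calabi g z (Z z) h = (\<chi> p. \<Sum>\<alpha>\<in>UNIV. \<Sum>\<gamma>\<in>UNIV. Rf z (fst p) (snd p) \<alpha> \<gamma> * h $ (\<alpha>, \<gamma>))" for h
    by (simp add: Calabi_def Riem_frame[OF z] Rf_def)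
  have r: "(\<Sum>c\<in>UNIV. Rf z c b c a) = (if b = a then lam else 0)" for a b
  proof -
    have "(\<Sum>c\<in>UNIV. Rf z c b c a) = (\<Sum>c\<in>UNIV. Rf z b c a c)"
      using Rf_upper[OF z] Rf_lower[OF z] by metis
    also have "\<dots> = Ricci g z (Z z) a b"
      by (simp add: Ricci_def Riem_frame[OF z] Rf_def)
    also have "\<dots> = lam * (if a = b then 1 else 0)"
      using frame z ric[OF z, of a b] by (simp add: unitary_frame_on_def unitary_basis_at_def)
    finally show ?thesis by auto
  qed
  interpret calabi_eigenbasis "Rf z" "Calabi g z (Z z)" I S \<sigma> lam
    by unfold_locales (rule Rf_upper[OF z] Rf_lower[OF z] Rf_herm[OF z] r C basis eigen; assumption?)+
  have "(\<Sum>B\<in>I. complex_of_real (\<sigma> B *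
        tensor_norm_sq (Z z) (tensor_action (tensor_map g z (Z z) (S B)) (Riem g z))))
     = 4 * (2 * lam * tr2 (Rf z) (Rf z) - 2 * tr2 (twist4 (Rf z) (Rf z)) (Rf z))"
    unfolding tensor_norm_sq_action[OF z] sum_eigenvalue_action[symmetric] act_def
    by (simp add: sum_distrib_left mult_ac)
  note action = this
  have "Ric_L g Z z = 16 * (lam * tr2 (Rf z) (Rf z) + tr2 (comp4 (Rf z) (Rf z)) (Rf z)
      - 2 * tr2 (twist4 (Rf z) (Rf z)) (Rf z))"
    by (rule Ric_L_einstein[OF z ric])
  then show ?thesis
    unfolding action trace_C2 trace_C3 by (simp add: algebra_simps)
qed

end

lemma kaehler_metric_on_subset:
  assumes "kaehler_metric_on g V" "W \<subseteq> V"
  shows "kaehler_metric_on g W"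
proof -
  have "smooth_on (\<lambda>z. g z u v) W" for u v
  proof (rule smooth_on_subset[OF _ assms(2)])
    show "smooth_on (\<lambda>z. g z u v) V"
      using assms(1) unfolding kaehler_metric_on_def hermitian_metric_on_def by simp
  qed
  then show ?thesis
    using assms(1) subsetD[OF assms(2)]
    unfolding kaehler_metric_on_def hermitian_metric_on_def by simp
qed

theorem theorem2:
  fixes M :: "('m::{t2_space,second_countable_topology}) set"
    and atlas :: "('m, 'n::finite) chart set"
    and g :: "('m, 'n) chart \<Rightarrow> 'n metric"
    and lam :: real
    and c :: "('m, 'n) chart"
    and W :: "(complex^'n) set"
    and Z :: "complex^'n \<Rightarrow> 'n \<Rightarrow> complex^'n"
    and p :: 'm
    and I :: "'i set"
    and S :: "'i \<Rightarrow> complex^('n \<times> 'n)"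
    and \<sigma> :: "'i \<Rightarrow> real"
  assumes "kaehler_einstein_manifold M atlas g lam"
    and "c \<in> atlas" and "p \<in> fst c"
    and "W \<subseteq> snd c ` fst c" and "snd c p \<in> W"
    and "unitary_frame_on (g c) W Z"
    and "unitary_basis_of S20 I S"
    and "\<And>A. A \<in> I \<Longrightarrow>
           Calabi (g c) (snd c p) (Z (snd c p)) (S A) = complex_of_real (\<sigma> A) *s S A"
  shows "Ric_L (g c) Z (snd c p) =
      4 * (\<Sum>A\<in>I. of_real (\<sigma> A *
             tensor_norm_sq (Z (snd c p))
               (tensor_action (tensor_map (g c) (snd c p) (Z (snd c p)) (S A))
                  (Riem (g c) (snd c p)))))
      + 16 * trace_on S20 (Calabi (g c) (snd c p) (Z (snd c p)) ^^ 3)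
      - 16 * of_real lam * trace_on S20 (Calabi (g c) (snd c p) (Z (snd c p)) ^^ 2)"
proof -
  have "kaehler_metric_on (g c) (snd c ` fst c)"
    using assms(1,2) by (simp add: kaehler_einstein_manifold_def kaehler_manifold_def)
  from kaehler_metric_on_subset[OF this assms(4)] have "kaehler_metric_on (g c) W" .
  then interpret kaehler_chart W "g c" Z
    by unfold_locales (simp_all add: assms(6))
  show ?thesis
  proof (rule Ric_L_calabi[OF assms(5) _ assms(7,8)])
    \<comment> \<open>The Einstein condition is required throughout \<open>W\<close> and not just at
      the chosen point, since the Ricci contraction gets differentiated.\<close>
    fix y \<alpha> \<beta>
    assume "y \<in> W"
    then have "y \<in> snd c ` fst c" "unitary_basis_at (g c) y (Z y)"
      using assms(4,6) by (auto simp: unitary_frame_on_def)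
    then show "Ricci (g c) y (Z y) \<alpha> \<beta>
        = complex_of_real lam * metric_ext (g c) y (hol_vec (Z y \<alpha>)) (antihol_vec (Z y \<beta>))"
      using assms(1,2) unfolding kaehler_einstein_manifold_def by blast
  qed
qed

end
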